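(* Let $E$ be a punctual equivalence structure which is relatively $\Delta^0_2$-categorical but not relatively $\Delta^0_1$-categorical. Then $\mathrm{PrCat}(E)=\mathrm{Cone}(\Delta^0_2)$.
   Context: An equivalence structure is a set with one equivalence relation. A structure is punctual if its domain is $\omega$ and its relations and functions are uniformly primitive recursive. A computable structure $A$ is relatively $\Delta^0_\alpha$-categorical if for every copy $B\cong A$ with domain $\omega$ there is an isomorphism $f:B\to A$ with $f\in\Delta^0_\alpha$ relative to the atomic diagram of $B$. For total $f,g:\omega\to\omega$, write $f\le_{PR}g$ if $f$ is primitive recursive relative to $g$ (i.e. $f=\Psi^g$ for some primitive recursive scheme $\Psi$); the induced equivalence classes are PR-degrees, and $f\le_{PR}\mathbf d$ means $f\le_{PR}$ a member of $\mathbf d$. For a punctual structure $A$, $\mathrm{PrCat}(A)$ is the set of PR-degrees $\mathbf d$ such that for every punctual $B\cong A$ there is an isomorphism $f:A\to B$ with $f\le_{PR}\mathbf d$ and $f^{-1}\le_{PR}\mathbf d$. For a computable ordinal $\alpha>0$, $\mathrm{Cone}(\Delta^0_\alpha)$ is the set of PR-degrees $\mathbf d$ such that $f\le_{PR}\mathbf d$ for every total $\Delta^0_\alpha$ function $f:\omega\to\omega$. *)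

theory Defs
  imports Main "HOL-Library.Nat_Bijection"
begin

text \<open>
  An \<open>n\<close>-ary function on the natural numbers is a function on lists of which only the values on
  lists of length \<open>n\<close> matter.  The oracle is a unary function \<open>g\<close>; unrelativised notions are obtained
  with the constantly zero oracle, which adds nothing to the initial functions.
\<close>

inductive prim_rec_in :: "(nat \<Rightarrow> nat) \<Rightarrow> nat \<Rightarrow> (nat list \<Rightarrow> nat) \<Rightarrow> bool"
  for g :: "nat \<Rightarrow> nat"
where
  zero: "prim_rec_in g n (\<lambda>xs. 0)"
| succ: "prim_rec_in g 1 (\<lambda>xs. Suc (hd xs))"
| proj: "i < n \<Longrightarrow> prim_rec_in g n (\<lambda>xs. xs ! i)"
| orcl: "prim_rec_in g 1 (\<lambda>xs. g (hd xs))"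
| comp: "prim_rec_in g (length Hs) F \<Longrightarrow> (\<forall>H\<in>set Hs. prim_rec_in g n H) \<Longrightarrow>
    prim_rec_in g n (\<lambda>xs. F (map (\<lambda>H. H xs) Hs))"
| prec: "prim_rec_in g n F \<Longrightarrow> prim_rec_in g (n + 2) H \<Longrightarrow>
    prim_rec_in g (Suc n)
      (\<lambda>xs. rec_nat (F (tl xs)) (\<lambda>k r. H (k # r # tl xs)) (hd xs))"

text \<open>
  Total recursive functions relative to \<open>g\<close>: additionally closed under minimisation, applied only
  when a zero always exists (so that all functions in the class are total).
\<close>

inductive recursive_in :: "(nat \<Rightarrow> nat) \<Rightarrow> nat \<Rightarrow> (nat list \<Rightarrow> nat) \<Rightarrow> bool"
  for g :: "nat \<Rightarrow> nat"
where
  zero: "recursive_in g n (\<lambda>xs. 0)"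
| succ: "recursive_in g 1 (\<lambda>xs. Suc (hd xs))"
| proj: "i < n \<Longrightarrow> recursive_in g n (\<lambda>xs. xs ! i)"
| orcl: "recursive_in g 1 (\<lambda>xs. g (hd xs))"
| comp: "recursive_in g (length Hs) F \<Longrightarrow> (\<forall>H\<in>set Hs. recursive_in g n H) \<Longrightarrow>
    recursive_in g n (\<lambda>xs. F (map (\<lambda>H. H xs) Hs))"
| prec: "recursive_in g n F \<Longrightarrow> recursive_in g (n + 2) H \<Longrightarrow>
    recursive_in g (Suc n)
      (\<lambda>xs. rec_nat (F (tl xs)) (\<lambda>k r. H (k # r # tl xs)) (hd xs))"
| minim: "recursive_in g (Suc n) F \<Longrightarrow>
    (\<forall>xs. length xs = n \<longrightarrow> (\<exists>y. F (y # xs) = 0)) \<Longrightarrow>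
    recursive_in g n (\<lambda>xs. LEAST y. F (y # xs) = 0)"

text \<open>
  The arithmetical hierarchy relative to \<open>g\<close>, for \<open>k\<close>-ary relations.  Level \<open>0\<close> consists of the
  relations recursive in \<open>g\<close>; the negation in the successor step makes the matrix range over the
  complements of \<open>\<Sigma>\<^sup>0\<^sub>n\<close> relations, i.e. over the \<open>\<Pi>\<^sup>0\<^sub>n\<close> relations.
\<close>

primrec Sigma0_in :: "(nat \<Rightarrow> nat) \<Rightarrow> nat \<Rightarrow> nat \<Rightarrow> (nat list \<Rightarrow> bool) \<Rightarrow> bool" where
  "Sigma0_in g 0 = (\<lambda>k R. \<exists>F. recursive_in g k F \<and>
      (\<forall>xs. length xs = k \<longrightarrow> F xs = of_bool (R xs)))"
| "Sigma0_in g (Suc n) = (\<lambda>k R. \<exists>S. Sigma0_in g n (Suc k) S \<and>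
      (\<forall>xs. length xs = k \<longrightarrow> (R xs \<longleftrightarrow> (\<exists>y. \<not> S (y # xs)))))"

definition Pi0_in :: "(nat \<Rightarrow> nat) \<Rightarrow> nat \<Rightarrow> nat \<Rightarrow> (nat list \<Rightarrow> bool) \<Rightarrow> bool" where
  "Pi0_in g n k R \<longleftrightarrow> Sigma0_in g n k (\<lambda>xs. \<not> R xs)"

definition Delta0_in :: "(nat \<Rightarrow> nat) \<Rightarrow> nat \<Rightarrow> nat \<Rightarrow> (nat list \<Rightarrow> bool) \<Rightarrow> bool" where
  "Delta0_in g n k R \<longleftrightarrow> Sigma0_in g n k R \<and> Pi0_in g n k R"

text \<open>A total function is \<open>\<Delta>\<^sup>0\<^sub>n\<close> relative to \<open>g\<close> if its graph is.\<close>

definition Delta0_fun_in :: "(nat \<Rightarrow> nat) \<Rightarrow> nat \<Rightarrow> (nat \<Rightarrow> nat) \<Rightarrow> bool" where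
  "Delta0_fun_in g n f \<longleftrightarrow> Delta0_in g n 2 (\<lambda>xs. xs ! 1 = f (xs ! 0))"

definition pr_le :: "(nat \<Rightarrow> nat) \<Rightarrow> (nat \<Rightarrow> nat) \<Rightarrow> bool"  (infix "\<le>PR" 50) where
  "f \<le>PR g \<longleftrightarrow> (\<exists>F. prim_rec_in g 1 F \<and> (\<forall>x. F [x] = f x))"

definition pr_equiv :: "((nat \<Rightarrow> nat) \<times> (nat \<Rightarrow> nat)) set" where
  "pr_equiv = {(f, g). f \<le>PR g \<and> g \<le>PR f}"

definition pr_degrees :: "(nat \<Rightarrow> nat) set set" where
  "pr_degrees = UNIV // pr_equiv"

definition pr_le_degree :: "(nat \<Rightarrow> nat) \<Rightarrow> (nat \<Rightarrow> nat) set \<Rightarrow> bool"  (infix "\<le>PRd" 50) where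
  "f \<le>PRd d \<longleftrightarrow> (\<exists>g\<in>d. f \<le>PR g)"

text \<open>Structures with domain \<open>\<omega>\<close> and one binary relation are given by that relation.\<close>

definition punctual :: "(nat \<Rightarrow> nat \<Rightarrow> bool) \<Rightarrow> bool" where
  "punctual A \<longleftrightarrow> (\<exists>F. prim_rec_in (\<lambda>_. 0) 2 F \<and> (\<forall>x y. F [x, y] = of_bool (A x y)))"

definition punctual_equivalence_structure :: "(nat \<Rightarrow> nat \<Rightarrow> bool) \<Rightarrow> bool" where
  "punctual_equivalence_structure E \<longleftrightarrow> equivp E \<and> punctual E"

definition is_iso :: "(nat \<Rightarrow> nat \<Rightarrow> bool) \<Rightarrow> (nat \<Rightarrow> nat \<Rightarrow> bool) \<Rightarrow> (nat \<Rightarrow> nat) \<Rightarrow> bool" where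
  "is_iso A B f \<longleftrightarrow> bij f \<and> (\<forall>x y. A x y \<longleftrightarrow> B (f x) (f y))"

definition isomorphic :: "(nat \<Rightarrow> nat \<Rightarrow> bool) \<Rightarrow> (nat \<Rightarrow> nat \<Rightarrow> bool) \<Rightarrow> bool" where
  "isomorphic A B \<longleftrightarrow> (\<exists>f. is_iso A B f)"

text \<open>
  The atomic diagram as an oracle, coded with the Cantor pairing function.  The equality atoms are
  decidable without an oracle and are therefore omitted.
\<close>

definition atomic_diagram :: "(nat \<Rightarrow> nat \<Rightarrow> bool) \<Rightarrow> nat \<Rightarrow> nat" where
  "atomic_diagram B c = of_bool (case prod_decode c of (x, y) \<Rightarrow> B x y)"

definition relatively_Delta0_categorical :: "nat \<Rightarrow> (nat \<Rightarrow> nat \<Rightarrow> bool) \<Rightarrow> bool" where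
  "relatively_Delta0_categorical n A \<longleftrightarrow>
    (\<forall>B. isomorphic B A \<longrightarrow> (\<exists>f. is_iso B A f \<and> Delta0_fun_in (atomic_diagram B) n f))"

definition PrCat :: "(nat \<Rightarrow> nat \<Rightarrow> bool) \<Rightarrow> (nat \<Rightarrow> nat) set set" where
  "PrCat A = {d \<in> pr_degrees. \<forall>B. punctual B \<and> isomorphic B A \<longrightarrow>
      (\<exists>f. is_iso A B f \<and> f \<le>PRd d \<and> inv f \<le>PRd d)}"

definition Cone_Delta0 :: "nat \<Rightarrow> (nat \<Rightarrow> nat) set set" where
  "Cone_Delta0 n = {d \<in> pr_degrees. \<forall>f. Delta0_fun_in (\<lambda>_. 0) n f \<longrightarrow> f \<le>PRd d}"

lemma pr_le_refl: "f \<le>PR f"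
  unfolding pr_le_def using prim_rec_in.orcl[of f] by (intro exI) auto

lemma prim_rec_in_trans:
  assumes "prim_rec_in g n F" and "g \<le>PR h"
  shows "\<exists>F'. prim_rec_in h n F' \<and> (\<forall>xs. length xs = n \<longrightarrow> F' xs = F xs)"
  using assms(1)
proof induction
  case (zero n) show ?case using prim_rec_in.zero[of h n] by blast
next
  case succ show ?case using prim_rec_in.succ[of h] by blast
next
  case (proj i n) then show ?case using prim_rec_in.proj[of i n h] by blast
next
  case orcl
  obtain G where G: "prim_rec_in h 1 G" "\<forall>x. G [x] = g x"
    using assms(2) unfolding pr_le_def by blast
  have "G xs = g (hd xs)" if "length xs = 1" for xs
    using that G(2) by (cases xs) auto
  with G(1) show ?case by blast
next
  case (comp Hs F n)
  obtain F' where F': "prim_rec_in h (length Hs) F'"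
    "\<And>xs. length xs = length Hs \<Longrightarrow> F' xs = F xs" using comp by blast
  have "\<forall>H\<in>set Hs. \<exists>H'. prim_rec_in h n H' \<and> (\<forall>xs. length xs = n \<longrightarrow> H' xs = H xs)"
    using comp by blast
  then obtain c where c: "\<And>H. H \<in> set Hs \<Longrightarrow> prim_rec_in h n (c H)"
    "\<And>H xs. H \<in> set Hs \<Longrightarrow> length xs = n \<Longrightarrow> c H xs = H xs" by metis
  have "prim_rec_in h n (\<lambda>xs. F' (map (\<lambda>H. H xs) (map c Hs)))"
    using F'(1) c(1) by (intro prim_rec_in.comp) auto
  moreover have "F' (map (\<lambda>H. H xs) (map c Hs)) = F (map (\<lambda>H. H xs) Hs)"
    if "length xs = n" for xs
  proof -
    have eq: "map (\<lambda>H. H xs) (map c Hs) = map (\<lambda>H. H xs) Hs" using c(2) that by simp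
    show ?thesis by (subst eq) (simp add: F'(2))
  qed
  ultimately show ?case by blast
next
  case (prec n F H)
  obtain F' where F': "prim_rec_in h n F'" "\<And>xs. length xs = n \<Longrightarrow> F' xs = F xs"
    using prec by blast
  obtain H' where H': "prim_rec_in h (n + 2) H'" "\<And>xs. length xs = n + 2 \<Longrightarrow> H' xs = H xs"
    using prec by blast
  have "rec_nat (F' (tl xs)) (\<lambda>k r. H' (k # r # tl xs)) m
      = rec_nat (F (tl xs)) (\<lambda>k r. H (k # r # tl xs)) m" if "length xs = Suc n" for xs m
    using that by (induction m) (auto simp: F'(2) H'(2))
  then show ?case using prim_rec_in.prec[OF F'(1) H'(1)] by blast
qed

lemma pr_le_trans: "f \<le>PR g \<Longrightarrow> g \<le>PR h \<Longrightarrow> f \<le>PR h"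
  using prim_rec_in_trans[of g 1 _ h] unfolding pr_le_def
  by (metis One_nat_def length_Cons list.size(3))

lemma equiv_pr_equiv: "equiv UNIV pr_equiv"
  by (intro equivI refl_onI symI transI)
    (auto simp: pr_equiv_def intro: pr_le_refl pr_le_trans)

end

(*
  Equivalence structures are determined by the numbers of classes of each size.

  Structure.  If all but finitely many classes have the same size, a bijection matching classes in
  order of appearance is Delta-1 in the copy.  If there are infinitely many infinite classes and
  unboundedly large finite ones, a generic copy has no Delta-2 isomorphism, because a finite
  condition can always be retargeted from an infinite class to a large finite one.  Hence E has
  either, for some k, infinitely many classes of size k and infinitely many larger ones, or
  unboundedly large finite classes and finitely many infinite ones.

  Coding.  Let h be the limit of the primitive recursive function a(x, s), and call s a change for x
  if a(x, s) differs from a(x, s + 1).  In both cases E has a punctual copy A with a primitive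
  recursive sequence of finite classes c(0), c(1), ... such that infinitely many classes are larger
  than each given c(t).  A second punctual copy B copies the classes of A; upon a change s for x, the
  classes j < s of B with x <= j that do not copy one of the first x classes of A are redirected to
  classes of A larger than c(0), ..., c(2 j).  So every isomorphism from A to B maps one of
  c(0), ..., c(2 x) to a class of B with index at least s, for each change s for x.  This bounds all
  changes for x, and hence computes h(x), primitively recursively in the isomorphism.
*)

theory Submission
  imports Defs "HOL-Library.Countable" "HOL-Library.Extended_Nat" "HOL-Library.Sublist"
begin

text \<open>A punctual copy cannot wait, whereas \<open>E\<close> reveals the sizes of its classes
  only in the limit. Copies are therefore given by label sequences: stage \<open>s\<close> opens
  class \<open>s\<close> at once, and only the growth of classes is postponed. A redirection swaps
  the targets of two classes of B, so the limit is a bijection between classes as soon as every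
  index and every target moves finitely often. For indices this is a finite injury argument. For
  targets it is the reason why a change for x spares the classes that copy one of the first x
  classes of A. These at most x exceptions, together with the at most x classes j < x, explain why 2
  x + 1 coding classes are used, and why class j is compared with c up to index 2 j. A class of B
  that has already grown can be sent only to a target that is large enough. Hence all growth from
  the first bad class on is frozen until a class that has not grown yet can be its partner.\<close>

section \<open>Primitive recursive functions of an environment\<close>

text \<open>
  The environment \<open>e\<close> assigns values to variables; an additional bound variable becomes \<open>e 0\<close> and
  shifts the other variables by one.
\<close>

definition PR :: "(nat \<Rightarrow> nat) \<Rightarrow> ((nat \<Rightarrow> nat) \<Rightarrow> nat) \<Rightarrow> bool" where
  "PR g f \<longleftrightarrow> (\<exists>n F. prim_rec_in g n F \<and> (\<forall>e. f e = F (map e [0..<n])))"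

abbreviation PRP :: "(nat \<Rightarrow> nat) \<Rightarrow> ((nat \<Rightarrow> nat) \<Rightarrow> bool) \<Rightarrow> bool" where
  "PRP g P \<equiv> PR g (\<lambda>e. of_bool (P e))"

lemma PR_weaken:
  assumes "prim_rec_in g n F" "n \<le> m"
  shows "\<exists>F'. prim_rec_in g m F' \<and> (\<forall>e. F' (map e [0..<m]) = F (map e [0..<n]))"
proof (intro exI conjI allI)
  let ?Hs = "map (\<lambda>i xs. xs ! i) [0..<n]"
  show "prim_rec_in g m (\<lambda>xs. F (map (\<lambda>H. H xs) ?Hs))"
    using assms by (intro prim_rec_in.comp) (auto intro: prim_rec_in.proj)
  fix e :: "nat \<Rightarrow> nat"
  have "map (\<lambda>H. H (map e [0..<m])) ?Hs = map e [0..<n]"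
    using assms(2) by (intro nth_equalityI) auto
  then show "F (map (\<lambda>H. H (map e [0..<m])) ?Hs) = F (map e [0..<n])" by (rule arg_cong)
qed

lemma PR_arity:
  assumes "PR g f"
  shows "\<exists>n. \<forall>m\<ge>n. \<exists>F. prim_rec_in g m F \<and> (\<forall>e. f e = F (map e [0..<m]))"
  using assms PR_weaken unfolding PR_def by metis

text \<open>Only the variables below the arity of \<open>f\<close> matter, so finitely many of the
  \<open>\<sigma> i\<close> are composed. This substitution is what lets the closure rules below
  work on open terms instead of argument lists.\<close>

lemma PR_subst:
  assumes "PR g f" and "\<And>i. PR g (\<sigma> i)"
  shows "PR g (\<lambda>e. f (\<lambda>i. \<sigma> i e))"
proof -
  obtain n F where F: "prim_rec_in g n F" "\<And>e. f e = F (map e [0..<n])"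
    using assms(1) unfolding PR_def by blast
  have "\<forall>i. \<exists>k. \<forall>m\<ge>k. \<exists>G. prim_rec_in g m G \<and> (\<forall>e. \<sigma> i e = G (map e [0..<m]))"
    using PR_arity[OF assms(2)] by blast
  then obtain k where k: "\<And>i m. k i \<le> m \<Longrightarrow>
      \<exists>G. prim_rec_in g m G \<and> (\<forall>e. \<sigma> i e = G (map e [0..<m]))" by metis
  \<comment> \<open>A sum serves as a common upper bound, here and in similar places below.\<close>
  define m where "m = (\<Sum>i<n. k i)"
  have "k i \<le> m" if "i < n" for i
    unfolding m_def using that by (intro member_le_sum) auto
  then have "\<forall>i<n. \<exists>G. prim_rec_in g m G \<and> (\<forall>e. \<sigma> i e = G (map e [0..<m]))"
    using k by blast
  then obtain G where G: "\<And>i. i < n \<Longrightarrow> prim_rec_in g m (G i)"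
    "\<And>i e. i < n \<Longrightarrow> \<sigma> i e = G i (map e [0..<m])" by metis
  have "prim_rec_in g m (\<lambda>xs. F (map (\<lambda>H. H xs) (map G [0..<n])))"
    using F(1) G(1) by (intro prim_rec_in.comp) auto
  moreover have "f (\<lambda>i. \<sigma> i e) = F (map (\<lambda>H. H (map e [0..<m])) (map G [0..<n]))" for e
  proof -
    have "map (\<lambda>i. \<sigma> i e) [0..<n] = map (\<lambda>H. H (map e [0..<m])) (map G [0..<n])"
      using G(2) by simp
    then show ?thesis by (simp only: F(2))
  qed
  ultimately show ?thesis unfolding PR_def by blast
qed

lemma PR_var: "PR g (\<lambda>e. e i)"
proof -
  have "prim_rec_in g (Suc i) (\<lambda>xs. xs ! i)" by (intro prim_rec_in.proj) simp
  moreover have "e i = map e [0..<Suc i] ! i" for e :: "nat \<Rightarrow> nat"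
    by (simp only: nth_map_upt) (simp del: upt_Suc)
  ultimately show ?thesis unfolding PR_def by blast
qed

lemma PR_zero: "PR g (\<lambda>e. 0)"
  unfolding PR_def using prim_rec_in.zero by blast

lemma PR_subst1:
  assumes "PR g (\<lambda>e. f (e 0))" "PR g a"
  shows "PR g (\<lambda>e. f (a e))"
  using PR_subst[OF assms(1), of "\<lambda>i. a"] assms(2) by simp

lemma PR_subst2:
  assumes "PR g (\<lambda>e. f (e 0) (e 1))" "PR g a" "PR g b"
  shows "PR g (\<lambda>e. f (a e) (b e))"
proof -
  have "PR g (if i = 0 then a else b)" for i :: nat using assms by simp
  from PR_subst[OF assms(1), of "\<lambda>i. if i = 0 then a else b", OF this] show ?thesis by simp
qed

lemma PR_subst3:
  assumes "PR g (\<lambda>e. f (e 0) (e 1) (e 2))" "PR g a" "PR g b" "PR g c"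
  shows "PR g (\<lambda>e. f (a e) (b e) (c e))"
proof -
  have "PR g (if i = 0 then a else if i = 1 then b else c)" for i :: nat using assms by simp
  from PR_subst[OF assms(1), of "\<lambda>i. if i = 0 then a else if i = 1 then b else c", OF this]
  show ?thesis by simp
qed

lemma PR_Suc:
  assumes "PR g a" shows "PR g (\<lambda>e. Suc (a e))"
proof -
  have "PR g (\<lambda>e. Suc (e 0))"
    unfolding PR_def using prim_rec_in.succ[of g] by (intro exI[of _ 1] exI conjI) auto
  from PR_subst1[OF this assms] show ?thesis .
qed

lemma PR_oracle:
  assumes "PR g a" shows "PR g (\<lambda>e. g (a e))"
proof -
  have "PR g (\<lambda>e. g (e 0))"
    unfolding PR_def using prim_rec_in.orcl[of g] by (intro exI[of _ 1] exI conjI) auto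
  from PR_subst1[OF this assms] show ?thesis .
qed

lemma PR_const: "PR g (\<lambda>e. c)"
  by (induction c) (auto intro: PR_zero PR_Suc)

lemma PR_rec:
  assumes "PR g z" "PR g (\<lambda>e. h (e 0) (e 1) (\<lambda>i. e (i + 2)))" "PR g a"
  shows "PR g (\<lambda>e. rec_nat (z e) (\<lambda>k r. h k r e) (a e))"
proof -
  obtain n where n: "\<And>m. n \<le> m \<Longrightarrow> \<exists>F. prim_rec_in g m F \<and> (\<forall>e. z e = F (map e [0..<m]))"
    using PR_arity[OF assms(1)] by blast
  obtain k where k: "\<And>m. k \<le> m \<Longrightarrow> \<exists>F. prim_rec_in g m F \<and>
      (\<forall>e. h (e 0) (e 1) (\<lambda>i. e (i + 2)) = F (map e [0..<m]))"
    using PR_arity[OF assms(2)] by blast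
  define m where "m = n + k"
  obtain F where F: "prim_rec_in g m F" "\<And>e. z e = F (map e [0..<m])"
    using n[of m] m_def by auto
  obtain H where H: "prim_rec_in g (m + 2) H"
    "\<And>e. h (e 0) (e 1) (\<lambda>i. e (i + 2)) = H (map e [0..<m + 2])"
    using k[of "m + 2"] m_def by auto
  have H': "h x r e = H (x # r # map e [0..<m])" for x r e
  proof -
    let ?e = "case_nat x (case_nat r e)"
    have "[0..<m + 2] = 0 # 1 # map (\<lambda>i. i + 2) [0..<m]"
      using upt_conv_Cons[of 0 "m + 2"] upt_conv_Cons[of 1 "m + 2"] map_add_upt[of 2 m]
      by (simp add: numeral_2_eq_2)
    then have "map ?e [0..<m + 2] = x # r # map e [0..<m]" by simp
    then show ?thesis using H(2)[of ?e] by simp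
  qed
  \<comment> \<open>The scheme recurses on the head of the list, so the recursion argument is
    variable 0 at first; \<open>a\<close> is substituted for it afterwards.\<close>
  have "prim_rec_in g (Suc m) (\<lambda>xs. rec_nat (F (tl xs)) (\<lambda>k r. H (k # r # tl xs)) (hd xs))"
    by (rule prim_rec_in.prec) (fact F(1) H(1))+
  moreover have "rec_nat (z (\<lambda>i. e (Suc i))) (\<lambda>k r. h k r (\<lambda>i. e (Suc i))) (e 0) =
     rec_nat (F (tl xs)) (\<lambda>k r. H (k # r # tl xs)) (hd xs)"
    if "xs = map e [0..<Suc m]" for e xs
  proof -
    have "xs = e 0 # map (\<lambda>i. e (Suc i)) [0..<m]"
      unfolding that by (simp add: map_upt_Suc del: upt_Suc)
    then show ?thesis by (simp add: F(2) H')
  qed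
  ultimately have *: "PR g (\<lambda>e. rec_nat (z (\<lambda>i. e (Suc i))) (\<lambda>k r. h k r (\<lambda>i. e (Suc i))) (e 0))"
    unfolding PR_def by blast
  have "PR g (case_nat a (\<lambda>i e. e i) i)" for i
    by (cases i) (auto intro: assms PR_var)
  from PR_subst[OF *, of "case_nat a (\<lambda>i e. e i)", OF this] show ?thesis by simp
qed

text \<open>The shifts are written with \<open>Suc\<close>, as in the rules for sums, bounded search
  and bounded quantifiers, so that \<open>intro\<close> unifies goals under nested binders.\<close>

lemma PR_rec':
  assumes "PR g z" "PR g (\<lambda>e. h (e 0) (e (Suc 0)) (\<lambda>i. e (Suc (Suc i))))" "PR g a"
  shows "PR g (\<lambda>e. rec_nat (z e) (\<lambda>k r. h k r e) (a e))"
  using assms by (intro PR_rec) simp_all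

section \<open>Arithmetic, propositional connectives and bounded quantifiers\<close>

lemma PR_add: "PR g a \<Longrightarrow> PR g b \<Longrightarrow> PR g (\<lambda>e. a e + b e)"
proof -
  have *: "rec_nat y (\<lambda>k r. Suc r) x = x + y" for x y by (induction x) auto
  show "PR g a \<Longrightarrow> PR g b \<Longrightarrow> ?thesis"
    unfolding *[symmetric] by (intro PR_rec' PR_Suc PR_var)
qed

lemma PR_mult: "PR g a \<Longrightarrow> PR g b \<Longrightarrow> PR g (\<lambda>e. a e * b e)"
proof -
  have *: "rec_nat 0 (\<lambda>k r. r + y) x = x * y" for x y by (induction x) auto
  have "PR g (\<lambda>e. rec_nat 0 (\<lambda>k r. r + e 1) (e 0))"
    by (intro PR_rec' PR_add PR_var PR_const)
  then have "PR g (\<lambda>e. e 0 * e 1)" unfolding * .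
  then show "PR g a \<Longrightarrow> PR g b \<Longrightarrow> ?thesis" by (rule PR_subst2)
qed

lemma PR_diff: "PR g a \<Longrightarrow> PR g b \<Longrightarrow> PR g (\<lambda>e. a e - b e)"
proof -
  have p: "rec_nat 0 (\<lambda>k r. k) x = x - 1" for x by (cases x) auto
  have "PR g (\<lambda>e. rec_nat 0 (\<lambda>k r. k) (e 0))" by (intro PR_rec' PR_var PR_const)
  then have pred: "PR g (\<lambda>e. e 0 - 1)" unfolding p .
  have *: "rec_nat x (\<lambda>k r. r - 1) y = x - y" for x y by (induction y) auto
  have "PR g (\<lambda>e. rec_nat (e 0) (\<lambda>k r. r - 1) (e 1))"
    by (intro PR_rec' PR_subst1[OF pred] PR_var)
  then have "PR g (\<lambda>e. e 0 - e 1)" unfolding * .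
  then show "PR g a \<Longrightarrow> PR g b \<Longrightarrow> ?thesis" by (rule PR_subst2)
qed

lemma PRP_not: "PRP g P \<Longrightarrow> PRP g (\<lambda>e. \<not> P e)"
proof -
  have *: "of_bool (\<not> P e) = 1 - (of_bool (P e) :: nat)" for e by simp
  show "PRP g P \<Longrightarrow> ?thesis" unfolding * by (intro PR_diff PR_const)
qed

lemma PRP_conj: "PRP g P \<Longrightarrow> PRP g Q \<Longrightarrow> PRP g (\<lambda>e. P e \<and> Q e)"
  by (simp only: of_bool_conj) (intro PR_mult)

lemma PRP_disj: "PRP g P \<Longrightarrow> PRP g Q \<Longrightarrow> PRP g (\<lambda>e. P e \<or> Q e)"
  using PRP_not[OF PRP_conj[OF PRP_not PRP_not], of g P Q] by (simp only: de_Morgan_conj not_not)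

lemma PRP_imp: "PRP g P \<Longrightarrow> PRP g Q \<Longrightarrow> PRP g (\<lambda>e. P e \<longrightarrow> Q e)"
  unfolding imp_conv_disj by (intro PRP_disj PRP_not)

lemma PRP_le: "PR g a \<Longrightarrow> PR g b \<Longrightarrow> PRP g (\<lambda>e. a e \<le> b e)"
proof -
  have *: "of_bool (a e \<le> b e) = 1 - (a e - b e)" for e by (auto simp: of_bool_def)
  show "PR g a \<Longrightarrow> PR g b \<Longrightarrow> ?thesis" unfolding * by (intro PR_diff PR_const)
qed

lemma PRP_less: "PR g a \<Longrightarrow> PR g b \<Longrightarrow> PRP g (\<lambda>e. a e < b e)"
  unfolding not_le[symmetric] by (intro PRP_not PRP_le)

lemma PRP_eq: "PR g a \<Longrightarrow> PR g b \<Longrightarrow> PRP g (\<lambda>e. a e = b e)"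
  unfolding order_eq_iff by (intro PRP_conj PRP_le)

lemma PR_if: "PRP g P \<Longrightarrow> PR g a \<Longrightarrow> PR g b \<Longrightarrow> PR g (\<lambda>e. if P e then a e else b e)"
proof -
  have *: "(if P e then a e else b e) = of_bool (P e) * a e + of_bool (\<not> P e) * b e" for e by simp
  show "PRP g P \<Longrightarrow> PR g a \<Longrightarrow> PR g b \<Longrightarrow> ?thesis"
    unfolding * by (intro PR_mult PR_add PRP_not)
qed

lemma PR_sum:
  assumes "PR g (\<lambda>e. f (e 0) (\<lambda>i. e (Suc i)))" "PR g a"
  shows "PR g (\<lambda>e. \<Sum>y<a e. f y e)"
proof -
  have *: "rec_nat 0 (\<lambda>k r. r + f k e) x = (\<Sum>y<x. f y e)" for x e by (induction x) auto
  \<comment> \<open>Variable 1 is the accumulator of the recursion, so the parameters of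
    \<open>f\<close> are shifted past it.\<close>
  have "PR g (case_nat (\<lambda>e. e 0) (\<lambda>i e. e (i + 2)) i)" for i by (cases i) (auto intro: PR_var)
  from PR_subst[OF assms(1), of "case_nat (\<lambda>e. e 0) (\<lambda>i e. e (i + 2))", OF this]
  have "PR g (\<lambda>e. f (e 0) (\<lambda>i. e (Suc (Suc i))))" by simp
  then have "PR g (\<lambda>e. rec_nat 0 (\<lambda>k r. r + f k e) (a e))"
    by (intro PR_rec' PR_const PR_add PR_var assms(2))
  then show ?thesis unfolding * .
qed

lemma PRP_ex_less:
  assumes "PRP g (\<lambda>e. P (e 0) (\<lambda>i. e (Suc i)))" "PR g a"
  shows "PRP g (\<lambda>e. \<exists>y<a e. P y e)"
proof -
  have *: "(\<exists>y<x. P y e) \<longleftrightarrow> \<not> (\<Sum>y<x. of_bool (P y e) :: nat) = 0" for x e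
    by (subst sum_eq_0_iff) auto
  show ?thesis unfolding * by (intro PRP_not PRP_eq PR_const PR_sum assms)
qed

lemma PRP_all_less:
  assumes "PRP g (\<lambda>e. P (e 0) (\<lambda>i. e (Suc i)))" "PR g a"
  shows "PRP g (\<lambda>e. \<forall>y<a e. P y e)"
proof -
  have *: "(\<forall>y<x. P y e) \<longleftrightarrow> \<not> (\<exists>y<x. \<not> P y e)" for x e by blast
  show ?thesis unfolding * by (intro PRP_not PRP_ex_less assms)
qed

lemma PRP_ex_le:
  assumes "PRP g (\<lambda>e. P (e 0) (\<lambda>i. e (Suc i)))" "PR g a"
  shows "PRP g (\<lambda>e. \<exists>y\<le>a e. P y e)"
  unfolding less_Suc_eq_le[symmetric] by (intro PRP_ex_less PR_Suc assms)

lemma PRP_all_le: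
  assumes "PRP g (\<lambda>e. P (e 0) (\<lambda>i. e (Suc i)))" "PR g a"
  shows "PRP g (\<lambda>e. \<forall>y\<le>a e. P y e)"
  unfolding less_Suc_eq_le[symmetric] by (intro PRP_all_less PR_Suc assms)

section \<open>Bounded search\<close>

text \<open>If the search fails, the value is \<open>n\<close>.\<close>

definition bmin :: "nat \<Rightarrow> (nat \<Rightarrow> bool) \<Rightarrow> nat" where
  "bmin n P = (\<Sum>y<n. of_bool (\<forall>z\<le>y. \<not> P z))"

lemma bmin_card: "bmin n P = card {y. y < n \<and> (\<forall>z\<le>y. \<not> P z)}"
proof -
  have "{..<n} \<inter> {y. \<forall>z\<le>y. \<not> P z} = {y. y < n \<and> (\<forall>z\<le>y. \<not> P z)}" by auto
  then show ?thesis unfolding bmin_def by (simp add: sum_of_bool_eq)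
qed

lemma bmin_eq:
  assumes "P y" "y < n" "\<And>z. z < y \<Longrightarrow> \<not> P z"
  shows "bmin n P = y"
proof -
  have "x < y" if "\<forall>z\<le>x. \<not> P z" for x using that assms(1) not_less by blast
  then have "{x. x < n \<and> (\<forall>z\<le>x. \<not> P z)} = {..<y}"
    using assms by auto
  then show ?thesis unfolding bmin_card by simp
qed

lemma bmin_none:
  assumes "\<And>y. y < n \<Longrightarrow> \<not> P y" shows "bmin n P = n"
proof -
  have "{x. x < n \<and> (\<forall>z\<le>x. \<not> P z)} = {..<n}" using assms by auto
  then show ?thesis unfolding bmin_card by simp
qed

lemma bmin_cases:
  obtains "bmin n P = n" "\<And>y. y < n \<Longrightarrow> \<not> P y"
  | "bmin n P < n" "P (bmin n P)" "\<And>y. y < bmin n P \<Longrightarrow> \<not> P y"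
proof (cases "\<exists>y<n. P y")
  case True
  then obtain y where y: "y < n" "P y" by blast
  define l where "l = (LEAST y. P y)"
  have l: "P l" unfolding l_def using y(2) by (rule LeastI)
  have less: "\<not> P z" if "z < l" for z
    using that unfolding l_def by (rule not_less_Least)
  have "l \<le> y" unfolding l_def using y(2) by (rule Least_le)
  then have "l < n" using y(1) by simp
  then have "bmin n P = l" using l less by (intro bmin_eq)
  then show ?thesis using that(2) l less \<open>l < n\<close> by metis
next
  case False
  then show ?thesis using that(1) bmin_none[of n P] by simp
qed

lemma bmin_less_iff: "bmin n P < n \<longleftrightarrow> (\<exists>y<n. P y)"
  using bmin_cases[of n P] by (metis less_irrefl)

lemma bmin_sat: "bmin n P < n \<Longrightarrow> P (bmin n P)"
  using bmin_cases[of n P] by (metis less_irrefl)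

lemma bmin_min: "y < bmin n P \<Longrightarrow> \<not> P y"
  using bmin_cases[of n P] by metis

lemma PR_bmin:
  assumes "PRP g (\<lambda>e. P (e 0) (\<lambda>i. e (Suc i)))" "PR g a"
  shows "PR g (\<lambda>e. bmin (a e) (\<lambda>y. P y e))"
proof -
  have "PR g (case_nat (\<lambda>e. e 0) (\<lambda>i e. e (i + 2)) i)" for i by (cases i) (auto intro: PR_var)
  from PR_subst[OF assms(1), of "case_nat (\<lambda>e. e 0) (\<lambda>i e. e (i + 2))", OF this]
  have "PRP g (\<lambda>e. P (e 0) (\<lambda>i. e (Suc (Suc i))))" by simp
  then show ?thesis
    unfolding bmin_def by (intro PR_sum PRP_all_le PRP_not PR_var assms(2))
qed

section \<open>Coded pairs, and recursion along coded lists\<close>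

lemma PR_prod_encode: "PR g a \<Longrightarrow> PR g b \<Longrightarrow> PR g (\<lambda>e. prod_encode (a e, b e))"
proof -
  have t: "triangle x = (\<Sum>y<x. Suc y)" for x by (induction x) auto
  show "PR g a \<Longrightarrow> PR g b \<Longrightarrow> ?thesis"
    unfolding prod_encode_def t by (simp only: prod.case) (intro PR_add PR_sum PR_Suc PR_var)
qed

definition dfst :: "nat \<Rightarrow> nat" where "dfst n = fst (prod_decode n)"
definition dsnd :: "nat \<Rightarrow> nat" where "dsnd n = snd (prod_decode n)"

lemma dfst_encode [simp]: "dfst (prod_encode (a, b)) = a" by (simp add: dfst_def)
lemma dsnd_encode [simp]: "dsnd (prod_encode (a, b)) = b" by (simp add: dsnd_def)
lemma encode_dfst_dsnd [simp]: "prod_encode (dfst n, dsnd n) = n" by (simp add: dfst_def dsnd_def)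
lemma dfst_le: "dfst n \<le> n" by (metis encode_dfst_dsnd le_prod_encode_1)
lemma dsnd_le: "dsnd n \<le> n" by (metis encode_dfst_dsnd le_prod_encode_2)

lemma PR_dfst: "PR g a \<Longrightarrow> PR g (\<lambda>e. dfst (a e))"
proof -
  have "dfst n = bmin (Suc n) (\<lambda>x. \<exists>y\<le>n. prod_encode (x, y) = n)" for n
  proof (rule bmin_eq[symmetric])
    show "\<exists>y\<le>n. prod_encode (dfst n, y) = n" using dsnd_le encode_dfst_dsnd by blast
  qed (use dfst_le[of n] in auto)
  then have "PR g (\<lambda>e. dfst (e 0))"
    by (simp only:) (intro PR_bmin PR_Suc PRP_ex_le PRP_eq PR_prod_encode PR_var)
  then show "PR g a \<Longrightarrow> ?thesis" by (rule PR_subst1)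
qed

lemma PR_dsnd: "PR g a \<Longrightarrow> PR g (\<lambda>e. dsnd (a e))"
proof -
  have "dsnd n = bmin (Suc n) (\<lambda>y. \<exists>x\<le>n. prod_encode (x, y) = n)" for n
  proof (rule bmin_eq[symmetric])
    show "\<exists>x\<le>n. prod_encode (x, dsnd n) = n" using dfst_le encode_dfst_dsnd by blast
  qed (use dsnd_le[of n] in auto)
  then have "PR g (\<lambda>e. dsnd (e 0))"
    by (simp only:) (intro PR_bmin PR_Suc PRP_ex_le PRP_eq PR_prod_encode PR_var)
  then show "PR g a \<Longrightarrow> ?thesis" by (rule PR_subst1)
qed

lemmas PR_intros = PR_const PR_var PR_Suc PR_add PR_mult PR_diff PR_if PR_sum PR_bmin
  PR_prod_encode PR_dfst PR_dsnd PRP_not PRP_conj PRP_disj PRP_imp PRP_le PRP_less PRP_eq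
  PRP_ex_less PRP_all_less PRP_ex_le PRP_all_le

text \<open>The state is a pair of the accumulator and the code of the remaining list. As many
  iterations as the number \<open>c\<close> are enough, since a list is no longer than its code;
  once the remaining code is 0, the state stays put.\<close>

lemma PR_foldl_code:
  assumes "PR g (\<lambda>e. f (e 0) (e (Suc 0)) (\<lambda>i. e (Suc (Suc i))))" "PR g z" "PR g c"
  shows "PR g (\<lambda>e. foldl (\<lambda>r x. f r x e) (z e) (list_decode (c e)))"
proof -
  define st where "st k z c e = rec_nat (prod_encode (z, c))
    (\<lambda>k q. if dsnd q = 0 then q else
      prod_encode (f (dfst q) (dfst (dsnd q - 1)) e, dsnd (dsnd q - 1))) k" for k z c e
  have step: "st (Suc k) z c e = st k (f z (dfst (c - 1)) e) (dsnd (c - 1)) e" if "c \<noteq> 0" for k z c e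
    using that by (induction k) (auto simp: st_def)
  have st0: "st k z 0 e = prod_encode (z, 0)" for k z e by (induction k) (auto simp: st_def)
  have main: "length xs \<le> k \<Longrightarrow> dfst (st k z (list_encode xs) e) = foldl (\<lambda>r x. f r x e) z xs" for k z e xs
  proof (induction xs arbitrary: k z)
    case Nil then show ?case by (simp add: st0)
  next
    case (Cons x xs)
    then obtain k' where "k = Suc k'" by (cases k) auto
    with Cons show ?case by (simp add: step)
  qed
  have len: "length xs \<le> list_encode xs" for xs
  proof (induction xs)
    case (Cons x xs)
    then show ?case using le_prod_encode_2[of "list_encode xs" x] by auto
  qed auto
  have eq: "foldl (\<lambda>r x. f r x e) z (list_decode c) = dfst (st c z c e)" for c z e
    using main[of "list_decode c" c z e] len[of "list_decode c"] by simp
  have "PR g (case_nat (\<lambda>e. dfst (e 1)) (case_nat (\<lambda>e. dfst (dsnd (e 1) - 1)) (\<lambda>i e. e (Suc (Suc i)))) i)" for i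
    by (cases i; cases "i - 1") (auto intro!: PR_intros)
  from PR_subst[OF assms(1), of "case_nat (\<lambda>e. dfst (e 1)) (case_nat (\<lambda>e. dfst (dsnd (e 1) - 1)) (\<lambda>i e. e (Suc (Suc i))))", OF this]
  have "PR g (\<lambda>e. f (dfst (e (Suc 0))) (dfst (dsnd (e (Suc 0)) - 1)) (\<lambda>i. e (Suc (Suc i))))" by simp
  then show ?thesis
    unfolding eq unfolding st_def by (intro PR_intros PR_rec' assms)
qed

section \<open>Change of oracle, and the link with \<open>prim_rec_in\<close>\<close>

lemma PR_trans:
  assumes "PR g f" "g \<le>PR h"
  shows "PR h f"
proof -
  obtain n F where F: "prim_rec_in g n F" "\<And>e. f e = F (map e [0..<n])"
    using assms(1) unfolding PR_def by blast
  from prim_rec_in_trans[OF F(1) assms(2)] obtain F' where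
    "prim_rec_in h n F'" "\<And>xs. length xs = n \<Longrightarrow> F' xs = F xs" by blast
  then show ?thesis unfolding PR_def using F(2) by (intro exI[of _ n] exI[of _ F']) auto
qed

lemma pr_le_iff_PR: "f \<le>PR g \<longleftrightarrow> PR g (\<lambda>e. f (e 0))"
proof
  assume "f \<le>PR g"
  then obtain F where "prim_rec_in g 1 F" "\<forall>x. F [x] = f x" unfolding pr_le_def by blast
  then show "PR g (\<lambda>e. f (e 0))" unfolding PR_def by (intro exI[of _ 1] exI[of _ F]) auto
next
  assume "PR g (\<lambda>e. f (e 0))"
  then obtain n F where F: "prim_rec_in g n F" "\<And>e. f (e 0) = F (map e [0..<n])"
    unfolding PR_def by blast
  \<comment> \<open>\<open>n\<close> may be 0; one more variable ensures a place for the argument.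
    The other places get 0, which is harmless because the value depends on \<open>e 0\<close>
    only.\<close>
  obtain F' where F': "prim_rec_in g (Suc n) F'" "\<And>e. F' (map e [0..<Suc n]) = F (map e [0..<n])"
    using PR_weaken[OF F(1), of "Suc n"] by auto
  let ?Hs = "(\<lambda>xs. xs ! 0) # replicate n (\<lambda>xs. 0)"
  have "prim_rec_in g 1 (\<lambda>xs. F' (map (\<lambda>H. H xs) ?Hs))"
    using F'(1) by (intro prim_rec_in.comp) (auto intro: prim_rec_in.intros)
  moreover have "F' (map (\<lambda>H. H [x]) ?Hs) = f x" for x
  proof -
    let ?e = "case_nat x (\<lambda>_. 0)"
    have "map (\<lambda>H. H [x]) ?Hs = map ?e [0..<Suc n]"
      by (simp add: map_upt_Suc map_replicate_const del: upt_Suc)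
    then show ?thesis using F'(2)[of ?e] F(2)[of ?e] by simp
  qed
  ultimately show "f \<le>PR g" unfolding pr_le_def by blast
qed

lemma PR_rebase: "PR (\<lambda>_. 0) f \<Longrightarrow> PR g f"
  by (erule PR_trans) (simp add: pr_le_iff_PR PR_const)

lemma PR_imp_prim_rec_in_2:
  assumes "PR g (\<lambda>e. f (e 0) (e 1))"
  shows "\<exists>F. prim_rec_in g 2 F \<and> (\<forall>x y. F [x, y] = f x y)"
proof -
  obtain n F where F: "prim_rec_in g n F" "\<And>e. f (e 0) (e 1) = F (map e [0..<n])"
    using assms unfolding PR_def by blast
  obtain F' where F': "prim_rec_in g (Suc (Suc n)) F'" "\<And>e. F' (map e [0..<Suc (Suc n)]) = F (map e [0..<n])"
    using PR_weaken[OF F(1), of "Suc (Suc n)"] by auto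
  let ?Hs = "(\<lambda>xs. xs ! 0) # (\<lambda>xs. xs ! 1) # replicate n (\<lambda>xs. 0)"
  have "prim_rec_in g 2 (\<lambda>xs. F' (map (\<lambda>H. H xs) ?Hs))"
    using F'(1) by (intro prim_rec_in.comp) (auto intro: prim_rec_in.intros)
  moreover have "F' (map (\<lambda>H. H [x, y]) ?Hs) = f x y" for x y
  proof -
    let ?e = "case_nat x (case_nat y (\<lambda>_. 0))"
    have "map (\<lambda>H. H [x, y]) ?Hs = map ?e [0..<Suc (Suc n)]"
      by (simp add: map_upt_Suc map_replicate_const del: upt_Suc)
    then show ?thesis using F'(2)[of ?e] F(2)[of ?e] by simp
  qed
  ultimately show ?thesis by (intro exI conjI allI)
qed

lemma punctual_iff_PR: "punctual A \<longleftrightarrow> PRP (\<lambda>_. 0) (\<lambda>e. A (e 0) (e 1))"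
proof
  assume "punctual A"
  then obtain F where "prim_rec_in (\<lambda>_. 0) 2 F" "\<forall>x y. F [x, y] = of_bool (A x y)"
    unfolding punctual_def by blast
  then show "PRP (\<lambda>_. 0) (\<lambda>e. A (e 0) (e 1))"
    unfolding PR_def by (intro exI[of _ 2] exI[of _ F]) (auto simp: numeral_2_eq_2)
next
  assume "PRP (\<lambda>_. 0) (\<lambda>e. A (e 0) (e 1))"
  then show "punctual A" unfolding punctual_def by (rule PR_imp_prim_rec_in_2)
qed

section \<open>Recursive functions and the arithmetical hierarchy\<close>

lemma PR_case:
  assumes "PR g k" "\<And>j. PR g (\<lambda>e. s e j)"
  shows "PR g (\<lambda>e. case_nat (k e) (s e) i)"
  using assms by (cases i) auto

lemma PR_env:
  assumes "PR g (\<lambda>e. a (e 0) (\<lambda>i. e (Suc i)))" "PR g t" "\<And>i. PR g (\<lambda>e. \<sigma> e i)"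
  shows "PR g (\<lambda>e. a (t e) (\<sigma> e))"
proof -
  have "PR g (\<lambda>e. case_nat (t e) (\<sigma> e) i)" for i
    by (intro PR_case assms)
  from PR_subst[OF assms(1), of "\<lambda>i e. case_nat (t e) (\<sigma> e) i", OF this]
  show ?thesis by simp
qed

lemma PR_subst4:
  assumes "PR g (\<lambda>e. f (e 0) (e 1) (e 2) (e 3))" "PR g a" "PR g b" "PR g c" "PR g d"
  shows "PR g (\<lambda>e. f (a e) (b e) (c e) (d e))"
proof -
  have "PR g (\<lambda>e. (case_nat (a e) (case_nat (b e) (case_nat (c e) (case_nat (d e) (\<lambda>_. 0))))) i)" for i
    by (intro PR_case assms PR_const)
  from PR_subst[OF assms(1), of "\<lambda>i e. (case_nat (a e) (case_nat (b e) (case_nat (c e) (case_nat (d e) (\<lambda>_. 0))))) i", OF this]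
  show ?thesis by (simp add: numeral_2_eq_2 numeral_3_eq_3)
qed

lemma PRP_all_fin:
  fixes m :: nat
  assumes "\<And>i. i < m \<Longrightarrow> PRP g (P i)"
  shows "PRP g (\<lambda>e. \<forall>i<m. P i e)"
  using assms
proof (induction m)
  case (Suc m)
  have "(\<forall>i<Suc m. P i e) \<longleftrightarrow> (\<forall>i<m. P i e) \<and> P m e" for e by (auto simp: less_Suc_eq)
  then show ?case using Suc by (simp only:) (intro PRP_conj, auto)
qed (simp add: PR_const)

section \<open>Approximation of recursive functions by stages\<close>

text \<open>The value \<open>0\<close> of \<open>a t e\<close> means that the computation has not halted within \<open>t\<close> steps.\<close>

definition stages :: "(nat \<Rightarrow> nat) \<Rightarrow> nat \<Rightarrow> (nat list \<Rightarrow> nat) \<Rightarrow> (nat \<Rightarrow> (nat \<Rightarrow> nat) \<Rightarrow> nat) \<Rightarrow> bool" where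
  "stages g n F a \<longleftrightarrow> PR g (\<lambda>e. a (e 0) (\<lambda>i. e (Suc i))) \<and>
     (\<forall>t e. a t e = 0 \<or> a t e = Suc (F (map e [0..<n]))) \<and>
     (\<forall>e. \<forall>\<^sub>F t in sequentially. a t e \<noteq> 0)"

lemma stagesD:
  assumes "stages g n F a"
  shows "PR g (\<lambda>e. a (e 0) (\<lambda>i. e (Suc i)))"
    "a t e \<noteq> 0 \<Longrightarrow> a t e = Suc (F (map e [0..<n]))"
    "\<forall>\<^sub>F t in sequentially. a t e = Suc (F (map e [0..<n]))"
proof -
  show "PR g (\<lambda>e. a (e 0) (\<lambda>i. e (Suc i)))"
    and *: "\<And>t. a t e \<noteq> 0 \<Longrightarrow> a t e = Suc (F (map e [0..<n]))"
    using assms unfolding stages_def by metis+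
  have "\<forall>\<^sub>F t in sequentially. a t e \<noteq> 0" using assms unfolding stages_def by blast
  then show "\<forall>\<^sub>F t in sequentially. a t e = Suc (F (map e [0..<n]))"
    by (rule eventually_mono) (rule *)
qed

text \<open>A weak Kleene normal form: only minimisation leads out of the primitive recursive
  functions, and a clock \<open>t\<close> turns it into a bounded search. Answers are correct at
  every stage, so it remains to ensure that each computation answers eventually.\<close>

lemma recursive_stages:
  assumes "recursive_in g n F"
  shows "\<exists>a. stages g n F a"
  using assms
proof induction
  case (zero n)
  show ?case by (rule exI[of _ "\<lambda>t e. 1"]) (simp add: stages_def PR_const)
next
  case succ
  show ?case by (rule exI[of _ "\<lambda>t e. Suc (Suc (e 0))"]) (simp add: stages_def PR_intros)
next
  case (proj i n)
  then show ?case
    by (intro exI[of _ "\<lambda>t e. Suc (e i)"]) (simp add: stages_def PR_intros)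
next
  case orcl
  show ?case by (rule exI[of _ "\<lambda>t e. Suc (g (e 0))"]) (simp add: stages_def PR_Suc[OF PR_oracle[OF PR_var]])
next
  case (comp Hs F n)
  then obtain aF where aF: "stages g (length Hs) F aF" by blast
  have "\<forall>i<length Hs. \<exists>a. stages g n (Hs ! i) a" using comp by auto
  then obtain c where c: "\<And>i. i < length Hs \<Longrightarrow> stages g n (Hs ! i) (c i)" by metis
  \<comment> \<open>The arguments at stage \<open>t\<close>, without the \<open>Suc\<close> that
    marks halting; they are correct once all argument computations have halted.\<close>
  define \<sigma> where "\<sigma> t e = (\<lambda>i. if i < length Hs then c i t e - 1 else 0)" for t :: nat and e
  define a where "a t e = (if \<forall>i<length Hs. c i t e \<noteq> 0 then aF t (\<sigma> t e) else 0)" for t e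
  have s: "map (\<sigma> t e) [0..<length Hs] = map (\<lambda>H. H (map e [0..<n])) Hs"
    if "\<forall>i<length Hs. c i t e \<noteq> 0" for t e
  proof (rule nth_equalityI)
    fix i assume "i < length (map (\<sigma> t e) [0..<length Hs])"
    then show "map (\<sigma> t e) [0..<length Hs] ! i = map (\<lambda>H. H (map e [0..<n])) Hs ! i"
      using stagesD(2)[OF c, of i t e] that by (simp add: \<sigma>_def)
  qed simp
  have "PR g (\<lambda>e. \<sigma> (e 0) (\<lambda>i. e (Suc i)) i)" for i
    unfolding \<sigma>_def by (cases "i < length Hs") (simp_all add: PR_intros stagesD(1)[OF c])
  then have "PR g (\<lambda>e. a (e 0) (\<lambda>i. e (Suc i)))"
    unfolding a_def
    by (intro PR_if PRP_all_fin PRP_not PRP_eq PR_const stagesD(1)[OF c] PR_env[OF stagesD(1)[OF aF]] PR_var)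
  moreover have "a t e = 0 \<or> a t e = Suc (F (map (\<lambda>H. H (map e [0..<n])) Hs))" for t e
    using stagesD(2)[OF aF, of t "\<sigma> t e"] s[of t e] unfolding a_def by (metis (no_types, lifting))
  moreover have "\<forall>\<^sub>F t in sequentially. a t e \<noteq> 0" for e
  proof -
    define w where "w = (\<lambda>i. if i < length Hs then (Hs ! i) (map e [0..<n]) else 0)"
    have "\<forall>\<^sub>F t in sequentially. \<forall>i\<in>{..<length Hs}. c i t e = Suc ((Hs ! i) (map e [0..<n]))"
      by (intro eventually_ball_finite) (auto intro: stagesD(3)[OF c])
    moreover have "\<forall>\<^sub>F t in sequentially. aF t w = Suc (F (map w [0..<length Hs]))"
      by (rule stagesD(3)[OF aF])
    ultimately show ?thesis
    proof eventually_elim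
      case (elim t)
      then have "\<sigma> t e = w" by (auto simp: \<sigma>_def w_def)
      then show ?case using elim by (simp add: a_def)
    qed
  qed
  ultimately show ?case unfolding stages_def by blast
next
  case (prec n F H)
  then obtain aF aH where aF: "stages g n F aF" and aH: "stages g (n + 2) H aH" by blast
  \<comment> \<open>If some intermediate value has not been computed by stage \<open>t\<close>, the
    0 is passed on to the end.\<close>
  define a where "a t e = rec_nat (aF t (\<lambda>i. e (Suc i)))
      (\<lambda>k r. if r = 0 then 0 else aH t (case_nat k (case_nat (r - 1) (\<lambda>i. e (Suc i))))) (e 0)" for t e
  have "PR g (\<lambda>e. a (e 0) (\<lambda>i. e (Suc i)))"
    unfolding a_def
    by (intro PR_rec' PR_if PRP_eq PR_const PR_env[OF stagesD(1)[OF aF]] PR_env[OF stagesD(1)[OF aH]]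
        PR_case PR_diff PR_var)
  moreover define v where "v m e = rec_nat (F (map (\<lambda>i. e (Suc i)) [0..<n]))
      (\<lambda>k r. H (k # r # map (\<lambda>i. e (Suc i)) [0..<n])) m" for m and e :: "nat \<Rightarrow> nat"
  moreover define b where "b t e m = rec_nat (aF t (\<lambda>i. e (Suc i)))
      (\<lambda>k r. if r = 0 then 0 else aH t (case_nat k (case_nat (r - 1) (\<lambda>i. e (Suc i))))) m" for t e m
  have env: "map (case_nat k (case_nat r e)) [0..<n + 2] = k # r # map e [0..<n]" for k r e
    by (simp add: map_upt_Suc del: upt_Suc)
  have b1: "b t e m = 0 \<or> b t e m = Suc (v m e)" for t e m
  proof (induction m)
    case 0 then show ?case using stagesD(2)[OF aF, of t "\<lambda>i. e (Suc i)"] by (auto simp: b_def v_def)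
  next
    case (Suc m)
    let ?E = "case_nat m (case_nat (v m e) (\<lambda>i. e (Suc i)))"
    have "b t e (Suc m) = (if b t e m = 0 then 0 else aH t ?E)"
      using Suc by (auto simp: b_def)
    moreover have "v (Suc m) e = H (map ?E [0..<n + 2])" unfolding env by (simp add: v_def)
    ultimately show ?case
      using stagesD(2)[OF aH, of t ?E] by (metis (full_types))
  qed
  have b2: "\<forall>\<^sub>F t in sequentially. b t e m \<noteq> 0" for e m
  proof (induction m)
    case 0
    then show ?case using stagesD(3)[OF aF, of "\<lambda>i. e (Suc i)"] unfolding b_def
      by (auto elim: eventually_mono)
  next
    case (Suc m)
    from Suc stagesD(3)[OF aH, of "case_nat m (case_nat (v m e) (\<lambda>i. e (Suc i)))"]
    show ?case
    proof eventually_elim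
      case (elim t)
      then have "b t e m = Suc (v m e)" using b1[of t e m] by simp
      then have "b t e (Suc m) = aH t (case_nat m (case_nat (v m e) (\<lambda>i. e (Suc i))))"
        by (simp add: b_def)
      then show ?case using elim by simp
    qed
  qed
  have ab: "a t e = b t e (e 0)" for t e by (simp add: a_def b_def)
  have tl: "map e [0..<Suc n] = e 0 # map (\<lambda>i. e (Suc i)) [0..<n]" for e :: "nat \<Rightarrow> nat"
    by (simp add: map_upt_Suc del: upt_Suc)
  show ?case
    unfolding stages_def
  proof (intro exI conjI allI)
    show "PR g (\<lambda>e. a (e 0) (\<lambda>i. e (Suc i)))" by fact
    show "a t e = 0 \<or> a t e = Suc (rec_nat (F (tl (map e [0..<Suc n])))
          (\<lambda>k r. H (k # r # tl (map e [0..<Suc n]))) (hd (map e [0..<Suc n])))" for t e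
      using b1[of t e "e 0"] unfolding ab tl v_def by simp
    show "\<forall>\<^sub>F t in sequentially. a t e \<noteq> 0" for e
      unfolding ab by (rule b2)
  qed
next
  case (minim n F)
  then obtain aF where aF: "stages g (Suc n) F aF" by blast
  have env: "map (case_nat k e) [0..<Suc n] = k # map e [0..<n]" for k e
    by (simp add: map_upt_Suc del: upt_Suc)
  \<comment> \<open>The search stops at the first argument that has not halted (value 0) or has
    halted with output 0 (value 1). Only the second counts as an answer, so all smaller arguments
    have a confirmed nonzero output.\<close>
  define y where "y t e = bmin t (\<lambda>y. aF t (case_nat y e) \<le> 1)" for t e
  define a where "a t e = (if y t e < t \<and> aF t (case_nat (y t e) e) = 1 then Suc (y t e) else 0)" for t e
  have PRy: "PR g (\<lambda>e. y (e 0) (\<lambda>i. e (Suc i)))"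
    unfolding y_def by (intro PR_bmin PRP_le PR_env[OF stagesD(1)[OF aF]] PR_case PR_var PR_const)
  have "PR g (\<lambda>e. a (e 0) (\<lambda>i. e (Suc i)))"
    unfolding a_def
    by (intro PR_if PRP_conj PRP_less PRP_eq PR_Suc PR_env[OF stagesD(1)[OF aF]] PRy PR_case PR_var PR_const)
  moreover have "a t e = 0 \<or> a t e = Suc (LEAST y. F (y # map e [0..<n]) = 0)" for t e
  proof (cases "a t e = 0")
    case False
    then have y: "y t e < t" "aF t (case_nat (y t e) e) = 1" "a t e = Suc (y t e)"
      unfolding a_def by (auto split: if_splits)
    have "(LEAST y. F (y # map e [0..<n]) = 0) = y t e"
    proof (rule Least_equality)
      show "F (y t e # map e [0..<n]) = 0"
        using stagesD(2)[OF aF, of t "case_nat (y t e) e"] y(2) unfolding env by simp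
      fix z assume z: "F (z # map e [0..<n]) = 0"
      show "y t e \<le> z"
      proof (rule ccontr)
        assume "\<not> y t e \<le> z"
        then have "\<not> aF t (case_nat z e) \<le> 1"
          unfolding y_def by (intro bmin_min[of _ t]) simp
        then show False using stagesD(2)[OF aF, of t "case_nat z e"] z unfolding env by simp
      qed
    qed
    then show ?thesis using y(3) by simp
  qed simp
  moreover have "\<forall>\<^sub>F t in sequentially. a t e \<noteq> 0" for e
  proof -
    have ex: "\<exists>y. F (y # map e [0..<n]) = 0" using minim by simp
    define m where "m = (LEAST y. F (y # map e [0..<n]) = 0)"
    have m: "F (m # map e [0..<n]) = 0" unfolding m_def using ex by (rule LeastI_ex)
    have m': "F (z # map e [0..<n]) \<noteq> 0" if "z < m" for z
      using that unfolding m_def by (rule not_less_Least)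
    have "\<forall>\<^sub>F t in sequentially. \<forall>z\<in>{..m}. aF t (case_nat z e) = Suc (F (z # map e [0..<n]))"
      using stagesD(3)[OF aF, of "case_nat _ e", unfolded env] by (intro eventually_ball_finite) auto
    then show ?thesis using eventually_gt_at_top[of m]
    proof eventually_elim
      case (elim t)
      have "y t e = m"
        unfolding y_def using elim m m' by (intro bmin_eq) auto
      then show ?case using elim m by (simp add: a_def)
    qed
  qed
  ultimately show ?case unfolding stages_def by blast
qed

subsection \<open>Normal form of total Delta-2 functions\<close>

text \<open>A recursive matrix is true iff no stage shows it to be false, that is, iff
  \<open>a\<close> never takes the value 1. This new quantifier over stages is universal and merges
  with the inner one: \<open>w\<close> codes the stage and the old variable. What is left is
  primitive recursive.\<close>

lemma Delta2_normal_form: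
  assumes "Delta0_fun_in g 2 f"
  shows "\<exists>P. PRP g (\<lambda>e. P (e 0) (e 1) (e 2) (e 3)) \<and>
    (\<forall>x y. f x = y \<longleftrightarrow> (\<exists>u. \<forall>w. \<not> P u w x y))"
proof -
  have "Sigma0_in g (Suc (Suc 0)) 2 (\<lambda>xs. xs ! 1 = f (xs ! 0))"
    using assms by (simp add: Delta0_fun_in_def Delta0_in_def numeral_2_eq_2 del: Sigma0_in.simps)
  then obtain S1 S0 F where F: "recursive_in g 4 F" "\<And>xs. length xs = 4 \<Longrightarrow> F xs = of_bool (S0 xs)"
    and S1: "\<And>xs. length xs = 3 \<Longrightarrow> S1 xs \<longleftrightarrow> (\<exists>v. \<not> S0 (v # xs))"
    and R: "\<And>xs. length xs = 2 \<Longrightarrow> xs ! 1 = f (xs ! 0) \<longleftrightarrow> (\<exists>u. \<not> S1 (u # xs))"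
    by (auto simp: numeral_2_eq_2 numeral_3_eq_3 eval_nat_numeral)
  obtain a where a: "stages g 4 F a" using recursive_stages[OF F(1)] by blast
  let ?e = "\<lambda>v u x y. case_nat v (case_nat u (case_nat x (case_nat y (\<lambda>_. 0))))"
  define P where "P u w x y \<longleftrightarrow> a (dfst w) (?e (dsnd w) u x y) = 1" for u w x y
  have "PRP g (\<lambda>e. P (e 0) (e 1) (e 2) (e 3))"
    unfolding P_def
    by (intro PRP_eq PR_env[OF stagesD(1)[OF a]] PR_case PR_dfst PR_dsnd PR_var PR_const)
  moreover have "f x = y \<longleftrightarrow> (\<exists>u. \<forall>w. \<not> P u w x y)" for x y
  proof -
    have e: "map (?e v u x y) [0..<4] = [v, u, x, y]" for v u
      by (simp add: map_upt_Suc eval_nat_numeral del: upt_Suc)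
    have S0: "S0 [v, u, x, y] \<longleftrightarrow> (\<forall>t. a t (?e v u x y) \<noteq> 1)" for v u
    proof
      assume "S0 [v, u, x, y]"
      then have F1: "F [v, u, x, y] = 1" using F(2)[of "[v,u,x,y]"] by simp
      show "\<forall>t. a t (?e v u x y) \<noteq> 1"
      proof
        fix t
        show "a t (?e v u x y) \<noteq> 1"
          using stagesD(2)[OF a, of t "?e v u x y"] F1 unfolding e by linarith
      qed
    next
      assume "\<forall>t. a t (?e v u x y) \<noteq> 1"
      moreover obtain t where "a t (?e v u x y) = Suc (F [v, u, x, y])"
        using stagesD(3)[OF a, of "?e v u x y"] unfolding e eventually_sequentially by blast
      ultimately show "S0 [v, u, x, y]" using F(2)[of "[v,u,x,y]"] by (cases "S0 [v, u, x, y]") auto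
    qed
    have "f x = y \<longleftrightarrow> (\<exists>u. \<forall>v. S0 [v, u, x, y])"
      using R[of "[x, y]"] S1[of "_ # [x, y]"] by auto
    also have "\<dots> \<longleftrightarrow> (\<exists>u. \<forall>v t. a t (?e v u x y) \<noteq> 1)" by (simp only: S0)
    also have "\<dots> \<longleftrightarrow> (\<exists>u. \<forall>w. \<not> P u w x y)"
      unfolding P_def by (metis dfst_encode dsnd_encode)
    finally show ?thesis .
  qed
  ultimately show ?thesis by blast
qed

text \<open>The limit lemma. A number \<open>q\<close> codes a value and a witness \<open>u\<close>,
  and stage \<open>s\<close> guesses the least \<open>q\<close> that no \<open>w < s\<close>
  refutes. All numbers below the least correct one are refuted eventually, so the guess settles
  there.\<close>

lemma Delta2_limit:
  assumes "Delta0_fun_in (\<lambda>_. 0) 2 f"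
  shows "\<exists>c. PR (\<lambda>_. 0) (\<lambda>e. c (e 0) (e 1)) \<and> (\<forall>x. \<exists>s0. \<forall>s\<ge>s0. c x s = f x)"
proof -
  obtain P where P: "PRP (\<lambda>_. 0) (\<lambda>e. P (e 0) (e 1) (e 2) (e 3))"
    "\<And>x y. f x = y \<longleftrightarrow> (\<exists>u. \<forall>w. \<not> P u w x y)"
    using Delta2_normal_form[OF assms] by blast
  define m where "m x s = bmin s (\<lambda>q. \<forall>w<s. \<not> P (dsnd q) w x (dfst q))" for x s
  have "PR (\<lambda>_. 0) (\<lambda>e. dfst (m (e 0) (e 1)))"
    unfolding m_def
    by (intro PR_intros PR_subst4[OF P(1)])
  moreover have "\<exists>s0. \<forall>s\<ge>s0. dfst (m x s) = f x" for x
  proof -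
    define Q where "Q q \<longleftrightarrow> (\<forall>w. \<not> P (dsnd q) w x (dfst q))" for q
    have "\<exists>q. Q q"
      using P(2)[of x "f x"] unfolding Q_def by (metis dfst_encode dsnd_encode)
    define l where "l = (LEAST q. Q q)"
    have l: "Q l" unfolding l_def using \<open>\<exists>q. Q q\<close> by (rule LeastI_ex)
    have "\<forall>q<l. \<exists>w. P (dsnd q) w x (dfst q)"
      using not_less_Least[of _ Q] unfolding l_def Q_def by blast
    then obtain w where w: "\<And>q. q < l \<Longrightarrow> P (dsnd q) (w q) x (dfst q)" by metis
    define s0 where "s0 = Suc (l + (\<Sum>q<l. w q))"
    have "m x s = l" if "s \<ge> s0" for s
      unfolding m_def
    proof (rule bmin_eq)
      show "\<forall>w<s. \<not> P (dsnd l) w x (dfst l)" using l Q_def by blast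
      show "l < s" using that s0_def by simp
      fix q assume "q < l"
      then have "w q \<le> (\<Sum>q<l. w q)" by (intro member_le_sum) auto
      then have "w q < s" using that s0_def by simp
      then show "\<not> (\<forall>w<s. \<not> P (dsnd q) w x (dfst q))" using w \<open>q < l\<close> by blast
    qed
    moreover have "dfst l = f x" using P(2)[of x "dfst l"] l unfolding Q_def by metis
    ultimately show ?thesis by blast
  qed
  ultimately show ?thesis by (intro exI[of _ "\<lambda>x s. dfst (m x s)"]) blast
qed

subsection \<open>Countably many functionals define all relativised Delta-2 functions\<close>

text \<open>Programs without their oracle: one code denotes a functional on all oracles.
  Countability allows a generic construction to treat every code as a requirement.\<close>

datatype code = CZ | CS | CP nat | CO | CC code "code list" | CR code code

instance code :: countable by countable_datatype

fun evalc :: "(nat \<Rightarrow> nat) \<Rightarrow> code \<Rightarrow> nat list \<Rightarrow> nat" where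
  "evalc g CZ xs = 0"
| "evalc g CS xs = Suc (hd xs)"
| "evalc g (CP i) xs = xs ! i"
| "evalc g CO xs = g (hd xs)"
| "evalc g (CC c ds) xs = evalc g c (map (\<lambda>d. evalc g d xs) ds)"
| "evalc g (CR c d) xs = rec_nat (evalc g c (tl xs)) (\<lambda>k r. evalc g d (k # r # tl xs)) (hd xs)"

lemma prim_rec_in_code:
  assumes "prim_rec_in g n F" shows "\<exists>c. F = evalc g c"
  using assms
proof induction
  case (zero n) then show ?case by (intro exI[of _ CZ]) auto
next
  case succ then show ?case by (intro exI[of _ CS]) auto
next
  case (proj i n) then show ?case by (intro exI[of _ "CP i"]) auto
next
  case orcl then show ?case by (intro exI[of _ CO]) auto
next
  case (comp Hs F n)
  then obtain c where c: "F = evalc g c" by blast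
  have "\<exists>ds. Hs = map (evalc g) ds"
    using comp by (intro ex_map_conv[THEN iffD2]) blast
  then obtain ds where "Hs = map (evalc g) ds" by blast
  then show ?case using c by (intro exI[of _ "CC c ds"]) (auto simp: comp_def)
next
  case (prec n F H)
  then obtain c d where "F = evalc g c" "H = evalc g d" by blast
  then show ?case by (intro exI[of _ "CR c d"]) auto
qed

text \<open>The use principle: a computation consults its oracle at finitely many places
  only.\<close>

lemma evalc_use:
  "\<exists>N. \<forall>g'. (\<forall>i<N. g' i = g i) \<longrightarrow> evalc g' c xs = evalc g c xs"
proof (induction c arbitrary: xs)
  case CO
  show ?case by (intro exI[of _ "Suc (hd xs)"]) auto
next
  case (CC c ds)
  obtain N1 where N1: "\<And>g'. \<forall>i<N1. g' i = g i \<Longrightarrow>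
     evalc g' c (map (\<lambda>d. evalc g d xs) ds) = evalc g c (map (\<lambda>d. evalc g d xs) ds)"
    using CC(1) by blast
  have "\<forall>d\<in>set ds. \<exists>N. \<forall>g'. (\<forall>i<N. g' i = g i) \<longrightarrow> evalc g' d xs = evalc g d xs"
    using CC(2) by blast
  then obtain N where N: "\<And>d g'. d \<in> set ds \<Longrightarrow> \<forall>i<N d. g' i = g i \<Longrightarrow> evalc g' d xs = evalc g d xs"
    by metis
  show ?case
  proof (intro exI allI impI)
    fix g' assume g': "\<forall>i<N1 + (\<Sum>d\<in>set ds. N d). g' i = g i"
    have "evalc g' d xs = evalc g d xs" if "d \<in> set ds" for d
    proof (rule N[OF that])
      have "N d \<le> (\<Sum>d\<in>set ds. N d)" using that by (intro member_le_sum) auto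
      then show "\<forall>i<N d. g' i = g i" using g' by auto
    qed
    then have "map (\<lambda>d. evalc g' d xs) ds = map (\<lambda>d. evalc g d xs) ds" by simp
    moreover have "evalc g' c (map (\<lambda>d. evalc g d xs) ds) = evalc g c (map (\<lambda>d. evalc g d xs) ds)"
      by (rule N1) (use g' in auto)
    ultimately show "evalc g' (CC c ds) xs = evalc g (CC c ds) xs" by (simp only: evalc.simps)
  qed
next
  case (CR c d)
  \<comment> \<open>The number of iterations is a value and not part of the code, hence an inner
    induction on it.\<close>
  let ?R = "\<lambda>g m. rec_nat (evalc g c (tl xs)) (\<lambda>k r. evalc g d (k # r # tl xs)) m"
  have "\<exists>N. \<forall>g'. (\<forall>i<N. g' i = g i) \<longrightarrow> ?R g' m = ?R g m" for m
  proof (induction m)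
    case 0 then show ?case using CR(1)[of "tl xs"] by simp
  next
    case (Suc m)
    then obtain N1 where N1: "\<And>g'. \<forall>i<N1. g' i = g i \<Longrightarrow> ?R g' m = ?R g m" by blast
    obtain N2 where N2: "\<And>g'. \<forall>i<N2. g' i = g i \<Longrightarrow>
       evalc g' d (m # ?R g m # tl xs) = evalc g d (m # ?R g m # tl xs)"
      using CR(2) by blast
    show ?case
    proof (intro exI allI impI)
      fix g' assume g': "\<forall>i<N1 + N2. g' i = g i"
      have "?R g' m = ?R g m" by (rule N1) (use g' in auto)
      moreover have "evalc g' d (m # ?R g m # tl xs) = evalc g d (m # ?R g m # tl xs)"
        by (rule N2) (use g' in auto)
      ultimately show "?R g' (Suc m) = ?R g (Suc m)" by (simp only: nat.rec)
    qed
  qed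
  then show ?case by simp
qed auto

text \<open>\<open>k\<close> encodes the program of a normal form together with its arity. The
  forcing argument relies on both conjuncts: the enumeration does not depend on the oracle, and each
  instance of a matrix is decided by a finite part of the oracle.\<close>

lemma Delta2_functionals:
  "\<exists>\<Psi> :: nat \<Rightarrow> (nat \<Rightarrow> nat) \<Rightarrow> nat \<Rightarrow> nat \<Rightarrow> nat \<Rightarrow> nat \<Rightarrow> bool.
     (\<forall>k g u w x y. \<exists>N. \<forall>g'. (\<forall>i<N. g' i = g i) \<longrightarrow> \<Psi> k g' u w x y = \<Psi> k g u w x y) \<and>
     (\<forall>g f. Delta0_fun_in g 2 f \<longrightarrow> (\<exists>k. \<forall>x y. f x = y \<longleftrightarrow> (\<exists>u. \<forall>w. \<not> \<Psi> k g u w x y)))"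
proof -
  let ?e = "\<lambda>u w x y. case_nat u (case_nat w (case_nat x (case_nat y (\<lambda>_. 0))))"
  define \<Psi> where "\<Psi> k g u w x y \<longleftrightarrow>
    (case from_nat k of (c, n) \<Rightarrow> evalc g c (map (?e u w x y) [0..<n]) = 1)" for k g u w x y
  show ?thesis
  proof (rule exI[of _ \<Psi>], intro conjI allI impI)
    fix k g u w x y
    obtain c n where "from_nat k = (c :: code, n :: nat)" by force
    then have "\<Psi> k g' u w x y \<longleftrightarrow> evalc g' c (map (?e u w x y) [0..<n]) = 1" for g'
      unfolding \<Psi>_def by simp
    then show "\<exists>N. \<forall>g'. (\<forall>i<N. g' i = g i) \<longrightarrow> \<Psi> k g' u w x y = \<Psi> k g u w x y"
      using evalc_use[of g c "map (?e u w x y) [0..<n]"] by metis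
  next
    fix g f assume f: "Delta0_fun_in g 2 f"
    obtain P where P: "PRP g (\<lambda>e. P (e 0) (e 1) (e 2) (e 3))"
      "\<And>x y. f x = y \<longleftrightarrow> (\<exists>u. \<forall>w. \<not> P u w x y)"
      using Delta2_normal_form[OF f] by blast
    obtain n F where F: "prim_rec_in g n F"
      "\<And>e. of_bool (P (e 0) (e 1) (e 2) (e 3)) = F (map e [0..<n])"
      using P(1) unfolding PR_def by blast
    obtain c where c: "F = evalc g c" using prim_rec_in_code[OF F(1)] by blast
    have "\<Psi> (to_nat (c, n)) g u w x y \<longleftrightarrow> P u w x y" for u w x y
      using F(2)[of "?e u w x y"] unfolding \<Psi>_def c
      by (simp add: numeral_2_eq_2 numeral_3_eq_3 of_bool_def split: if_splits)
    then show "\<exists>k. \<forall>x y. f x = y \<longleftrightarrow> (\<exists>u. \<forall>w. \<not> \<Psi> k g u w x y)"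
      using P(2) by (intro exI[of _ "to_nat (c, n)"]) simp
  qed
qed

subsection \<open>Relativisation to a punctual structure\<close>

lemma prim_rec_in_imp_recursive_in: "prim_rec_in g n F \<Longrightarrow> recursive_in g n F"
  by (induction rule: prim_rec_in.induct) (blast intro: recursive_in.intros)+

lemma recursive_in_trans:
  assumes "recursive_in g n F" and "g \<le>PR h"
  shows "\<exists>F'. recursive_in h n F' \<and> (\<forall>xs. length xs = n \<longrightarrow> F' xs = F xs)"
  using assms(1)
proof induction
  case (zero n) show ?case using recursive_in.zero[of h n] by blast
next
  case succ show ?case using recursive_in.succ[of h] by blast
next
  case (proj i n) then show ?case using recursive_in.proj[of i n h] by blast
next
  case orcl
  obtain G where G: "prim_rec_in h 1 G" "\<forall>x. G [x] = g x"
    using assms(2) unfolding pr_le_def by blast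
  have "G xs = g (hd xs)" if "length xs = 1" for xs
    using that G(2) by (cases xs) auto
  with prim_rec_in_imp_recursive_in[OF G(1)] show ?case by blast
next
  case (comp Hs F n)
  obtain F' where F': "recursive_in h (length Hs) F'"
    "\<And>xs. length xs = length Hs \<Longrightarrow> F' xs = F xs" using comp by blast
  have "\<forall>H\<in>set Hs. \<exists>H'. recursive_in h n H' \<and> (\<forall>xs. length xs = n \<longrightarrow> H' xs = H xs)"
    using comp by blast
  then obtain c where c: "\<And>H. H \<in> set Hs \<Longrightarrow> recursive_in h n (c H)"
    "\<And>H xs. H \<in> set Hs \<Longrightarrow> length xs = n \<Longrightarrow> c H xs = H xs" by metis
  have "recursive_in h n (\<lambda>xs. F' (map (\<lambda>H. H xs) (map c Hs)))"
    using F'(1) c(1) by (intro recursive_in.comp) auto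
  moreover have "F' (map (\<lambda>H. H xs) (map c Hs)) = F (map (\<lambda>H. H xs) Hs)"
    if "length xs = n" for xs
  proof -
    have eq: "map (\<lambda>H. H xs) (map c Hs) = map (\<lambda>H. H xs) Hs" using c(2) that by simp
    show ?thesis by (subst eq) (simp add: F'(2))
  qed
  ultimately show ?case by blast
next
  case (prec n F H)
  obtain F' where F': "recursive_in h n F'" "\<And>xs. length xs = n \<Longrightarrow> F' xs = F xs"
    using prec by blast
  obtain H' where H': "recursive_in h (n + 2) H'" "\<And>xs. length xs = n + 2 \<Longrightarrow> H' xs = H xs"
    using prec by blast
  have "rec_nat (F' (tl xs)) (\<lambda>k r. H' (k # r # tl xs)) m
      = rec_nat (F (tl xs)) (\<lambda>k r. H (k # r # tl xs)) m" if "length xs = Suc n" for xs m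
    using that by (induction m) (auto simp: F'(2) H'(2))
  then show ?case using recursive_in.prec[OF F'(1) H'(1)] by blast
next
  case (minim n F)
  then obtain F' where F': "recursive_in h (Suc n) F'" "\<And>xs. length xs = Suc n \<Longrightarrow> F' xs = F xs"
    by blast
  have "recursive_in h n (\<lambda>xs. LEAST y. F' (y # xs) = 0)"
    using minim F' by (intro recursive_in.minim) auto
  then show ?case using F'(2) by (intro exI conjI) auto
qed

lemma Sigma0_in_trans:
  "g \<le>PR h \<Longrightarrow> Sigma0_in g n k R \<Longrightarrow> Sigma0_in h n k R"
proof (induction n arbitrary: k R)
  case 0
  then obtain F where F: "recursive_in g k F" "\<And>xs. length xs = k \<Longrightarrow> F xs = of_bool (R xs)" by auto
  from recursive_in_trans[OF F(1) 0(1)] F(2) show ?case by auto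
next
  case (Suc n)
  then show ?case by auto
qed

lemma Delta0_fun_in_trans: "g \<le>PR h \<Longrightarrow> Delta0_fun_in g n f \<Longrightarrow> Delta0_fun_in h n f"
  unfolding Delta0_fun_in_def Delta0_in_def Pi0_in_def using Sigma0_in_trans by blast

text \<open>Exchanging the last two arguments turns the graph of a bijection into that of its
  inverse. Quantified variables are added in front, so the arguments in question remain the last
  two, and \<open>m\<close> counts what precedes them.\<close>

lemma Sigma0_in_swap:
  "Sigma0_in g n (m + 2) R \<Longrightarrow> Sigma0_in g n (m + 2) (\<lambda>xs. R (take m xs @ [xs ! Suc m, xs ! m]))"
proof (induction n arbitrary: m R)
  case 0
  then obtain F where F: "recursive_in g (m + 2) F"
    "\<And>xs. length xs = m + 2 \<Longrightarrow> F xs = of_bool (R xs)" by auto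
  let ?Hs = "map (\<lambda>i xs. xs ! i) ([0..<m] @ [Suc m, m])"
  have "recursive_in g (m + 2) (\<lambda>xs. F (map (\<lambda>H. H xs) ?Hs))"
    using F(1) by (intro recursive_in.comp) (auto intro!: recursive_in.proj)
  moreover have "F (map (\<lambda>H. H xs) ?Hs) = of_bool (R (take m xs @ [xs ! Suc m, xs ! m]))"
    if "length xs = m + 2" for xs
  proof -
    have "map (\<lambda>H. H xs) ?Hs = take m xs @ [xs ! Suc m, xs ! m]"
      using that by (auto intro!: nth_equalityI)
    moreover have "length (take m xs @ [xs ! Suc m, xs ! m]) = m + 2" using that by simp
    ultimately show ?thesis using F(2) by metis
  qed
  ultimately show ?case by auto
next
  case (Suc n)
  then obtain S where S: "Sigma0_in g n (Suc m + 2) S"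
    "\<And>xs. length xs = m + 2 \<Longrightarrow> R xs \<longleftrightarrow> (\<exists>y. \<not> S (y # xs))" by auto
  from Suc.IH[OF S(1)] show ?case
    using S(2) by (auto intro!: exI[of _ "\<lambda>xs. S (take (Suc m) xs @ [xs ! Suc (Suc m), xs ! Suc m])"])
qed

lemma Delta0_fun_in_inv:
  assumes "Delta0_fun_in g n f" "bij f"
  shows "Delta0_fun_in g n (inv f)"
proof -
  have *: "ys ! 0 = f (ys ! 1) \<longleftrightarrow> ys ! 1 = inv f (ys ! 0)" for ys
    using assms(2) by (metis bij_inv_eq_iff)
  have "Sigma0_in g n 2 (\<lambda>xs. xs ! 1 = f (xs ! 0))" "Sigma0_in g n 2 (\<lambda>xs. \<not> xs ! 1 = f (xs ! 0))"
    using assms(1) unfolding Delta0_fun_in_def Delta0_in_def Pi0_in_def by auto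
  from Sigma0_in_swap[of g n 0, unfolded add_0, OF this(1)]
    Sigma0_in_swap[of g n 0, unfolded add_0, OF this(2)]
  have "Sigma0_in g n 2 (\<lambda>xs. xs ! 0 = f (xs ! 1))" "Sigma0_in g n 2 (\<lambda>xs. \<not> xs ! 0 = f (xs ! 1))"
    by simp_all
  then show ?thesis
    unfolding Delta0_fun_in_def Delta0_in_def Pi0_in_def by (simp only: *)
qed

section \<open>Degrees, isomorphisms and the inclusion of the cone in the spectrum\<close>

lemma pr_degreeE:
  assumes "d \<in> pr_degrees"
  obtains g where "\<And>f. f \<le>PRd d \<longleftrightarrow> f \<le>PR g"
proof -
  obtain g where g: "d = pr_equiv `` {g}"
    using assms unfolding pr_degrees_def by (auto elim: quotientE)
  have "f \<le>PRd d \<longleftrightarrow> f \<le>PR g" for f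
    unfolding pr_le_degree_def g
    by (auto simp: pr_equiv_def intro: pr_le_trans pr_le_refl)
  then show ?thesis by (rule that)
qed

lemma is_iso_inv: "is_iso A B f \<Longrightarrow> is_iso B A (inv f)"
  unfolding is_iso_def by (metis bij_imp_bij_inv bij_inv_eq_iff)

lemma is_iso_comp: "is_iso A B f \<Longrightarrow> is_iso B C h \<Longrightarrow> is_iso A C (h \<circ> f)"
  unfolding is_iso_def by (auto intro: bij_comp)

lemma punctual_atomic_diagram:
  assumes "punctual B" shows "atomic_diagram B \<le>PR (\<lambda>_. 0)"
proof -
  have "PRP (\<lambda>_. 0) (\<lambda>e. B (e 0) (e 1))" using assms by (simp add: punctual_iff_PR)
  from PR_subst2[OF this PR_dfst[OF PR_var] PR_dsnd[OF PR_var]]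
  have "PRP (\<lambda>_. 0) (\<lambda>e. B (dfst (e 0)) (dsnd (e 0)))" .
  then show ?thesis
    by (simp add: pr_le_iff_PR atomic_diagram_def case_prod_beta dfst_def dsnd_def)
qed

text \<open>The atomic diagram of a punctual \<open>B\<close> is primitive recursive, so the
  isomorphism is Delta-2 without an oracle; so is its inverse, whose graph has the arguments
  exchanged.\<close>

lemma Cone_subset_PrCat:
  assumes "relatively_Delta0_categorical 2 E"
  shows "Cone_Delta0 2 \<subseteq> PrCat E"
proof
  fix d assume "d \<in> Cone_Delta0 2"
  then have d: "d \<in> pr_degrees" "\<And>f. Delta0_fun_in (\<lambda>_. 0) 2 f \<Longrightarrow> f \<le>PRd d"
    unfolding Cone_Delta0_def by auto
  have "\<exists>f. is_iso E B f \<and> f \<le>PRd d \<and> inv f \<le>PRd d" if B: "punctual B" "isomorphic B E" for B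
  proof -
    obtain f where f: "is_iso B E f" "Delta0_fun_in (atomic_diagram B) 2 f"
      using assms B(2) unfolding relatively_Delta0_categorical_def by blast
    have 2: "Delta0_fun_in (\<lambda>_. 0) 2 f"
      using Delta0_fun_in_trans[OF punctual_atomic_diagram[OF B(1)] f(2)] .
    have "bij f" using f(1) is_iso_def by blast
    then show ?thesis
      using d(2)[OF 2] d(2)[OF Delta0_fun_in_inv[OF 2]] is_iso_inv[OF f(1)]
      by (intro exI[of _ "inv f"]) (auto simp: inv_inv_eq)
  qed
  then show "d \<in> PrCat E" unfolding PrCat_def using d(1) by blast
qed

section \<open>Equivalence structures and class sizes\<close>

definition esz :: "nat set \<Rightarrow> enat" where
  "esz A = (if finite A then enat (card A) else \<infinity>)"

text \<open>For \<open>x\<close> in \<open>A\<close> the position of \<open>x\<close> in the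
  increasing enumeration of \<open>A\<close>; for a stage \<open>x\<close> the part of the size of
  \<open>A\<close> visible by then.\<close>

definition pos :: "nat set \<Rightarrow> nat \<Rightarrow> nat" where
  "pos A x = card (A \<inter> {..<x})"

lemma pos_sum: "pos A x = (\<Sum>z<x. of_bool (z \<in> A))"
  unfolding pos_def by (simp add: sum_of_bool_eq Int_commute)

lemma pos_Suc: "pos A (Suc x) = pos A x + of_bool (x \<in> A)"
  by (simp add: pos_sum)

lemma pos_mono: "x \<le> y \<Longrightarrow> pos A x \<le> pos A y"
  unfolding pos_def by (intro card_mono) auto

lemma pos_less: "x \<in> A \<Longrightarrow> x < y \<Longrightarrow> pos A x < pos A y"
  using pos_mono[of "Suc x" y A] by (simp add: pos_Suc)

lemma pos_inj_on: "inj_on (pos A) A"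
  by (rule inj_onI) (metis linorder_less_linear pos_less less_irrefl)

lemma esz_infinite [simp]: "infinite A \<Longrightarrow> esz A = \<infinity>"
  by (simp add: esz_def)

lemma esz_image:
  assumes "inj_on f A" shows "esz (f ` A) = esz A"
  using assms by (simp add: esz_def card_image finite_image_iff)

lemma esz_insert: "x \<notin> A \<Longrightarrow> esz (insert x A) = eSuc (esz A)"
  by (simp add: esz_def eSuc_enat)

lemma pos_esz: "x \<in> A \<Longrightarrow> enat (pos A x) < esz A"
proof (cases "finite A")
  case True
  assume "x \<in> A"
  then have "card (A \<inter> {..<x}) < card A" using True by (intro psubset_card_mono) auto
  then show ?thesis using True by (simp add: esz_def pos_def)
qed simp

text \<open>Positions grow by one from an element to the next, so the least element of position at
  least \<open>i\<close> has position exactly \<open>i\<close>.\<close>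

lemma pos_surj:
  assumes "enat i < esz A"
  shows "\<exists>x\<in>A. pos A x = i"
proof -
  have "\<exists>x\<in>A. i \<le> pos A x"
  proof (rule ccontr)
    assume "\<not> (\<exists>x\<in>A. i \<le> pos A x)"
    then have sub: "pos A ` A \<subseteq> {..<i}" by auto
    then have fin: "finite A" using pos_inj_on finite_subset finite_imageD by blast
    then have "card A \<le> i"
      using card_mono[OF _ sub] card_image[OF pos_inj_on, of A] by simp
    then show False using assms fin by (simp add: esz_def)
  qed
  then obtain y where y: "y \<in> A" "i \<le> pos A y" by blast
  define x where "x = (LEAST x. x \<in> A \<and> i \<le> pos A x)"
  have x: "x \<in> A" "i \<le> pos A x"
    unfolding x_def using LeastI[of "\<lambda>x. x \<in> A \<and> i \<le> pos A x" y] y by auto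
  have "pos A x \<le> i"
  proof (rule ccontr)
    assume "\<not> pos A x \<le> i"
    then have gt: "i < pos A x" by simp
    have ne: "A \<inter> {..<x} \<noteq> {}" using gt unfolding pos_def by (intro notI) simp
    define z where "z = Max (A \<inter> {..<x})"
    have z: "z \<in> A" "z < x" unfolding z_def using Max_in[OF _ ne] by auto
    have "A \<inter> {..<x} \<subseteq> insert z (A \<inter> {..<z})"
    proof
      fix u assume u: "u \<in> A \<inter> {..<x}"
      then have "u \<le> z" unfolding z_def by (intro Max_ge) auto
      then show "u \<in> insert z (A \<inter> {..<z})" using u by auto
    qed
    then have "pos A x \<le> Suc (pos A z)"
      unfolding pos_def by (metis card_insert_disjoint card_mono finite_Int finite_insert
          finite_lessThan Int_iff lessThan_iff less_irrefl)
    then have "i \<le> pos A z" using gt by simp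
    then have "x \<le> z" unfolding x_def using z(1) by (intro Least_le) simp
    then show False using z(2) by simp
  qed
  then show ?thesis using x by auto
qed

text \<open>A size, finite or infinite, is the supremum of the counts
  \<open>pos A s\<close>.\<close>

lemma esz_eqI:
  assumes "\<And>v. (\<exists>s. v \<le> pos A s) \<longleftrightarrow> (\<exists>s. v \<le> pos B s)"
  shows "esz A = esz B"
proof -
  have *: "enat v \<le> esz A \<longleftrightarrow> (\<exists>s. v \<le> pos A s)" for v A
  proof
    assume v: "enat v \<le> esz A"
    show "\<exists>s. v \<le> pos A s"
    proof (cases v)
      case (Suc w)
      then have "enat w < esz A" using v by (cases "esz A") auto
      then obtain x where "x \<in> A" "pos A x = w" using pos_surj by blast
      then have "v \<le> pos A (Suc x)" using Suc by (simp add: pos_Suc)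
      then show ?thesis by blast
    qed simp
  next
    assume "\<exists>s. v \<le> pos A s"
    then obtain s where "v \<le> card (A \<inter> {..<s})" unfolding pos_def by blast
    moreover have "card (A \<inter> {..<s}) \<le> card A" if "finite A" using that by (intro card_mono) auto
    ultimately show "enat v \<le> esz A" by (auto simp: esz_def intro: order.trans)
  qed
  have "enat v \<le> esz A \<longleftrightarrow> enat v \<le> esz B" for v unfolding * by (rule assms)
  note le = this
  show ?thesis
  proof (cases "esz A"; cases "esz B")
    fix m n assume "esz A = enat m" "esz B = enat n"
    then show ?thesis using le[of m] le[of n] by simp
  next
    fix m assume "esz A = enat m" "esz B = \<infinity>"
    then show ?thesis using le[of "Suc m"] by simp
  next
    fix m assume "esz A = \<infinity>" "esz B = enat m"
    then show ?thesis using le[of "Suc m"] by simp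
  qed simp
qed

subsection \<open>Isomorphisms of labelled equivalence structures\<close>

text \<open>Elements are matched by their label and by their position within the class. The graph is
  part of the conclusion because decidable labels then make it decidable, which yields Delta-1
  isomorphisms.\<close>

lemma labelled_iso:
  assumes A: "\<And>x y. A x y \<longleftrightarrow> la x = la y" and B: "\<And>x y. B x y \<longleftrightarrow> lb x = lb y"
    and sz: "\<And>k. esz {x. la x = k} = esz {x. lb x = k}"
  shows "\<exists>f. is_iso A B f \<and> (\<forall>x y. f x = y \<longleftrightarrow> la x = lb y \<and> pos {z. la z = la x} x = pos {z. lb z = lb y} y)"
proof -
  have ex: "\<exists>y. la x = lb y \<and> pos {z. la z = la x} x = pos {z. lb z = lb y} y"
    if "\<And>k. esz {x. la x = k} = esz {x. lb x = k}" for la lb :: "nat \<Rightarrow> 'b" and x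
  proof -
    have "enat (pos {z. la z = la x} x) < esz {z. lb z = la x}"
      using pos_esz[of x "{z. la z = la x}"] that by simp
    from pos_surj[OF this] show ?thesis by (metis mem_Collect_eq)
  qed
  have un: "y = y'" if "lb y = lb y'" "pos {z. lb z = lb y} y = pos {z. lb z = lb y'} y'"
    for lb :: "nat \<Rightarrow> 'b" and y y'
    using pos_inj_on[of "{z. lb z = lb y}"] that by (auto dest: inj_onD)
  obtain f where f: "\<And>x. la x = lb (f x)" "\<And>x. pos {z. la z = la x} x = pos {z. lb z = lb (f x)} (f x)"
    using ex[OF sz] by metis
  have f_iff: "f x = y \<longleftrightarrow> la x = lb y \<and> pos {z. la z = la x} x = pos {z. lb z = lb y} y" for x y
    using f[of x] un[of lb "f x" y] by auto
  have "inj f"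
    by (rule injI) (metis f un[of la])
  moreover have "surj f"
    unfolding surj_def
  proof
    fix y
    from ex[of lb la y, OF sz[symmetric]] show "\<exists>x. y = f x" using f_iff by metis
  qed
  ultimately have "is_iso A B f" unfolding is_iso_def bij_def A B using f(1) by simp
  then show ?thesis using f_iff by blast
qed

lemma is_iso_class_size:
  assumes "is_iso A B f"
  shows "esz {y. B (f x) y} = esz {y. A x y}"
proof -
  have "{y. B (f x) y} = f ` {y. A x y}"
    using assms unfolding is_iso_def by (auto simp: image_iff) (metis bij_pointE)
  moreover have "inj_on f {y. A x y}"
    using assms unfolding is_iso_def by (meson bij_is_inj inj_on_subset subset_UNIV)
  ultimately show ?thesis by (simp add: esz_image)
qed

lemma isomorphic_sym: "isomorphic A B \<Longrightarrow> isomorphic B A"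
  unfolding isomorphic_def using is_iso_inv by blast

lemma isomorphic_trans: "isomorphic A B \<Longrightarrow> isomorphic B C \<Longrightarrow> isomorphic A C"
  unfolding isomorphic_def using is_iso_comp by blast

subsection \<open>Structures in which the classes appear immediately\<close>

text \<open>
  Stage \<open>s\<close> contributes a first element of class \<open>s\<close> and, if \<open>l s = Suc k\<close>, one further element of
  class \<open>k\<close>.  The first element of class \<open>s\<close> is the number \<open>spos l s\<close>.
\<close>

definition spos :: "(nat \<Rightarrow> nat) \<Rightarrow> nat \<Rightarrow> nat" where
  "spos l s = s + pos {a. l a \<noteq> 0} s"

text \<open>Stage \<open>s\<close> provides the numbers from \<open>spos l s\<close> up to and
  excluding \<open>spos l (Suc s)\<close>. The search finds the stage of \<open>n\<close>, which is
  at most \<open>n\<close> because every stage provides at least one number.\<close>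

definition slab :: "(nat \<Rightarrow> nat) \<Rightarrow> nat \<Rightarrow> nat" where
  "slab l n = (let s = bmin (Suc n) (\<lambda>s. n < spos l (Suc s)) in if n = spos l s then s else l s - 1)"

definition srel :: "(nat \<Rightarrow> nat) \<Rightarrow> nat \<Rightarrow> nat \<Rightarrow> bool" where
  "srel l x y \<longleftrightarrow> slab l x = slab l y"

text \<open>The first element of the class is left out; \<open>esz_slab_fibre\<close> adds it
  again.\<close>

definition ssize :: "(nat \<Rightarrow> nat) \<Rightarrow> nat \<Rightarrow> enat" where
  "ssize l k = esz {a. l a = Suc k}"

lemma spos_Suc: "spos l (Suc s) = Suc (spos l s + of_bool (l s \<noteq> 0))"
  by (simp add: spos_def pos_Suc)

lemma spos_ge: "s \<le> spos l s" by (simp add: spos_def)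

lemma spos_strict_mono: "strict_mono (spos l)"
  by (rule strict_mono_Suc_iff[THEN iffD2]) (simp add: spos_Suc)

lemma slab_stage:
  assumes "spos l s \<le> n" "n < spos l (Suc s)"
  shows "slab l n = (if n = spos l s then s else l s - 1)"
proof -
  have "bmin (Suc n) (\<lambda>s. n < spos l (Suc s)) = s"
  proof (rule bmin_eq)
    show "s < Suc n" using assms(1) spos_ge[of s l] by simp
    fix z assume "z < s"
    then have "spos l (Suc z) \<le> spos l s"
      using spos_strict_mono by (simp add: strict_mono_less_eq)
    then show "\<not> n < spos l (Suc z)" using assms(1) by simp
  qed fact
  then show ?thesis by (simp add: slab_def Let_def)
qed

lemma slab_spos [simp]: "slab l (spos l s) = s"
  by (subst slab_stage[of l s]) (auto simp: spos_Suc)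

lemma slab_Suc_spos: "l s = Suc k \<Longrightarrow> slab l (Suc (spos l s)) = k"
  by (subst slab_stage[of l s]) (auto simp: spos_Suc)

lemma spos_cases: "\<exists>s. n = spos l s \<or> n = Suc (spos l s) \<and> l s \<noteq> 0"
proof (induction n)
  case 0 show ?case by (intro exI[of _ 0]) (simp add: spos_def pos_def)
next
  case (Suc n)
  then obtain s where s: "n = spos l s \<or> n = Suc (spos l s) \<and> l s \<noteq> 0" by blast
  then show ?case
  proof
    assume "n = spos l s"
    then show ?thesis
      by (cases "l s = 0") (auto simp: spos_Suc intro: exI[of _ s] exI[of _ "Suc s"])
  next
    assume "n = Suc (spos l s) \<and> l s \<noteq> 0"
    then show ?thesis by (auto simp: spos_Suc intro!: exI[of _ "Suc s"])
  qed
qed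

lemma slab_fibre: "{n. slab l n = k} = insert (spos l k) ((\<lambda>a. Suc (spos l a)) ` {a. l a = Suc k})"
proof (intro equalityI subsetI)
  fix n assume n: "n \<in> {n. slab l n = k}"
  obtain s where "n = spos l s \<or> n = Suc (spos l s) \<and> l s \<noteq> 0" using spos_cases by blast
  then show "n \<in> insert (spos l k) ((\<lambda>a. Suc (spos l a)) ` {a. l a = Suc k})"
  proof
    assume "n = spos l s" then show ?thesis using n by simp
  next
    assume s: "n = Suc (spos l s) \<and> l s \<noteq> 0"
    then obtain j where "l s = Suc j" by (cases "l s") auto
    then show ?thesis using s n slab_Suc_spos[of l s j] by auto
  qed
qed (auto simp: slab_Suc_spos)

lemma esz_slab_fibre: "esz {n. slab l n = k} = eSuc (ssize l k)"
proof -
  have "spos l k \<noteq> Suc (spos l a)" if "l a = Suc k" for a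
  proof
    assume eq: "spos l k = Suc (spos l a)"
    have "spos l a < spos l k" "spos l k < spos l (Suc a)" using eq that by (auto simp: spos_Suc)
    then show False using spos_strict_mono[of l] by (simp add: strict_mono_less)
  qed
  moreover have "inj_on (\<lambda>a. Suc (spos l a)) {a. l a = Suc k}"
    using strict_mono_imp_inj_on[OF spos_strict_mono[of l]] by (auto simp: inj_on_def)
  ultimately show ?thesis
    unfolding slab_fibre ssize_def by (subst esz_insert) (auto simp: esz_image)
qed

lemma srel_isomorphic:
  assumes "bij \<pi>" "\<And>k. ssize l (\<pi> k) = ssize l' k"
  shows "isomorphic (srel l') (srel l)"
proof -
  have "srel l x y \<longleftrightarrow> inv \<pi> (slab l x) = inv \<pi> (slab l y)" for x y
    unfolding srel_def using assms(1) by (metis bij_inv_eq_iff)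
  moreover have "{x. inv \<pi> (slab l x) = k} = {x. slab l x = \<pi> k}" for k
    using assms(1) by (metis bij_inv_eq_iff)
  then have "esz {x. slab l' x = k} = esz {x. inv \<pi> (slab l x) = k}" for k
    by (simp add: esz_slab_fibre assms(2))
  ultimately show ?thesis
    using labelled_iso[of "srel l'" "slab l'" "srel l" "\<lambda>x. inv \<pi> (slab l x)"]
    unfolding isomorphic_def srel_def by blast
qed

lemma PR_pos:
  assumes "PRP g (\<lambda>e. e 0 \<in> A (\<lambda>i. e (Suc i)))" "PR g a"
  shows "PR g (\<lambda>e. pos (A e) (a e))"
  unfolding pos_sum by (intro PR_sum assms)

lemma PR_spos:
  assumes "PR g (\<lambda>e. l (e 0))" "PR g a"
  shows "PR g (\<lambda>e. spos l (a e))"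
  unfolding spos_def
  by (intro PR_add PR_pos assms) (simp only: mem_Collect_eq, intro PRP_not PRP_eq PR_const assms)

lemma PR_slab:
  assumes l: "PR g (\<lambda>e. l (e 0))" and a: "PR g a"
  shows "PR g (\<lambda>e. slab l (a e))"
proof -
  have "PR g (\<lambda>e. slab l (e 0))"
    unfolding slab_def Let_def
    by (intro PR_if PRP_eq PR_bmin PRP_less PR_spos[OF l] PR_Suc PR_var PR_diff PR_const PR_subst1[OF l])
  then show ?thesis using a by (rule PR_subst1)
qed

lemma punctual_srel: "PR (\<lambda>_. 0) (\<lambda>e. l (e 0)) \<Longrightarrow> punctual (srel l)"
  unfolding punctual_iff_PR srel_def by (intro PRP_eq PR_slab PR_var)

subsection \<open>Ranking the classes of an equivalence structure\<close>

definition cmin :: "(nat \<Rightarrow> nat \<Rightarrow> bool) \<Rightarrow> nat \<Rightarrow> nat" where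
  "cmin E x = bmin (Suc x) (E x)"

definition reps :: "(nat \<Rightarrow> nat \<Rightarrow> bool) \<Rightarrow> nat set" where
  "reps E = {m. cmin E m = m}"

text \<open>The label sequence that rebuilds \<open>E\<close> up to isomorphism. A least element
  contributes 0 because the stages supply the first elements of classes themselves; any other
  \<open>a\<close> contributes an element to the class with the rank of its own class.\<close>

definition elab :: "(nat \<Rightarrow> nat \<Rightarrow> bool) \<Rightarrow> nat \<Rightarrow> nat" where
  "elab E a = (if cmin E a = a then 0 else Suc (pos (reps E) (cmin E a)))"

lemma cmin_props:
  assumes "equivp E"
  shows "E x (cmin E x)" "cmin E x \<le> x" "E x y \<Longrightarrow> cmin E x \<le> y"
    "E x y \<longleftrightarrow> cmin E x = cmin E y" "cmin E x \<in> reps E"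
proof -
  have 1: "E x (cmin E x) \<and> cmin E x \<le> x \<and> (\<forall>y. E x y \<longrightarrow> cmin E x \<le> y)" for x
  proof -
    have "E x x" using assms by (rule equivp_reflp)
    then have "bmin (Suc x) (E x) < Suc x" unfolding bmin_less_iff by auto
    then show ?thesis
      using bmin_sat[of "Suc x" "E x"] bmin_min[of _ "Suc x" "E x"] unfolding cmin_def by (meson leI less_Suc_eq_le)
  qed
  have 2: "E x y \<longleftrightarrow> cmin E x = cmin E y" for x y
    using 1[of x] 1[of y] assms by (metis equivp_symp equivp_transp order_antisym)
  show "E x (cmin E x)" "cmin E x \<le> x" "E x y \<Longrightarrow> cmin E x \<le> y"
    "E x y \<longleftrightarrow> cmin E x = cmin E y" using 1 2 by blast+
  show "cmin E x \<in> reps E" using 1[of x] 2[of x "cmin E x"] by (simp add: reps_def)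
qed

lemma PR_cmin:
  assumes "PRP g (\<lambda>e. E (e 0) (e 1))" "PR g a"
  shows "PR g (\<lambda>e. cmin E (a e))"
proof -
  have "PRP g (\<lambda>e. E (e 1) (e 0))" by (rule PR_subst2[OF assms(1) PR_var PR_var])
  then have "PR g (\<lambda>e. cmin E (e 0))"
    unfolding cmin_def by (intro PR_bmin PR_Suc PR_var) simp
  then show ?thesis using assms(2) by (rule PR_subst1)
qed

lemma PR_elab:
  assumes "PRP g (\<lambda>e. E (e 0) (e 1))"
  shows "PR g (\<lambda>e. elab E (e 0))"
  unfolding elab_def reps_def
  by (intro PR_if PRP_eq PR_cmin[OF assms] PR_var PR_const PR_Suc PR_pos)
    (simp only: mem_Collect_eq, intro PRP_eq PR_cmin[OF assms] PR_var)

lemma rank_props: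
  assumes E: "equivp E" and inf: "infinite (reps E)"
  defines "r \<equiv> \<lambda>x. pos (reps E) (cmin E x)"
  shows "E x y \<longleftrightarrow> r x = r y" "\<exists>x\<in>reps E. r x = k" "esz {x. r x = k} = eSuc (ssize (elab E) k)"
proof -
  show xy: "E x y \<longleftrightarrow> r x = r y" for x y
    using cmin_props[OF E] pos_inj_on[of "reps E"] unfolding r_def by (metis inj_onD)
  have ex: "\<exists>x\<in>reps E. r x = k" for k
    using pos_surj[of k "reps E"] inf unfolding r_def by (auto simp: reps_def)
  then show "\<exists>x\<in>reps E. r x = k" .
  obtain m where m: "m \<in> reps E" "r m = k" using ex by blast
  have "{x. r x = k} = insert m {x. elab E x = Suc k}"
  proof (intro equalityI subsetI)
    fix x assume "x \<in> {x. r x = k}"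
    then have "r x = k" by simp
    then have "E x m" using m xy by simp
    then have "x \<noteq> m \<Longrightarrow> cmin E x \<noteq> x" using cmin_props(4)[OF E, of x m] m(1) by (auto simp: reps_def)
    then show "x \<in> insert m {x. elab E x = Suc k}" using \<open>r x = k\<close> by (auto simp: elab_def r_def)
  qed (use m(2) in \<open>auto simp: elab_def r_def split: if_splits\<close>)
  moreover have "elab E m \<noteq> Suc k" using m(1) by (simp add: elab_def reps_def)
  ultimately show "esz {x. r x = k} = eSuc (ssize (elab E) k)"
    unfolding ssize_def by (simp add: esz_insert)
qed

lemma isomorphic_srel_elab:
  assumes "equivp E" "infinite (reps E)"
  shows "isomorphic E (srel (elab E))"
  using labelled_iso[of E "\<lambda>x. pos (reps E) (cmin E x)" "srel (elab E)" "slab (elab E)"]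
    rank_props[OF assms] esz_slab_fibre
  unfolding isomorphic_def srel_def by metis

lemma class_size_elab:
  assumes "equivp E" "infinite (reps E)"
  shows "esz {y. E x y} = eSuc (ssize (elab E) (pos (reps E) (cmin E x)))"
proof -
  have "{y. E x y} = {y. pos (reps E) (cmin E y) = pos (reps E) (cmin E x)}"
    using rank_props(1)[OF assms] by auto
  then show ?thesis using rank_props(3)[OF assms] by simp
qed

section \<open>Coding changes into a copy\<close>

definition tr :: "nat \<Rightarrow> nat \<Rightarrow> nat \<Rightarrow> nat" where
  "tr a b r = (if r = a then b else if r = b then a else r)"

lemma tr_tr [simp]: "tr a b (tr a b r) = r" by (simp add: tr_def)
lemma tr_same [simp]: "tr a a r = r" by (simp add: tr_def)
lemma bij_tr: "bij (tr a b)" by (rule o_bij[of "tr a b"]) auto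

text \<open>A history entry codes a transposition and the label contributed by the stage.\<close>

definition perm :: "nat list \<Rightarrow> nat \<Rightarrow> nat" where
  "perm H j = foldl (\<lambda>r q. tr (dfst (dfst q)) (dsnd (dfst q)) r) j H"

definition cnt :: "nat list \<Rightarrow> nat \<Rightarrow> nat" where
  "cnt H j = foldl (\<lambda>r q. r + of_bool (dsnd q = Suc j)) 0 H"

lemma perm_Nil [simp]: "perm [] j = j"
  and perm_Cons: "perm (q # H) j = perm H (tr (dfst (dfst q)) (dsnd (dfst q)) j)"
  by (simp_all add: perm_def)

lemma cnt_Nil [simp]: "cnt [] j = 0" by (simp add: cnt_def)

lemma cnt_Cons: "cnt (q # H) j = cnt H j + of_bool (dsnd q = Suc j)"
proof -
  have sum: "foldl (\<lambda>r q. r + f q) z H = z + (\<Sum>q\<leftarrow>H. f q)" for f :: "nat \<Rightarrow> nat" and z H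
    by (induction H arbitrary: z) simp_all
  show ?thesis unfolding cnt_def sum by simp
qed

text \<open>\<open>srel l\<close> is the copy A, \<open>c\<close> its sequence of coding classes,
  and \<open>D x s\<close> says that \<open>s\<close> is a change for \<open>x\<close>. After the
  history \<open>H\<close>, class \<open>j\<close> of B copies class \<open>perm H j\<close> of A
  and has received \<open>cnt H j\<close> elements besides its first.\<close>

locale coding =
  fixes l :: "nat \<Rightarrow> nat" and c :: "nat \<Rightarrow> nat" and D :: "nat \<Rightarrow> nat \<Rightarrow> bool"
  assumes inj_c: "inj c"
    and fin_c: "\<And>t. ssize l (c t) \<noteq> \<infinity>"
    and large: "\<And>j. infinite {k. \<forall>t\<le>j. ssize l (c t) < ssize l k}"
    and fin_D: "\<And>x. finite {s. D x s}"
begin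

definition m :: "nat \<Rightarrow> nat \<Rightarrow> nat" where
  "m k s = pos {a. l a = Suc k} s"

text \<open>A class is bad while a change demands that it exceed coding classes and its target does
  not visibly do so. The guards \<open>x \<le> j\<close> and \<open>x \<le> perm H j\<close> expose
  each index and each target to finitely many \<open>x\<close>, hence to finitely many changes. The
  bound \<open>2 * j\<close> is what \<open>coded_bound\<close> requires: it finds some
  \<open>t \<le> 2 * x\<close> for which the index satisfies \<open>x \<le> j\<close>.\<close>

definition bad :: "nat list \<Rightarrow> nat \<Rightarrow> nat \<Rightarrow> bool" where
  "bad H s j \<longleftrightarrow> (\<exists>t\<le>2 * j. m (perm H j) s \<le> m (c t) s) \<and>
     (\<exists>x\<le>j. x \<le> perm H j \<and> (\<exists>s'\<le>s. j < s' \<and> D x s'))"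

definition fbad :: "nat list \<Rightarrow> nat \<Rightarrow> nat" where
  "fbad H s = bmin s (bad H s)"

text \<open>A partner has not grown, so it can take over any target; its own target is visibly large
  enough for the first bad class.\<close>

definition cand :: "nat list \<Rightarrow> nat \<Rightarrow> nat \<Rightarrow> bool" where
  "cand H s j \<longleftrightarrow> fbad H s < j \<and> cnt H j = 0 \<and> (\<forall>t\<le>2 * fbad H s. m (c t) s < m (perm H j) s)"

definition partner :: "nat list \<Rightarrow> nat \<Rightarrow> nat" where
  "partner H s = bmin (Suc s) (cand H s)"

text \<open>The pair \<open>(0, 0)\<close> stands for the identity. Stage \<open>s\<close> serves
  class \<open>dfst s\<close>, so every class is served infinitely often. Growth only below the
  first bad class preserves the later classes as possible partners.\<close>

definition entry :: "nat list \<Rightarrow> nat \<Rightarrow> nat" where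
  "entry H s = prod_encode
     (if fbad H s < s \<and> partner H s \<le> s then prod_encode (fbad H s, partner H s) else prod_encode (0, 0),
      if dfst s < fbad H s \<and> cnt H (dfst s) < m (perm H (dfst s)) s then Suc (dfst s) else 0)"

primrec hist :: "nat \<Rightarrow> nat list" where
  "hist 0 = []"
| "hist (Suc s) = entry (hist s) s # hist s"

declare hist.simps [simp del]

definition l2 :: "nat \<Rightarrow> nat" where
  "l2 s = dsnd (entry (hist s) s)"

lemma cnt_0 [simp]: "cnt (hist 0) j = 0" by (simp add: hist.simps)

lemma cnt_Suc: "cnt (hist (Suc s)) j = cnt (hist s) j + of_bool (l2 s = Suc j)"
  by (simp add: hist.simps cnt_Cons l2_def)

abbreviation \<alpha> :: "nat \<Rightarrow> nat \<Rightarrow> nat" where "\<alpha> s \<equiv> perm (hist s)"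

definition acts :: "nat \<Rightarrow> bool" where
  "acts s \<longleftrightarrow> fbad (hist s) s < s \<and> partner (hist s) s \<le> s"

lemma \<alpha>_Suc: "\<alpha> (Suc s) j = (if acts s then \<alpha> s (tr (fbad (hist s) s) (partner (hist s) s) j) else \<alpha> s j)"
  by (simp add: hist.simps perm_Cons entry_def acts_def)

lemma bij_\<alpha>: "bij (\<alpha> s)"
proof (induction s)
  case 0
  have "\<alpha> 0 = id" by (auto simp: hist.simps)
  then show ?case by (simp only: bij_id)
next
  case (Suc s)
  have "\<alpha> (Suc s) = (if acts s then \<alpha> s \<circ> tr (fbad (hist s) s) (partner (hist s) s) else \<alpha> s)"
    using \<alpha>_Suc by (auto simp: fun_eq_iff)
  then show ?case using Suc bij_tr by (auto intro: bij_comp)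
qed

lemma \<alpha>_eq_iff: "\<alpha> s j = \<alpha> s j' \<longleftrightarrow> j = j'"
  using bij_\<alpha> by (simp add: bij_is_inj inj_eq)

lemma cnt_pos: "cnt (hist s) j = pos {a. l2 a = Suc j} s"
  by (induction s) (simp_all add: cnt_Suc pos_Suc, simp add: pos_def)

lemma cnt_mono: "s \<le> s' \<Longrightarrow> cnt (hist s) j \<le> cnt (hist s') j"
  by (simp add: cnt_pos pos_mono)

lemma m_mono: "s \<le> s' \<Longrightarrow> m k s \<le> m k s'"
  by (simp add: m_def pos_mono)

lemma l2_eq_Suc: "l2 s = Suc j \<longleftrightarrow> dfst s = j \<and> j < fbad (hist s) s \<and> cnt (hist s) j < m (\<alpha> s j) s"
  by (auto simp: l2_def entry_def)

lemma fbad_bad: "fbad (hist s) s < s \<Longrightarrow> bad (hist s) s (fbad (hist s) s)"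
  unfolding fbad_def by (rule bmin_sat)

lemma less_fbad: "j < fbad (hist s) s \<Longrightarrow> \<not> bad (hist s) s j"
  unfolding fbad_def by (rule bmin_min)

lemma fbad_le: "bad (hist s) s j \<Longrightarrow> fbad (hist s) s \<le> j \<and> fbad (hist s) s < s"
proof -
  assume b: "bad (hist s) s j"
  then have "j < s" unfolding bad_def by auto
  then show ?thesis using b less_fbad[of j s] unfolding fbad_def bmin_less_iff by (meson not_less)
qed

lemma actsD:
  assumes "acts s"
  defines "j \<equiv> fbad (hist s) s" and "j' \<equiv> partner (hist s) s"
  shows "bad (hist s) s j" "j < j'" "cnt (hist s) j' = 0" "t \<le> 2 * j \<Longrightarrow> m (c t) s < m (\<alpha> s j') s"
    "\<alpha> (Suc s) j = \<alpha> s j'" "\<alpha> (Suc s) j' = \<alpha> s j" "k \<noteq> j \<Longrightarrow> k \<noteq> j' \<Longrightarrow> \<alpha> (Suc s) k = \<alpha> s k"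
proof -
  show "bad (hist s) s j" using assms fbad_bad by (simp add: acts_def)
  have "partner (hist s) s < Suc s" using assms(1) by (simp add: acts_def)
  then have "cand (hist s) s j'" unfolding j'_def partner_def by (rule bmin_sat)
  then show "j < j'" "cnt (hist s) j' = 0" "t \<le> 2 * j \<Longrightarrow> m (c t) s < m (\<alpha> s j') s"
    unfolding cand_def j_def by auto
  then show "\<alpha> (Suc s) j = \<alpha> s j'" "\<alpha> (Suc s) j' = \<alpha> s j" "k \<noteq> j \<Longrightarrow> k \<noteq> j' \<Longrightarrow> \<alpha> (Suc s) k = \<alpha> s k"
    using assms(1) by (auto simp: \<alpha>_Suc tr_def j_def j'_def)
qed

lemma \<alpha>_change:
  assumes "\<alpha> (Suc s) j \<noteq> \<alpha> s j"
  shows "acts s" "j = fbad (hist s) s \<or> j = partner (hist s) s"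
proof -
  show "acts s" using assms by (auto simp: \<alpha>_Suc split: if_splits)
  then show "j = fbad (hist s) s \<or> j = partner (hist s) s" using actsD(7)[of s j] assms by blast
qed

text \<open>The copy never gets ahead of A. A swap preserves this: the partner has received nothing,
  and the bad class has received at most what its old target shows, which is at most some
  \<open>c t\<close> that the new target exceeds.\<close>

lemma cnt_le: "cnt (hist s) j \<le> m (\<alpha> s j) s"
proof (induction s arbitrary: j)
  case 0 show ?case by simp
next
  case (Suc s)
  show ?case
  proof (cases "\<alpha> (Suc s) j = \<alpha> s j")
    case True
    have "cnt (hist (Suc s)) j \<le> m (\<alpha> s j) s"
      using Suc[of j] l2_eq_Suc[of s j] by (auto simp: cnt_Suc)
    then show ?thesis using True m_mono[of s "Suc s"] by (metis le_SucI order.refl order.trans)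
  next
    case False
    note ch = \<alpha>_change[OF False]
    have "\<not> j < fbad (hist s) s" using ch actsD(2)[OF ch(1)] by auto
    then have cj: "cnt (hist (Suc s)) j = cnt (hist s) j"
      using l2_eq_Suc[of s j] by (auto simp: cnt_Suc)
    have "cnt (hist s) j \<le> m (\<alpha> (Suc s) j) s"
      using ch(2)
    proof
      assume j: "j = partner (hist s) s"
      then show ?thesis using actsD(3)[OF ch(1)] by simp
    next
      assume j: "j = fbad (hist s) s"
      obtain t where "t \<le> 2 * j" "m (\<alpha> s j) s \<le> m (c t) s"
        using actsD(1)[OF ch(1)] unfolding bad_def j by blast
      then show ?thesis
        using Suc[of j] actsD(4)[OF ch(1), of t] actsD(5)[OF ch(1)] unfolding j by simp
    qed
    then show ?thesis using cj m_mono[of s "Suc s"] by (metis le_SucI order.refl order.trans)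
  qed
qed

section \<open>Every class of the copy settles\<close>

lemma fin_limit:
  assumes "ssize l k \<noteq> \<infinity>"
  shows "\<exists>T. \<forall>s\<ge>T. m k s = m k T"
proof -
  have "finite {a. l a = Suc k}" using assms unfolding ssize_def by (metis esz_infinite)
  then obtain T where T: "\<And>a. l a = Suc k \<Longrightarrow> a < T"
    unfolding finite_nat_set_iff_bounded by blast
  have "{a. l a = Suc k} \<inter> {..<s} = {a. l a = Suc k} \<inter> {..<T}" if "s \<ge> T" for s
    using T that by (auto dest: less_le_trans)
  then show ?thesis unfolding m_def pos_def by metis
qed

lemma m_le_ssize: "enat (m k s) \<le> ssize l k"
  unfolding m_def ssize_def pos_def esz_def by (auto intro: card_mono)

lemma less_ssize: "enat v < ssize l k \<Longrightarrow> \<exists>s. v < m k s"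
  unfolding m_def ssize_def using pos_surj[of v "{a. l a = Suc k}"] by (metis lessI pos_less)

lemma m_c_limit: "\<exists>T. \<forall>t\<le>n. \<forall>s\<ge>T. m (c t) s = m (c t) T"
proof -
  have "\<forall>t. \<exists>T. \<forall>s\<ge>T. m (c t) s = m (c t) T" using fin_limit[OF fin_c] by blast
  then obtain T where T: "\<And>t s. s \<ge> T t \<Longrightarrow> m (c t) s = m (c t) (T t)" by metis
  have "T t \<le> (\<Sum>t\<le>n. T t)" if "t \<le> n" for t using that by (intro member_le_sum) auto
  then have "\<forall>t\<le>n. \<forall>s\<ge>(\<Sum>t\<le>n. T t). m (c t) s = m (c t) (\<Sum>t\<le>n. T t)"
    using T by (metis order.trans)
  then show ?thesis by blast
qed

definition settled :: "nat \<Rightarrow> nat \<Rightarrow> bool" where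
  "settled T j \<longleftrightarrow> (\<forall>s\<ge>T. \<alpha> s j = \<alpha> T j \<and> \<not> bad (hist s) s j)"

lemma settled_mono: "settled T j \<Longrightarrow> T \<le> T' \<Longrightarrow> settled T' j"
  unfolding settled_def by (metis order.trans)

text \<open>
  If \<open>j\<close> stayed bad forever, the growth of all later classes would be blocked, so that only finitely
  many classes are unsuitable as partners because they have already grown.
\<close>

lemma not_bad_forever:
  assumes "\<And>s. s \<ge> T \<Longrightarrow> fbad (hist s) s = j \<and> j < s \<and> \<not> acts s"
    and lim: "\<And>t s. t \<le> 2 * j \<Longrightarrow> s \<ge> T \<Longrightarrow> m (c t) s = m (c t) T"
  shows False
proof -
  have \<alpha>T: "\<alpha> s k = \<alpha> T k" if "s \<ge> T" for s k
    using that by (induction s rule: dec_induct) (use assms(1) \<alpha>_Suc in auto)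
  have cntT: "cnt (hist s) k = cnt (hist T) k" if "s \<ge> T" "k \<ge> j" for s k
    using that(1)
  proof (induction s rule: dec_induct)
    case (step s)
    then have "l2 s \<noteq> Suc k" using assms(1)[of s] that(2) l2_eq_Suc[of s k] by auto
    then show ?case using step by (simp add: cnt_Suc)
  qed simp
  \<comment> \<open>Stage \<open>a\<close> can serve only class \<open>dfst a\<close>, so finitely
    many classes have grown before \<open>T\<close>.\<close>
  have "{k. cnt (hist T) k > 0} \<subseteq> dfst ` {..<T}"
  proof
    fix k assume "k \<in> {k. cnt (hist T) k > 0}"
    then have "pos {a. l2 a = Suc k} T > 0" by (simp add: cnt_pos)
    then have "{a. l2 a = Suc k} \<inter> {..<T} \<noteq> {}" unfolding pos_def using card_gt_0_iff by blast
    then obtain a where "l2 a = Suc k" "a < T" by auto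
    then show "k \<in> dfst ` {..<T}" using l2_eq_Suc[of a k] by auto
  qed
  then have fin: "finite ({k. cnt (hist T) k > 0} \<union> {..j})" using finite_surj by auto
  have "infinite {k. \<forall>t\<le>2 * j. ssize l (c t) < ssize l k}" by (rule large)
  then have "infinite (\<alpha> T -` {k. \<forall>t\<le>2 * j. ssize l (c t) < ssize l k})"
    using finite_vimage_iff[OF bij_\<alpha>] by blast
  from infinite_super[OF _ this] have "\<not> \<alpha> T -` {k. \<forall>t\<le>2 * j. ssize l (c t) < ssize l k} \<subseteq> {k. cnt (hist T) k > 0} \<union> {..j}"
    using fin \<open>infinite (\<alpha> T -` _)\<close> finite_subset by blast
  then obtain k where "k \<in> \<alpha> T -` {k. \<forall>t\<le>2 * j. ssize l (c t) < ssize l k}"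
    "k \<notin> {k. cnt (hist T) k > 0} \<union> {..j}" by blast
  then have k: "\<forall>t\<le>2 * j. ssize l (c t) < ssize l (\<alpha> T k)" "cnt (hist T) k = 0" "j < k"
    by simp_all
  have "\<exists>s. \<forall>t\<le>2 * j. m (c t) T < m (\<alpha> T k) s"
  proof -
    have "\<forall>t\<in>{..2 * j}. \<exists>s. m (c t) T < m (\<alpha> T k) s"
    proof
      fix t assume "t \<in> {..2 * j}"
      then have "enat (m (c t) T) < ssize l (\<alpha> T k)"
        using k(1) m_le_ssize[of "c t" T] by (auto intro: le_less_trans)
      then show "\<exists>s. m (c t) T < m (\<alpha> T k) s" by (rule less_ssize)
    qed
    then obtain S where S: "\<And>t. t \<le> 2 * j \<Longrightarrow> m (c t) T < m (\<alpha> T k) (S t)" by (metis atMost_iff)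
    have "S t \<le> (\<Sum>t\<le>2 * j. S t)" if "t \<le> 2 * j" for t using that by (intro member_le_sum) auto
    then show ?thesis using S m_mono by (meson less_le_trans)
  qed
  then obtain s0 where s0: "\<And>t. t \<le> 2 * j \<Longrightarrow> m (c t) T < m (\<alpha> T k) s0" by blast
  \<comment> \<open>Late enough that the target of \<open>k\<close> has outgrown the coding classes,
    and that \<open>k\<close> lies in the range of the search for a partner.\<close>
  define s where "s = s0 + T + k"
  have "cand (hist s) s k"
    unfolding cand_def
  proof (intro conjI allI impI)
    have fb: "fbad (hist s) s = j" using assms(1)[of s] s_def by simp
    show "fbad (hist s) s < k" using fb k(3) by simp
    show "cnt (hist s) k = 0" using cntT[of s k] k s_def by simp
    fix t assume "t \<le> 2 * fbad (hist s) s"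
    then have t: "t \<le> 2 * j" using fb by simp
    have "m (c t) s < m (\<alpha> T k) s0" using lim[OF t, of s] s0[OF t] s_def by simp
    also have "\<dots> \<le> m (\<alpha> s k) s" using \<alpha>T[of s k] m_mono[of s0 s] s_def by simp
    finally show "m (c t) s < m (\<alpha> s k) s" .
  qed
  moreover have "k < Suc s" by (simp add: s_def)
  ultimately have "partner (hist s) s < Suc s" unfolding partner_def bmin_less_iff by blast
  then have "acts s" using assms(1)[of s] by (simp add: acts_def s_def)
  then show False using assms(1)[of s] by (simp add: s_def)
qed

text \<open>Finite injury. Once the smaller indices have settled and the classes \<open>c t\<close>
  with \<open>t \<le> 2 * j\<close> have stopped growing, the first bad index is at least
  \<open>j\<close>. As partners lie above the first bad index, the target of \<open>j\<close> then
  changes only when \<open>j\<close> itself is the first bad index.\<close>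

lemma ex_settled: "\<exists>T. settled T j"
proof (induction j rule: less_induct)
  case (less j)
  then obtain S where S: "\<And>i. i < j \<Longrightarrow> settled (S i) i" by metis
  obtain T0 where T0: "\<And>t s. t \<le> 2 * j \<Longrightarrow> s \<ge> T0 \<Longrightarrow> m (c t) s = m (c t) T0"
    using m_c_limit[of "2 * j"] by blast
  define T where "T = (\<Sum>i<j. S i) + T0"
  have "S i \<le> (\<Sum>i<j. S i)" if "i < j" for i using that by (intro member_le_sum) auto
  then have low: "settled T i" if "i < j" for i
    using S[OF that] that settled_mono unfolding T_def by (meson order.trans le_add1)
  have lim: "m (c t) s = m (c t) s'" if "t \<le> 2 * j" "s \<ge> T" "s' \<ge> T" for t s s'
    using T0[OF that(1), of s] T0[OF that(1), of s'] that unfolding T_def by simp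
  have ge: "j \<le> fbad (hist s) s" if "s \<ge> T" "fbad (hist s) s < s" for s
    using low[of "fbad (hist s) s"] fbad_bad[OF that(2)] that(1) unfolding settled_def by (meson not_less)
  have change: "acts s \<and> fbad (hist s) s = j" if "s \<ge> T" "\<alpha> (Suc s) j \<noteq> \<alpha> s j" for s
  proof -
    have a: "acts s" by (rule \<alpha>_change(1)[OF that(2)])
    then have "j \<le> fbad (hist s) s" using ge that(1) by (simp add: acts_def)
    then show ?thesis using a \<alpha>_change(2)[OF that(2)] actsD(2)[OF a] by auto
  qed
  show ?case
  proof (cases "\<exists>s\<ge>T. acts s \<and> fbad (hist s) s = j")
    case True
    then obtain s0 where s0: "s0 \<ge> T" "acts s0" "fbad (hist s0) s0 = j" by blast
    \<comment> \<open>The new target exceeds the coding classes, which no longer grow, so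
      \<open>j\<close> is never bad again.\<close>
    define k where "k = \<alpha> (Suc s0) j"
    have k: "m (c t) s < m k s" if "t \<le> 2 * j" "s \<ge> s0" for t s
    proof -
      have "m (c t) s = m (c t) s0" using lim[OF that(1), of s s0] s0(1) that(2) by simp
      also have "\<dots> < m k s0" using actsD(4,5)[OF s0(2)] that(1) unfolding k_def s0(3) by simp
      also have "\<dots> \<le> m k s" using that(2) by (rule m_mono)
      finally show ?thesis .
    qed
    have nb: "\<not> bad (hist s) s j" if "\<alpha> s j = k" "s \<ge> s0" for s
      using k[OF _ that(2)] that(1) unfolding bad_def by (metis not_le)
    have "\<alpha> s j = k" if "s \<ge> Suc s0" for s
      using that
    proof (induction s rule: dec_induct)
      case base show ?case by (simp add: k_def)
    next
      case (step s)
      have "\<not> bad (hist s) s j" using nb[of s] step by simp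
      then have "\<alpha> (Suc s) j = \<alpha> s j"
        using change[of s] actsD(1)[of s] step(1) s0(1) by (metis Suc_leD order.trans)
      then show ?case using step by simp
    qed
    then have "settled (Suc s0) j" unfolding settled_def using nb by (metis Suc_leD order.refl)
    then show ?thesis by blast
  next
    case False
    have const: "\<alpha> s j = \<alpha> T j" if "s \<ge> T" for s
      using that
    proof (induction s rule: dec_induct)
      case (step s)
      then show ?case using change[of s] False by metis
    qed simp
    have good: "\<exists>T'. settled T' j" if "T' \<ge> T" "\<And>s. s \<ge> T' \<Longrightarrow> \<not> bad (hist s) s j" for T'
    proof -
      have "settled T' j"
        unfolding settled_def
      proof (intro allI impI conjI)
        fix s assume "T' \<le> s"
        then show "\<alpha> s j = \<alpha> T' j" "\<not> bad (hist s) s j"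
          using const[of s] const[of T'] that by auto
      qed
      then show ?thesis ..
    qed
    show ?thesis
    proof (cases "\<exists>s\<ge>T. bad (hist s) s j \<and> (\<forall>s'\<ge>s. bad (hist s') s' j)")
      case True
      then obtain s1 where s1: "s1 \<ge> T" "\<And>s. s \<ge> s1 \<Longrightarrow> bad (hist s) s j" by blast
      have "fbad (hist s) s = j \<and> j < s \<and> \<not> acts s" if "s \<ge> s1" for s
      proof -
        have "fbad (hist s) s = j"
          using fbad_le[OF s1(2)[OF that]] ge[of s] s1(1) that by simp
        then show ?thesis using fbad_le[OF s1(2)[OF that]] False s1(1) that by auto
      qed
      then have False
      proof (rule not_bad_forever)
        show "m (c t) s = m (c t) s1" if "t \<le> 2 * j" "s \<ge> s1" for t s
          using lim[OF that(1), of s s1] that(2) s1(1) by simp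
      qed
      then show ?thesis ..
    next
      case nf: False
      \<comment> \<open>The clause about changes persists, so badness at a fixed target ends only
        through growth of the target, and this is final.\<close>
      have drop: "\<not> bad (hist s'') s'' j" if "s \<ge> T" "bad (hist s) s j" "s' \<ge> s" "\<not> bad (hist s') s' j" "s'' \<ge> s'" for s s' s''
      proof -
        from that(2) obtain x u where x: "x \<le> j" "x \<le> \<alpha> s j" "u \<le> s" "j < u" "D x u"
          unfolding bad_def by blast
        have "\<alpha> s' j = \<alpha> s j" using const[of s] const[of s'] that by simp
        then have "\<not> (\<exists>t\<le>2 * j. m (\<alpha> s' j) s' \<le> m (c t) s')"
          using that(4) x that(3) unfolding bad_def by (metis order.trans)
        moreover have "\<alpha> s'' j = \<alpha> s' j" using const[of s''] const[of s'] that by simp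
        moreover have "m (\<alpha> s' j) s' \<le> m (\<alpha> s' j) s''" using that(5) by (rule m_mono)
        moreover have "m (c t) s'' = m (c t) s'" if "t \<le> 2 * j" for t
          using lim[OF that, of s'' s'] \<open>s \<ge> T\<close> \<open>s' \<ge> s\<close> \<open>s'' \<ge> s'\<close> by simp
        ultimately show ?thesis unfolding bad_def by (metis order.trans)
      qed
      show ?thesis
      proof (cases "\<exists>s\<ge>T. bad (hist s) s j")
        case True
        then obtain s where s: "s \<ge> T" "bad (hist s) s j" by blast
        then obtain s' where "s' \<ge> s" "\<not> bad (hist s') s' j" using nf by blast
        then show ?thesis using good[of s'] drop[OF s] s(1) by (meson order.trans)
      next
        case False
        then show ?thesis using good[of T] by blast
      qed
    qed
  qed
qed

section \<open>The limit permutation and the class sizes of the copy\<close>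

definition \<pi> :: "nat \<Rightarrow> nat" where
  "\<pi> j = \<alpha> (SOME T. settled T j) j"

lemma \<pi>_limit: "\<exists>T. \<forall>s\<ge>T. \<alpha> s j = \<pi> j \<and> \<not> bad (hist s) s j"
proof -
  have "settled (SOME T. settled T j) j" using ex_settled by (rule someI_ex)
  then show ?thesis unfolding settled_def \<pi>_def by blast
qed

lemma \<pi>_limits: "\<exists>T. \<forall>j\<le>n. \<forall>s\<ge>T. \<alpha> s j = \<pi> j \<and> \<not> bad (hist s) s j"
proof -
  obtain T where T: "\<And>j s. s \<ge> T j \<Longrightarrow> \<alpha> s j = \<pi> j \<and> \<not> bad (hist s) s j"
    using \<pi>_limit by metis
  have "T j \<le> (\<Sum>j\<le>n. T j)" if "j \<le> n" for j using that by (intro member_le_sum) auto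
  then show ?thesis using T by (meson order.trans)
qed

text \<open>For surjectivity, a target \<open>e\<close> is followed to the least index
  \<open>j\<close> that holds it at some late stage. If \<open>e\<close> left \<open>j\<close>
  because \<open>j\<close> is bad, then \<open>j\<close> would lie below a change for some
  \<open>x \<le> e\<close>, but such indices have already settled. If \<open>e\<close> left because
  \<open>j\<close> is a partner, it would move to a smaller index.\<close>

lemma bij_\<pi>: "bij \<pi>"
proof (rule bijI)
  show "inj \<pi>"
  proof (rule injI)
    fix i j assume "\<pi> i = \<pi> j"
    moreover obtain T where "\<And>k s. k \<le> i + j \<Longrightarrow> s \<ge> T \<Longrightarrow> \<alpha> s k = \<pi> k"
      using \<pi>_limits[of "i + j"] by blast
    ultimately show "i = j" using \<alpha>_eq_iff[of T i j] by simp
  qed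
  show "surj \<pi>"
    unfolding surj_def
  proof
    fix e
    have "finite (\<Union>x\<le>e. {s. D x s})" using fin_D by simp
    then obtain S where S: "\<And>x s. x \<le> e \<Longrightarrow> D x s \<Longrightarrow> s \<le> S"
      by (metis (mono_tags, lifting) UN_iff atMost_iff finite_nat_set_iff_bounded_le mem_Collect_eq)
    obtain T where T: "\<And>k s. k \<le> S \<Longrightarrow> s \<ge> T \<Longrightarrow> \<alpha> s k = \<pi> k"
      using \<pi>_limits[of S] by blast
    define P where "P j \<longleftrightarrow> (\<exists>s\<ge>T. \<alpha> s j = e)" for j
    have "P (inv (\<alpha> T) e)" unfolding P_def using bij_\<alpha> by (metis bij_inv_eq_iff order.refl)
    define j where "j = (LEAST j. P j)"
    have "P j" unfolding j_def using \<open>P (inv (\<alpha> T) e)\<close> by (rule LeastI)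
    then obtain s0 where s0: "s0 \<ge> T" "\<alpha> s0 j = e" unfolding P_def by blast
    have "\<alpha> s j = e" if "s \<ge> s0" for s
      using that
    proof (induction s rule: dec_induct)
      case (step s)
      show ?case
      proof (rule ccontr)
        assume "\<not> \<alpha> (Suc s) j = e"
        then have ch: "\<alpha> (Suc s) j \<noteq> \<alpha> s j" using step by simp
        note a = \<alpha>_change(1)[OF ch]
        show False
          using \<alpha>_change(2)[OF ch]
        proof
          assume j: "j = fbad (hist s) s"
          then obtain x u where "x \<le> \<alpha> s j" "j < u" "D x u"
            using actsD(1)[OF a] unfolding bad_def by blast
          then have "j \<le> S" using S[of x u] step by simp
          then have "\<alpha> (Suc s) j = \<alpha> s j" using T[of j s] T[of j "Suc s"] step s0 by simp
          then show False using ch by simp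
        next
          assume j: "j = partner (hist s) s"
          have "\<alpha> (Suc s) (fbad (hist s) s) = e" using actsD(5)[OF a] j step by simp
          then have "P (fbad (hist s) s)" unfolding P_def using step s0 by (intro exI[of _ "Suc s"]) simp
          then have "j \<le> fbad (hist s) s" unfolding j_def by (rule Least_le)
          then show False using actsD(2)[OF a] j by simp
        qed
      qed
    qed (rule s0(2))
    moreover obtain T' where "\<And>s. s \<ge> T' \<Longrightarrow> \<alpha> s j = \<pi> j" using \<pi>_limit by blast
    ultimately have "\<pi> j = e" by (metis nle_le)
    then show "\<exists>j. e = \<pi> j" by blast
  qed
qed

text \<open>One bound is \<open>cnt_le\<close>. Conversely, once the indices up to \<open>j\<close>
  have settled, each stage that serves \<open>j\<close> adds an element as long as the target is
  ahead.\<close>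

lemma ssize_l2: "ssize l2 j = ssize l (\<pi> j)"
  unfolding ssize_def
proof (rule esz_eqI)
  obtain T where T: "\<And>k s. k \<le> j \<Longrightarrow> s \<ge> T \<Longrightarrow> \<alpha> s k = \<pi> k \<and> \<not> bad (hist s) s k"
    using \<pi>_limits[of j] by blast
  fix v
  show "(\<exists>s. v \<le> pos {a. l2 a = Suc j} s) \<longleftrightarrow> (\<exists>s. v \<le> pos {a. l a = Suc (\<pi> j)} s)"
  proof
    assume "\<exists>s. v \<le> pos {a. l2 a = Suc j} s"
    then obtain s where s: "v \<le> cnt (hist s) j" by (auto simp: cnt_pos)
    have "v \<le> cnt (hist (s + T)) j" using s cnt_mono[of s "s + T" j] by simp
    also have "\<dots> \<le> m (\<alpha> (s + T) j) (s + T)" by (rule cnt_le)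
    also have "\<alpha> (s + T) j = \<pi> j" using T[of j "s + T"] by simp
    finally show "\<exists>s. v \<le> pos {a. l a = Suc (\<pi> j)} s" unfolding m_def by blast
  next
    assume "\<exists>s. v \<le> pos {a. l a = Suc (\<pi> j)} s"
    then obtain s1 where s1: "v \<le> m (\<pi> j) s1" unfolding m_def by blast
    have "w \<le> v \<Longrightarrow> \<exists>s. w \<le> cnt (hist s) j" for w
    proof (induction w)
      case (Suc w)
      then obtain s where s: "w \<le> cnt (hist s) j" by auto
      \<comment> \<open>A stage that serves \<open>j\<close> beyond all given bounds, since a pair
        code is at least its second component.\<close>
      define s' where "s' = prod_encode (j, Suc (j + T + s1 + s))"
      have s': "s' \<ge> Suc (j + T + s1 + s)" unfolding s'_def by (rule le_prod_encode_2)
      show ?case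
      proof (cases "cnt (hist s') j \<ge> Suc w")
        case False
        have c: "cnt (hist s') j = w" using False s cnt_mono[of s s' j] s' by simp
        have "m (\<pi> j) s1 \<le> m (\<pi> j) s'" using s' by (intro m_mono) simp
        then have "cnt (hist s') j < m (\<alpha> s' j) s'" using c s1 Suc(2) T[of j s'] s' by simp
        moreover have "j < fbad (hist s') s'"
        proof (rule ccontr)
          assume "\<not> j < fbad (hist s') s'"
          then have "fbad (hist s') s' \<le> j" by simp
          moreover from this have "bad (hist s') s' (fbad (hist s') s')" using s' by (intro fbad_bad) simp
          ultimately show False using T[of "fbad (hist s') s'" s'] s' by simp
        qed
        moreover have "dfst s' = j" by (simp add: s'_def)
        ultimately have "l2 s' = Suc j" by (simp add: l2_eq_Suc)
        then have "cnt (hist (Suc s')) j = Suc w" using c by (simp add: cnt_Suc)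
        then show ?thesis by (metis order.refl)
      qed blast
    qed simp
    then show "\<exists>s. v \<le> pos {a. l2 a = Suc j} s" unfolding cnt_pos by simp
  qed
qed

lemma isomorphic_l2: "isomorphic (srel l2) (srel l)"
  using srel_isomorphic[OF bij_\<pi>, of l l2] ssize_l2 by simp

text \<open>At late stages \<open>j\<close> is not bad although the clause of \<open>bad\<close>
  about changes holds. So the clause about sizes fails, also at a stage at which \<open>c t\<close>
  has its final size.\<close>

lemma coded_size:
  assumes "D x s" "x \<le> j" "j < s" "x \<le> \<pi> j" "t \<le> 2 * j"
  shows "ssize l (c t) < ssize l (\<pi> j)"
proof -
  obtain T where T: "\<And>s. s \<ge> T \<Longrightarrow> \<alpha> s j = \<pi> j \<and> \<not> bad (hist s) s j" using \<pi>_limit by blast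
  obtain T' where T': "\<And>s. s \<ge> T' \<Longrightarrow> m (c t) s = m (c t) T'" using fin_limit[OF fin_c] by blast
  define u where "u = s + T + T'"
  have u: "u \<ge> s" "u \<ge> T" "u \<ge> T'" by (simp_all add: u_def)
  have "m (c t) u < m (\<pi> j) u"
    using T[OF u(2)] assms u(1) unfolding bad_def by (metis not_le)
  moreover have "ssize l (c t) \<le> enat (m (c t) u)"
  proof (rule ccontr)
    assume "\<not> ssize l (c t) \<le> enat (m (c t) u)"
    then obtain w where w: "m (c t) u < m (c t) w" using less_ssize by (meson not_le)
    have "m (c t) w \<le> m (c t) (w + u)" by (rule m_mono) simp
    then show False using w T'[OF u(3)] T'[of "w + u"] u(3) by simp
  qed
  ultimately show ?thesis
    using m_le_ssize[of "\<pi> j" u] by (metis enat_ord_simps(2) le_less_trans less_le_trans)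
qed

text \<open>
  Of the \<open>2 x + 1\<close> classes \<open>c 0, \<dots>, c (2 x)\<close>, at most \<open>x\<close> are mapped to a class \<open>j < x\<close> and at
  most \<open>x\<close> to a class \<open>j\<close> with \<open>\<pi> j < x\<close>.
\<close>

lemma coded_bound:
  assumes h: "is_iso (srel l) (srel l2) h" and D: "D x s"
  shows "s \<le> (\<Sum>t<Suc (2 * x). slab l2 (h (spos l (c t))))"
proof (rule ccontr)
  define J where "J t = slab l2 (h (spos l (c t)))" for t
  assume "\<not> ?thesis"
  \<comment> \<open>Since \<open>s\<close> exceeds every \<open>J t\<close>, the change at
    \<open>s\<close> concerns all these classes that the guards of \<open>bad\<close> do not
    exempt.\<close>
  then have lt: "(\<Sum>t<Suc (2 * x). J t) < s" unfolding J_def by simp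
  have J: "J t < s" if "t < Suc (2 * x)" for t
  proof -
    have "J t \<le> (\<Sum>t<Suc (2 * x). J t)" using that by (intro member_le_sum) auto
    then show ?thesis using lt by simp
  qed
  have inj: "inj J"
  proof (rule injI)
    fix t t' assume "J t = J t'"
    then have "srel l2 (h (spos l (c t))) (h (spos l (c t')))" unfolding J_def srel_def .
    then have "srel l (spos l (c t)) (spos l (c t'))" using h unfolding is_iso_def by blast
    then show "t = t'" using inj_c by (simp add: srel_def inj_eq)
  qed
  have size: "ssize l (\<pi> (J t)) = ssize l (c t)" for t
  proof -
    have "{y. srel l2 (h (spos l (c t))) y} = {y. slab l2 y = J t}"
      "{y. srel l (spos l (c t)) y} = {y. slab l y = c t}"
      unfolding J_def srel_def by auto
    then show ?thesis
      using is_iso_class_size[OF h, of "spos l (c t)"] by (simp add: esz_slab_fibre ssize_l2)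
  qed
  have "{..<Suc (2 * x)} \<subseteq> J -` {..<x} \<union> (\<pi> \<circ> J) -` {..<x}"
  proof
    fix t assume t: "t \<in> {..<Suc (2 * x)}"
    show "t \<in> J -` {..<x} \<union> (\<pi> \<circ> J) -` {..<x}"
    proof (rule ccontr)
      assume "t \<notin> J -` {..<x} \<union> (\<pi> \<circ> J) -` {..<x}"
      then have "x \<le> J t" "x \<le> \<pi> (J t)" by auto
      then have "ssize l (c t) < ssize l (\<pi> (J t))"
        using t J[of t] by (intro coded_size[OF D]) auto
      then show False using size by simp
    qed
  qed
  moreover have inj2: "inj (\<pi> \<circ> J)" using inj bij_\<pi> by (metis bij_is_inj inj_compose)
  ultimately have "card {..<Suc (2 * x)} \<le> card (J -` {..<x} \<union> (\<pi> \<circ> J) -` {..<x})"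
    using inj by (intro card_mono) (auto intro: finite_vimageI simp del: lessThan_Suc)
  also have "\<dots> \<le> card (J -` {..<x}) + card ((\<pi> \<circ> J) -` {..<x})" by (rule card_Un_le)
  also have "\<dots> \<le> card {..<x} + card {..<x}"
    using card_vimage_inj_on_le[of J UNIV "{..<x}"] card_vimage_inj_on_le[of "\<pi> \<circ> J" UNIV "{..<x}"] inj inj2
    by (intro add_mono) simp_all
  finally show False by simp
qed

section \<open>Primitive recursiveness of the copy\<close>

lemma PR_l2:
  assumes l: "PR g (\<lambda>e. l (e 0))" and c: "PR g (\<lambda>e. c (e 0))" and D: "PRP g (\<lambda>e. D (e 0) (e 1))"
  shows "PR g (\<lambda>e. l2 (e 0))"
proof -
  have perm': "PR g (\<lambda>e. perm (list_decode (e 0)) (e 1))"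
    unfolding perm_def tr_def by (intro PR_foldl_code PR_intros)
  have cnt': "PR g (\<lambda>e. cnt (list_decode (e 0)) (e 1))"
    unfolding cnt_def by (intro PR_foldl_code PR_intros)
  note perm = PR_subst2[OF perm'] and cnt = PR_subst2[OF cnt']
  have m: "PR g (\<lambda>e. m (a e) (b e))" if "PR g a" "PR g b" for a b
  proof -
    have "PR g (\<lambda>e. m (e 0) (e 1))"
      unfolding m_def by (intro PR_pos PR_var) (simp only: mem_Collect_eq, intro PRP_eq PR_subst1[OF l] PR_Suc PR_var)
    then show ?thesis using that by (rule PR_subst2)
  qed
  have bad: "PRP g (\<lambda>e. bad (list_decode (e 0)) (e 1) (e 2))"
    unfolding bad_def
    by (intro PRP_conj PRP_ex_le PRP_le PRP_less m perm PR_subst1[OF c] PR_mult PR_const PR_var PR_subst2[OF D])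
  have fbad': "PR g (\<lambda>e. fbad (list_decode (e 0)) (e 1))"
    unfolding fbad_def by (intro PR_bmin PR_subst3[OF bad] PR_var)
  note fbad = PR_subst2[OF fbad']
  have cand: "PRP g (\<lambda>e. cand (list_decode (e 0)) (e 1) (e 2))"
    unfolding cand_def
    by (intro PRP_conj PRP_all_le PRP_less PRP_eq m perm cnt fbad PR_subst1[OF c] PR_mult PR_const PR_var)
  have partner': "PR g (\<lambda>e. partner (list_decode (e 0)) (e 1))"
    unfolding partner_def by (intro PR_bmin PR_subst3[OF cand] PR_var PR_Suc)
  note partner = PR_subst2[OF partner']
  have entry': "PR g (\<lambda>e. entry (list_decode (e 0)) (e 1))"
    unfolding entry_def
    by (intro PR_prod_encode PR_if PRP_conj PRP_le PRP_less m perm cnt fbad partner PR_Suc PR_dfst PR_const PR_var)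
  \<comment> \<open>The recursion carries the whole history as a coded list; \<open>Suc\<close> of a
    pair is the code of a nonempty list.\<close>
  have rec: "rec_nat 0 (\<lambda>s H. Suc (prod_encode (entry (list_decode H) s, H))) s = list_encode (hist s)" for s
    by (induction s) (simp_all add: hist.simps)
  have "PR g (\<lambda>e. rec_nat 0 (\<lambda>s H. Suc (prod_encode (entry (list_decode H) s, H))) (e 0))"
    by (intro PR_rec' PR_const PR_var PR_Suc PR_prod_encode PR_subst2[OF entry'])
  then have hist: "PR g (\<lambda>e. list_encode (hist (e 0)))" unfolding rec .
  have "PR g (\<lambda>e. dsnd (entry (list_decode (list_encode (hist (e 0)))) (e 0)))"
    by (intro PR_dsnd PR_subst2[OF entry'] hist PR_var)
  then show ?thesis by (simp add: l2_def)
qed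

end

section \<open>From coding classes to the cone\<close>

lemma limit_change_finite:
  assumes "\<forall>s\<ge>s0. f s = (v :: nat)"
  shows "finite {s. f s \<noteq> f (Suc s)}"
proof (rule finite_subset)
  show "{s. f s \<noteq> f (Suc s)} \<subseteq> {..<s0}" using assms by (auto simp: not_le[symmetric])
qed simp

text \<open>The degree provides isomorphisms with domain \<open>E\<close>, so the two copies are
  compared through \<open>E\<close>; this takes the inverse of one isomorphism and the other one as
  it is. Applied to the coding classes, the composite gives the bound of
  \<open>coded_bound\<close>.\<close>

lemma PrCat_subset_Cone:
  assumes l: "PR (\<lambda>_. 0) (\<lambda>e. l (e 0))" and c: "PR (\<lambda>_. 0) (\<lambda>e. c (e 0))"
    and iso: "isomorphic (srel l) E"
    and inj: "inj c" and fin: "\<And>t. ssize l (c t) \<noteq> \<infinity>"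
    and large: "\<And>j. infinite {k. \<forall>t\<le>j. ssize l (c t) < ssize l k}"
  shows "PrCat E \<subseteq> Cone_Delta0 2"
proof
  fix d assume "d \<in> PrCat E"
  then have d: "d \<in> pr_degrees" and cat: "\<And>B. punctual B \<Longrightarrow> isomorphic B E \<Longrightarrow>
      \<exists>f. is_iso E B f \<and> f \<le>PRd d \<and> inv f \<le>PRd d" unfolding PrCat_def by auto
  obtain g where g: "\<And>f. f \<le>PRd d \<longleftrightarrow> f \<le>PR g" by (rule pr_degreeE[OF d]) (rule that)
  have "h \<le>PR g" if h: "Delta0_fun_in (\<lambda>_. 0) 2 h" for h
  proof -
    obtain a where a: "PR (\<lambda>_. 0) (\<lambda>e. a (e 0) (e 1))" "\<And>x. \<exists>s0. \<forall>s\<ge>s0. a x s = h x"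
      using Delta2_limit[OF h] by blast
    define D where "D x s \<longleftrightarrow> a x s \<noteq> a x (Suc s)" for x s
    interpret coding l c D
    proof
      show "finite {s. D x s}" for x
        unfolding D_def using a(2)[of x] limit_change_finite[of _ "a x"] by blast
    qed (fact inj fin large)+
    have "PRP (\<lambda>_. 0) (\<lambda>e. D (e 0) (e 1))"
      unfolding D_def by (intro PRP_not PRP_eq PR_subst2[OF a(1)] PR_var PR_Suc)
    then have l2: "PR (\<lambda>_. 0) (\<lambda>e. l2 (e 0))" by (intro PR_l2 l c)
    obtain f1 where f1: "is_iso E (srel l) f1" "inv f1 \<le>PR g"
      using cat[OF punctual_srel[OF l] iso] g by blast
    obtain f2 where f2: "is_iso E (srel l2) f2" "f2 \<le>PR g"
      using cat[OF punctual_srel[OF l2] isomorphic_trans[OF isomorphic_l2 iso]] g by blast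
    have iso12: "is_iso (srel l) (srel l2) (f2 \<circ> inv f1)"
      using is_iso_comp[OF is_iso_inv[OF f1(1)] f2(1)] .
    define M where "M x = (\<Sum>t<Suc (2 * x). slab l2 ((f2 \<circ> inv f1) (spos l (c t))))" for x
    have "PR g (\<lambda>e. slab l2 (f2 (inv f1 (spos l (c (e 0))))))"
      by (intro PR_slab PR_spos PR_subst1[OF f2(2)[unfolded pr_le_iff_PR]]
          PR_subst1[OF f1(2)[unfolded pr_le_iff_PR]] PR_rebase[OF l] PR_rebase[OF l2] PR_rebase[OF c])
    then have "PR g (\<lambda>e. M (e 0))"
      unfolding M_def o_def by (intro PR_sum PR_Suc PR_mult PR_const PR_var)
    \<comment> \<open>A change at \<open>s\<close> is a difference between \<open>s\<close> and
      \<open>Suc s\<close>, and all changes are at most \<open>M x\<close>, so the value at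
      \<open>Suc (M x)\<close> is final.\<close>
    then have "PR g (\<lambda>e. a (e 0) (Suc (M (e 0))))"
      by (intro PR_subst2[OF PR_rebase[OF a(1)]] PR_var PR_Suc)
    moreover have "a x (Suc (M x)) = h x" for x
    proof -
      have step: "a x (Suc s) = a x s" if "s > M x" for s
      proof (rule ccontr)
        assume "a x (Suc s) \<noteq> a x s"
        then have "D x s" by (simp add: D_def)
        from coded_bound[OF iso12 this] have "s \<le> M x" unfolding M_def .
        then show False using that by simp
      qed
      have const: "a x s = a x (Suc (M x))" if "s \<ge> Suc (M x)" for s
        using that
      proof (induction s rule: dec_induct)
        case (step s)
        then show ?case using \<open>\<And>s. s > M x \<Longrightarrow> a x (Suc s) = a x s\<close>[of s] by simp
      qed simp
      obtain s0 where "\<And>s. s \<ge> s0 \<Longrightarrow> a x s = h x" using a(2)[of x] by blast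
      then show ?thesis using const[of "s0 + Suc (M x)"] by simp
    qed
    ultimately show "h \<le>PR g" by (simp add: pr_le_iff_PR)
  qed
  then show "d \<in> Cone_Delta0 2" unfolding Cone_Delta0_def using d g by blast
qed

section \<open>Copies with a primitive recursive sequence of finite classes\<close>

lemma bij_betw_infinite_nat:
  fixes A B :: "nat set"
  assumes "infinite A" "infinite B"
  shows "\<exists>f. bij_betw f A B"
  using bij_betw_inv_into[OF bij_enumerate[OF assms(1)]] bij_enumerate[OF assms(2)] bij_betw_trans by blast

lemma PR_div:
  assumes "PR g a" "PR g b" shows "PR g (\<lambda>e. a e div b e)"
proof -
  have "x div y = (if y = 0 then 0 else bmin (Suc x) (\<lambda>q. x < y * Suc q))" for x y :: nat
  proof (cases "y = 0")
    case False
    have "bmin (Suc x) (\<lambda>q. x < y * Suc q) = x div y"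
    proof (rule bmin_eq)
      show "x < y * Suc (x div y)" using False by (simp add: dividend_less_times_div)
      show "x div y < Suc x" by (simp add: less_Suc_eq_le)
      fix z assume "z < x div y"
      then have "Suc z \<le> x div y" by simp
      then have "Suc z * y \<le> x"
        using less_eq_div_iff_mult_less_eq[of y "Suc z" x] False by (simp del: mult_Suc)
      then show "\<not> x < y * Suc z" by (simp add: mult.commute)
    qed
    then show ?thesis using False by simp
  qed simp
  then have "PR g (\<lambda>e. e 0 div e 1)"
    by (simp only:) (intro PR_if PRP_eq PR_const PR_bmin PRP_less PR_Suc PR_mult PR_var)
  then show ?thesis using assms by (rule PR_subst2)
qed

text \<open>Even stages and classes reproduce \<open>l\<close>. Each block of \<open>v\<close>
  consecutive odd stages fills one odd class, so the odd classes form a sequence whose sizes are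
  known in advance, from which coding classes can be taken primitive recursively.\<close>

definition add_classes :: "nat \<Rightarrow> (nat \<Rightarrow> nat) \<Rightarrow> nat \<Rightarrow> nat" where
  "add_classes v l a = (if a = 2 * (a div 2) then (if l (a div 2) = 0 then 0 else Suc (2 * (l (a div 2) - 1)))
     else if v = 0 then 0 else Suc (Suc (2 * (a div 2 div v))))"

lemma ssize_add_classes:
  "ssize (add_classes v l) (2 * k) = ssize l k" "ssize (add_classes v l) (Suc (2 * k)) = enat v"
proof -
  have "{a. add_classes v l a = Suc (2 * k)} = (\<lambda>a. 2 * a) ` {a. l a = Suc k}"
  proof (intro equalityI subsetI)
    fix a assume "a \<in> {a. add_classes v l a = Suc (2 * k)}"
    then have *: "add_classes v l a = Suc (2 * k)" by simp
    have even: "a = 2 * (a div 2)"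
    proof (rule ccontr)
      assume "a \<noteq> 2 * (a div 2)"
      then have "Suc (2 * k) = Suc (Suc (2 * (a div 2 div v)))" using * by (auto simp: add_classes_def split: if_splits)
      then show False using Suc_double_not_eq_double by (metis Suc_inject)
    qed
    then have "l (a div 2) = Suc k" using * by (cases "l (a div 2)") (auto simp: add_classes_def)
    then show "a \<in> (\<lambda>a. 2 * a) ` {a. l a = Suc k}" using even by blast
  qed (auto simp: add_classes_def)
  then show "ssize (add_classes v l) (2 * k) = ssize l k"
    unfolding ssize_def by (simp add: esz_image inj_on_def)
  have "{a. add_classes v l a = Suc (Suc (2 * k))} = (\<lambda>b. Suc (2 * b)) ` {k * v..<Suc k * v}"
  proof (intro equalityI subsetI)
    fix a assume "a \<in> {a. add_classes v l a = Suc (Suc (2 * k))}"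
    then have *: "add_classes v l a = Suc (Suc (2 * k))" by simp
    have odd: "a \<noteq> 2 * (a div 2)"
    proof
      assume "a = 2 * (a div 2)"
      then have "Suc (Suc (2 * k)) = Suc (2 * (l (a div 2) - 1))" using * by (auto simp: add_classes_def split: if_splits)
      then show False using Suc_double_not_eq_double by (metis Suc_inject)
    qed
    then have v: "v \<noteq> 0" "a div 2 div v = k" using * by (auto simp: add_classes_def split: if_splits)
    then have "a div 2 \<in> {k * v..<Suc k * v}"
      using dividend_less_times_div[of v "a div 2"] div_times_less_eq_dividend[of "a div 2" v] by (auto simp: mult.commute)
    moreover have "a = Suc (2 * (a div 2))" using odd by presburger
    ultimately show "a \<in> (\<lambda>b. Suc (2 * b)) ` {k * v..<Suc k * v}" by blast
  next
    fix a assume "a \<in> (\<lambda>b. Suc (2 * b)) ` {k * v..<Suc k * v}"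
    then obtain b where b: "a = Suc (2 * b)" "k * v \<le> b" "b < Suc k * v" by auto
    then have "v \<noteq> 0" by (cases v) auto
    moreover have "b div v = k" using b by (intro div_nat_eqI) (auto simp: mult.commute)
    moreover have "a div 2 = b" "a \<noteq> 2 * (a div 2)" using b(1) by simp_all
    ultimately show "a \<in> {a. add_classes v l a = Suc (Suc (2 * k))}" by (simp add: add_classes_def)
  qed
  moreover have "inj_on (\<lambda>b. Suc (2 * b)) X" for X by (simp add: inj_on_def)
  ultimately show "ssize (add_classes v l) (Suc (2 * k)) = enat v"
    unfolding ssize_def by (simp add: esz_image) (simp add: esz_def)
qed

lemma PR_add_classes:
  assumes "PR g (\<lambda>e. l (e 0))" shows "PR g (\<lambda>e. add_classes v l (e 0))"
  unfolding add_classes_def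
  by (intro PR_if PRP_eq PR_mult PR_div PR_const PR_var PR_Suc PR_diff PR_subst1[OF assms])

text \<open>Infinitely many classes absorb infinitely many more of the same size; the other classes
  \<open>k\<close> go to \<open>2 * k\<close>.\<close>

lemma isomorphic_add_classes:
  assumes "infinite {k. ssize l k = enat v}"
  shows "isomorphic (srel l) (srel (add_classes v l))"
proof -
  define A where "A = {k. ssize l k = enat v}"
  define A' where "A' = {k. ssize (add_classes v l) k = enat v}"
  have "range (\<lambda>k. Suc (2 * k)) \<subseteq> A'" unfolding A'_def by (auto simp: ssize_add_classes)
  moreover have "infinite (range (\<lambda>k::nat. Suc (2 * k)))" by (intro range_inj_infinite) (simp add: inj_def)
  ultimately have "infinite A'" using finite_subset by blast
  then obtain f where f: "bij_betw f A A'" using bij_betw_infinite_nat assms unfolding A_def by blast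
  have "(\<lambda>k. 2 * k) ` (- A) = - A'"
  proof (intro equalityI subsetI)
    fix k assume "k \<in> - A'"
    then have k: "ssize (add_classes v l) k \<noteq> enat v" by (simp add: A'_def)
    then have "\<nexists>j. k = Suc (2 * j)" using ssize_add_classes(2) by blast
    then obtain j where j: "k = 2 * j" by (metis evenE oddE Suc_eq_plus1)
    then have "j \<in> - A" using k by (simp add: A_def ssize_add_classes)
    then show "k \<in> (\<lambda>k. 2 * k) ` (- A)" using j by blast
  qed (auto simp: A_def A'_def ssize_add_classes)
  then have "bij_betw (\<lambda>k. 2 * k) (- A) (- A')" by (simp add: bij_betw_def inj_on_def)
  then have "bij_betw (\<lambda>k. if k \<in> A then f k else 2 * k) (A \<union> - A) (A' \<union> - A')"
    by (intro bij_betw_disjoint_Un f) auto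
  then have bij: "bij (\<lambda>k. if k \<in> A then f k else 2 * k)" by simp
  have "ssize (add_classes v l) (if k \<in> A then f k else 2 * k) = ssize l k" for k
    using bij_betwE[OF f] by (auto simp: ssize_add_classes A_def A'_def)
  from srel_isomorphic[OF bij this] show ?thesis .
qed

text \<open>If some \<open>v\<close> occurs infinitely often below infinitely many larger sizes,
  added classes serve for coding. Otherwise every finite size occurs finitely often and there are
  finitely many infinite classes; past these, the classes of \<open>l\<close> itself serve, because
  only finitely many classes stay below any finite bound.\<close>

lemma PrCat_subset_Cone_sizes:
  assumes l: "PR (\<lambda>_. 0) (\<lambda>e. l (e 0))" and iso: "isomorphic (srel l) E"
    and H1: "\<And>K. infinite {k. ssize l k \<noteq> K}"
    and H2: "infinite {k. ssize l k = \<infinity>} \<Longrightarrow> \<exists>v. \<forall>k. ssize l k \<noteq> \<infinity> \<longrightarrow> ssize l k \<le> enat v"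
  shows "PrCat E \<subseteq> Cone_Delta0 2"
proof (cases "\<exists>v. infinite {k. ssize l k = enat v} \<and> infinite {k. enat v < ssize l k}")
  case True
  then obtain v where v: "infinite {k. ssize l k = enat v}" "infinite {k. enat v < ssize l k}" by blast
  show ?thesis
  proof (rule PrCat_subset_Cone[of "add_classes v l" "\<lambda>t. Suc (2 * t)"])
    show "PR (\<lambda>_. 0) (\<lambda>e. add_classes v l (e 0))" by (rule PR_add_classes[OF l])
    show "PR (\<lambda>_. 0) (\<lambda>e. Suc (2 * e 0))" by (intro PR_Suc PR_mult PR_const PR_var)
    show "isomorphic (srel (add_classes v l)) E"
      using isomorphic_trans[OF isomorphic_sym[OF isomorphic_add_classes[OF v(1)]] iso] .
    show "inj (\<lambda>t::nat. Suc (2 * t))" by (simp add: inj_def)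
    show "ssize (add_classes v l) (Suc (2 * t)) \<noteq> \<infinity>" for t by (simp add: ssize_add_classes)
    show "infinite {k. \<forall>t\<le>j. ssize (add_classes v l) (Suc (2 * t)) < ssize (add_classes v l) k}" for j
    proof -
      have "(\<lambda>k. 2 * k) ` {k. enat v < ssize l k}
          \<subseteq> {k. \<forall>t\<le>j. ssize (add_classes v l) (Suc (2 * t)) < ssize (add_classes v l) k}"
        by (auto simp: ssize_add_classes)
      moreover have "infinite ((\<lambda>k. 2 * k) ` {k. enat v < ssize l k})"
        using v(2) by (simp add: finite_image_iff inj_on_def)
      ultimately show ?thesis using finite_subset by blast
    qed
  qed
next
  case nC: False
  \<comment> \<open>If \<open>v\<close> occurred infinitely often, \<open>H1\<close> would leave
    infinitely many smaller classes, and some \<open>w < v\<close> would occur infinitely often.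
    With the classes of size \<open>v\<close> above it, \<open>w\<close> would fall under the first
    case.\<close>
  have fin: "finite {k. ssize l k = enat v}" for v
  proof (rule ccontr)
    assume v: "infinite {k. ssize l k = enat v}"
    then have "finite {k. enat v < ssize l k}" using nC by blast
    moreover have "{k. ssize l k \<noteq> enat v} = {k. enat v < ssize l k} \<union> {k. ssize l k < enat v}" by auto
    ultimately have "infinite {k. ssize l k < enat v}" using H1[of "enat v"] by auto
    moreover have "{k. ssize l k < enat v} = (\<Union>w<v. {k. ssize l k = enat w})"
    proof (intro equalityI subsetI)
      fix k assume k: "k \<in> {k. ssize l k < enat v}"
      then obtain w where "ssize l k = enat w" by (cases "ssize l k") auto
      then show "k \<in> (\<Union>w<v. {k. ssize l k = enat w})" using k by auto
    qed auto
    ultimately obtain w where w: "w < v" "infinite {k. ssize l k = enat w}" by auto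
    have "{k. ssize l k = enat v} \<subseteq> {k. enat w < ssize l k}" using w(1) by auto
    then show False using nC w(2) v finite_subset by blast
  qed
  have fin_le: "finite {k. ssize l k \<le> enat v}" for v
  proof -
    have "{k. ssize l k \<le> enat v} \<subseteq> (\<Union>w\<le>v. {k. ssize l k = enat w})"
    proof
      fix k assume k: "k \<in> {k. ssize l k \<le> enat v}"
      then obtain w where "ssize l k = enat w" by (cases "ssize l k") auto
      then show "k \<in> (\<Union>w\<le>v. {k. ssize l k = enat w})" using k by auto
    qed
    then show ?thesis by (rule finite_subset) (simp add: fin)
  qed
  \<comment> \<open>Otherwise \<open>H2\<close> bounds the finite sizes, so by \<open>fin_le\<close>
    all but finitely many classes are infinite, against \<open>H1\<close>.\<close>
  have "finite {k. ssize l k = \<infinity>}"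
  proof (rule ccontr)
    assume "infinite {k. ssize l k = \<infinity>}"
    from H2[OF this] obtain v where "\<And>k. ssize l k \<noteq> \<infinity> \<Longrightarrow> ssize l k \<le> enat v" by blast
    then have "{k. ssize l k \<noteq> \<infinity>} \<subseteq> {k. ssize l k \<le> enat v}" by blast
    then show False using H1[of \<infinity>] fin_le[of v] finite_subset by blast
  qed
  then obtain K where K: "\<And>k. ssize l k = \<infinity> \<Longrightarrow> k < K"
    unfolding finite_nat_set_iff_bounded by blast
  show ?thesis
  proof (rule PrCat_subset_Cone[of l "\<lambda>t. t + K"])
    show "PR (\<lambda>_. 0) (\<lambda>e. e 0 + K)" by (intro PR_add PR_const PR_var)
    show "inj (\<lambda>t::nat. t + K)" by (simp add: inj_def)
    show nf: "ssize l (t + K) \<noteq> \<infinity>" for t using K[of "t + K"] by auto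
    show "infinite {k. \<forall>t\<le>j. ssize l (t + K) < ssize l k}" for j
    proof -
      have "\<exists>w. \<forall>t\<le>j. ssize l (t + K) \<le> enat w"
      proof -
        have "\<forall>t. \<exists>w. ssize l (t + K) = enat w" using nf by auto
        then obtain w where w: "\<And>t. ssize l (t + K) = enat (w t)" by metis
        have "w t \<le> (\<Sum>t\<le>j. w t)" if "t \<le> j" for t using that by (intro member_le_sum) auto
        then show ?thesis using w by (intro exI[of _ "\<Sum>t\<le>j. w t"]) simp
      qed
      then obtain w where w: "\<And>t. t \<le> j \<Longrightarrow> ssize l (t + K) \<le> enat w" by blast
      have "- {k. ssize l k \<le> enat w} \<subseteq> {k. \<forall>t\<le>j. ssize l (t + K) < ssize l k}"
        using w by (auto simp: not_le) (meson le_less_trans)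
      moreover have "infinite (- {k. ssize l k \<le> enat w})"
        using fin_le[of w] by (metis finite_compl infinite_UNIV_nat)
      ultimately show ?thesis using finite_subset by blast
    qed
  qed (fact l iso)+
qed

section \<open>Relative Delta-1-categoricity\<close>

text \<open>Through such tables the representatives of finitely many classes enter as non-uniform
  information.\<close>

lemma PR_table:
  fixes c :: "nat \<Rightarrow> nat"
  assumes "\<And>i. i \<ge> m \<Longrightarrow> c i = 0"
  shows "PR g (\<lambda>e. c (e 0))"
  using assms
proof (induction m arbitrary: c)
  case 0
  then have "c = (\<lambda>_. 0)" by auto
  then show ?case by (simp add: PR_const)
next
  case (Suc m)
  have "PR g (\<lambda>e. (c(m := 0)) (e 0))" by (rule Suc.IH) (use Suc.prems in auto)
  then have "PR g (\<lambda>e. if e 0 = m then c m else (c(m := 0)) (e 0))"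
    by (intro PR_if PRP_eq PR_var PR_const)
  moreover have "(\<lambda>e :: nat \<Rightarrow> nat. if e 0 = m then c m else (c(m := 0)) (e 0)) = (\<lambda>e. c (e 0))"
    by (auto simp: fun_eq_iff)
  ultimately show ?case by (simp only:)
qed

lemma Sigma1_if_PR:
  assumes "PRP g (\<lambda>e. P (e 0) (e 1))"
  shows "Sigma0_in g 1 2 (\<lambda>xs. P (xs ! 0) (xs ! 1))"
proof -
  obtain F where F: "prim_rec_in g 2 F" "\<And>x y. F [x, y] = of_bool (\<not> P x y)"
    using PR_imp_prim_rec_in_2[OF PRP_not[OF assms]] by blast
  \<comment> \<open>Index 0 is a dummy quantified variable. The matrix is the negation because
    \<open>Sigma0_in\<close> quantifies over complements.\<close>
  let ?Hs = "[\<lambda>xs. xs ! 1, \<lambda>xs. xs ! 2] :: (nat list \<Rightarrow> nat) list"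
  let ?F = "\<lambda>xs. F (map (\<lambda>H. H xs) ?Hs)"
  have "prim_rec_in g 3 ?F"
    by (rule prim_rec_in.comp) (use F(1) in \<open>auto intro: prim_rec_in.proj simp: numeral_2_eq_2\<close>)
  then have "Sigma0_in g 0 3 (\<lambda>xs. \<not> P (xs ! 1) (xs ! 2))"
    using prim_rec_in_imp_recursive_in[of g 3 ?F] F(2) by (auto intro!: exI[of _ ?F])
  then show ?thesis
    by (auto intro!: exI[of _ "\<lambda>xs. \<not> P (xs ! 1) (xs ! 2)"] simp: numeral_3_eq_3 numeral_2_eq_2)
qed

lemma Delta1_fun_if_PR:
  assumes "PRP g (\<lambda>e. f (e 0) = e 1)"
  shows "Delta0_fun_in g 1 f"
proof -
  have "Sigma0_in g 1 2 (\<lambda>xs. f (xs ! 0) = xs ! 1)" "Sigma0_in g 1 2 (\<lambda>xs. \<not> f (xs ! 0) = xs ! 1)"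
    using Sigma1_if_PR[of g "\<lambda>x y. f x = y", OF assms] Sigma1_if_PR[of g "\<lambda>x y. \<not> f x = y", OF PRP_not[OF assms]] .
  then show ?thesis unfolding Delta0_fun_in_def Delta0_in_def Pi0_in_def by (simp only: eq_commute)
qed

definition others :: "(nat \<Rightarrow> nat \<Rightarrow> bool) \<Rightarrow> (nat \<Rightarrow> nat) \<Rightarrow> nat \<Rightarrow> nat set" where
  "others R c m = {z. cmin R z = z \<and> \<not> (\<exists>i<m. R z (c i))}"

text \<open>Serves to line up two structures: finitely many exceptional classes are matched by hand
  through the table \<open>c\<close>, the others, all of the same size, by order of
  appearance.\<close>

definition xlab :: "(nat \<Rightarrow> nat \<Rightarrow> bool) \<Rightarrow> (nat \<Rightarrow> nat) \<Rightarrow> nat \<Rightarrow> nat \<Rightarrow> nat" where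
  "xlab R c m x = (if \<exists>i<m. R x (c i) then bmin m (\<lambda>i. R x (c i)) else m + pos (others R c m) (cmin R x))"

lemma PR_xlab:
  assumes R: "PRP g (\<lambda>e. R (e 0) (e 1))" and c: "PR g (\<lambda>e. c (e 0))" and a: "PR g a"
  shows "PR g (\<lambda>e. xlab R c m (a e))"
proof -
  have R': "PRP g (\<lambda>e. R (a e) (c (b e)))" if "PR g a" "PR g b" for a b
    by (intro PR_subst2[OF R] PR_subst1[OF c] that)
  have "PR g (\<lambda>e. xlab R c m (e 0))"
    unfolding xlab_def others_def
    by (intro PR_if PRP_ex_less R' PR_var PR_const PR_bmin PR_add PR_pos PR_cmin[OF R])
      (simp only: mem_Collect_eq, intro PRP_conj PRP_eq PR_cmin[OF R] PRP_not PRP_ex_less R' PR_var PR_const)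
  then show ?thesis using a by (rule PR_subst1)
qed

text \<open>The sizes depend only on the exceptional classes, on \<open>K\<close> and on the number
  of other classes. Two structures that share these data therefore meet the hypothesis of
  \<open>labelled_iso\<close>.\<close>

lemma xlab_props:
  assumes R: "equivp R" and c: "\<And>i j. i < m \<Longrightarrow> j < m \<Longrightarrow> R (c i) (c j) \<Longrightarrow> i = j"
    and K: "\<And>x. \<not> (\<exists>i<m. R x (c i)) \<Longrightarrow> esz {y. R x y} = K"
  shows "R x y \<longleftrightarrow> xlab R c m x = xlab R c m y"
    "esz {x. xlab R c m x = k} = (if k < m then esz {y. R (c k) y}
        else if enat (k - m) < esz (others R c m) then K else 0)"
proof -
  note cm = cmin_props[OF R]
  have sym: "R x y \<Longrightarrow> R y x" and trans: "R x y \<Longrightarrow> R y z \<Longrightarrow> R x z" for x y z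
    using R by (blast intro: equivp_symp equivp_transp)+
  have lt: "xlab R c m x = i" if "i < m" "R x (c i)" for i x
  proof -
    have "bmin m (\<lambda>i. R x (c i)) = i"
    proof (rule bmin_eq)
      fix z assume "z < i"
      then show "\<not> R x (c z)" using c[of z i] trans[OF sym[of x "c z"] that(2)] that by auto
    qed (fact that)+
    then show ?thesis using that unfolding xlab_def by auto
  qed
  have ge: "xlab R c m x = m + pos (others R c m) (cmin R x)" "cmin R x \<in> others R c m"
    if "\<not> (\<exists>i<m. R x (c i))" for x
  proof -
    show "xlab R c m x = m + pos (others R c m) (cmin R x)" unfolding xlab_def by (rule if_not_P[OF that])
    have "\<not> R (cmin R x) (c i)" if "i < m" for i
      using trans[OF cm(1)[of x], of "c i"] \<open>\<not> (\<exists>i<m. R x (c i))\<close> that by auto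
    then show "cmin R x \<in> others R c m" using cm(5)[of x] by (simp add: others_def reps_def)
  qed
  show iff: "R x y \<longleftrightarrow> xlab R c m x = xlab R c m y" for x y
  proof (cases "\<exists>i<m. R x (c i)")
    case True
    then obtain i where i: "i < m" "R x (c i)" by blast
    show ?thesis
    proof (cases "\<exists>j<m. R y (c j)")
      case True
      then obtain j where j: "j < m" "R y (c j)" by blast
      show ?thesis using lt[OF i] lt[OF j] i j sym trans c by metis
    next
      case False
      then have "\<not> R x y" using i sym trans by blast
      then show ?thesis using lt[OF i] ge(1)[OF False] i(1) by simp
    qed
  next
    case x: False
    show ?thesis
    proof (cases "\<exists>j<m. R y (c j)")
      case True
      then obtain j where j: "j < m" "R y (c j)" by blast
      then have "\<not> R x y" using x trans by blast
      then show ?thesis using lt[OF j] ge(1)[OF x] j(1) by simp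
    next
      case y: False
      have "xlab R c m x = xlab R c m y \<longleftrightarrow> cmin R x = cmin R y"
        using ge[OF x] ge[OF y] pos_inj_on[of "others R c m"] by (auto dest: inj_onD)
      then show ?thesis using cm(4) by simp
    qed
  qed
  have refl: "R z z" for z using R by (rule equivp_reflp)
  show "esz {x. xlab R c m x = k} = (if k < m then esz {y. R (c k) y}
        else if enat (k - m) < esz (others R c m) then K else 0)"
  proof (cases "k < m")
    case True
    then have "xlab R c m (c k) = k" using lt refl by blast
    then have "xlab R c m x = k \<longleftrightarrow> R (c k) x" for x using iff[of "c k" x] by metis
    then have "{x. xlab R c m x = k} = {y. R (c k) y}" by (simp only:)
    then show ?thesis using True by simp
  next
    case False
    show ?thesis
    proof (cases "enat (k - m) < esz (others R c m)")
      case True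
      then obtain z where z: "z \<in> others R c m" "pos (others R c m) z = k - m" using pos_surj by blast
      then have nz: "\<not> (\<exists>i<m. R z (c i))" and "cmin R z = z" by (auto simp: others_def)
      then have "xlab R c m z = k" using ge(1)[OF nz] z(2) False by simp
      then have "xlab R c m x = k \<longleftrightarrow> R z x" for x using iff[of z x] by metis
      then have "{x. xlab R c m x = k} = {y. R z y}" by (simp only:)
      then show ?thesis using True False K[OF nz] by simp
    next
      case none: False
      have "xlab R c m x \<noteq> k" for x
      proof
        assume k: "xlab R c m x = k"
        have nx: "\<not> (\<exists>i<m. R x (c i))"
        proof
          assume "\<exists>i<m. R x (c i)"
          then obtain i where "i < m" "R x (c i)" by blast
          then show False using lt[of i x] k False by simp
        qed
        have "k - m = pos (others R c m) (cmin R x)" using ge(1)[OF nx] k by simp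
        then show False using pos_esz[OF ge(2)[OF nx]] none by simp
      qed
      then show ?thesis using False none by (simp add: esz_def zero_enat_def)
    qed
  qed
qed

text \<open>The given isomorphism \<open>f\<close> is consulted only for representatives of the
  finitely many exceptional classes. The other classes all have size \<open>K\<close>, so they can
  be matched in order of appearance even if \<open>f\<close> matches them differently.\<close>

lemma relatively_Delta1_categorical:
  assumes E: "equivp E" "punctual E" and fin: "finite {x \<in> reps E. esz {y. E x y} \<noteq> K}"
  shows "relatively_Delta0_categorical 1 E"
  unfolding relatively_Delta0_categorical_def
proof (intro allI impI)
  fix B assume "isomorphic B E"
  then obtain f where f: "is_iso B E f" unfolding isomorphic_def by blast
  have fiff: "B x y \<longleftrightarrow> E (f x) (f y)" for x y using f unfolding is_iso_def by blast
  have bij: "bij f" using f unfolding is_iso_def by blast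
  have B: "equivp B"
    using E(1) unfolding equivp_def fiff fun_eq_iff using bij by (metis bij_pointE)
  note eE = equivp_reflp[OF E(1)] equivp_symp[OF E(1)] equivp_transp[OF E(1)]
  define m where "m = card {x \<in> reps E. esz {y. E x y} \<noteq> K}"
  obtain r where r: "bij_betw r {0..<m} {x \<in> reps E. esz {y. E x y} \<noteq> K}"
    using ex_bij_betw_nat_finite[OF fin] unfolding m_def by blast
  define c where "c i = (if i < m then r i else 0)" for i
  define b where "b i = (if i < m then inv f (r i) else 0)" for i
  have cb: "f (b i) = c i" if "i < m" for i
    using that bij by (simp add: c_def b_def bij_is_surj surj_f_inv_f)
  have c_inj: "i = j" if "i < m" "j < m" "E (c i) (c j)" for i j
  proof -
    have "c i \<in> reps E" "c j \<in> reps E" using bij_betwE[OF r] that unfolding c_def by auto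
    then have "c i = c j" using cmin_props(4)[OF E(1), of "c i" "c j"] that(3) by (simp add: reps_def)
    then show ?thesis using that r unfolding c_def bij_betw_def inj_on_def by auto
  qed
  have b_inj: "i = j" if "i < m" "j < m" "B (b i) (b j)" for i j
    using that c_inj cb fiff by simp
  have KE: "esz {y. E x y} = K" if "\<not> (\<exists>i<m. E x (c i))" for x
  proof (rule ccontr)
    assume ne: "esz {y. E x y} \<noteq> K"
    have eq: "{y. E x y} = {y. E (cmin E x) y}"
      using cmin_props(1)[OF E(1), of x] E(1)[unfolded equivp_def] by auto
    have "esz {y. E (cmin E x) y} \<noteq> K" using ne unfolding eq .
    then have "cmin E x \<in> {x \<in> reps E. esz {y. E x y} \<noteq> K}"
      by (intro CollectI conjI cmin_props(5)[OF E(1)])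
    then have "cmin E x \<in> r ` {0..<m}" by (simp only: bij_betw_imp_surj_on[OF r])
    then obtain i where "i < m" "r i = cmin E x" by auto
    then show False using that cmin_props(1)[OF E(1), of x] by (auto simp: c_def)
  qed
  have exB: "(\<exists>i<m. B x (b i)) \<longleftrightarrow> (\<exists>i<m. E (f x) (c i))" for x
    using fiff cb by auto
  have KB: "esz {y. B x y} = K" if "\<not> (\<exists>i<m. B x (b i))" for x
    using KE[of "f x"] that exB is_iso_class_size[OF f, of x] by simp
  \<comment> \<open>The number of other classes may be finite, so it has to be compared;
    \<open>f\<close> induces a bijection between them.\<close>
  have "esz (others B b m) = esz (others E c m)"
  proof -
    have "inj_on (\<lambda>z. cmin E (f z)) (others B b m)"
    proof (rule inj_onI)
      fix x y assume xy: "x \<in> others B b m" "y \<in> others B b m" "cmin E (f x) = cmin E (f y)"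
      then have "B x y" using cmin_props(4)[OF E(1)] fiff by simp
      then show "x = y" using cmin_props(4)[OF B, of x y] xy by (simp add: others_def)
    qed
    moreover have "(\<lambda>z. cmin E (f z)) ` others B b m = others E c m"
    proof (intro equalityI subsetI)
      fix y assume "y \<in> (\<lambda>z. cmin E (f z)) ` others B b m"
      then obtain z where z: "z \<in> others B b m" "y = cmin E (f z)" by blast
      have "\<not> (\<exists>i<m. E (f z) (c i))" using z(1) exB by (auto simp: others_def)
      then have "\<not> (\<exists>i<m. E y (c i))" using z(2) eE(3)[OF cmin_props(1)[OF E(1), of "f z"]] by auto
      then show "y \<in> others E c m" using z(2) cmin_props(5)[OF E(1), of "f z"] by (simp add: others_def reps_def)
    next
      fix y assume y: "y \<in> others E c m"
      define z where "z = cmin B (inv f y)"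
      have fy: "f (inv f y) = y" using bij by (simp add: bij_is_surj surj_f_inv_f)
      have "B (inv f y) z" unfolding z_def by (rule cmin_props(1)[OF B])
      then have yz: "E y (f z)" using fiff fy by simp
      have "cmin E y = y" "\<not> (\<exists>i<m. E y (c i))" using y by (auto simp: others_def)
      then have "y = cmin E (f z)" "\<not> (\<exists>i<m. E (f z) (c i))"
        using yz cmin_props(4)[OF E(1), of y "f z"] eE(3)[OF yz] by auto
      moreover have "cmin B z = z" using cmin_props(5)[OF B, of "inv f y"] by (simp add: z_def reps_def)
      ultimately have "z \<in> others B b m" "y = cmin E (f z)" using exB by (auto simp: others_def)
      then show "y \<in> (\<lambda>z. cmin E (f z)) ` others B b m" by blast
    qed
    ultimately show ?thesis using esz_image by metis
  qed
  moreover have "esz {y. B (b k) y} = esz {y. E (c k) y}" if "k < m" for k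
    using is_iso_class_size[OF f, of "b k"] cb[OF that] by simp
  ultimately have "esz {x. xlab B b m x = k} = esz {x. xlab E c m x = k}" for k
    using xlab_props(2)[where R = B and c = b and m = m and K = K and k = k, OF B b_inj KB]
      xlab_props(2)[where R = E and c = c and m = m and K = K and k = k, OF E(1) c_inj KE] by simp
  from labelled_iso[of B "xlab B b m" E "xlab E c m", OF _ _ this]
    xlab_props(1)[where R = B and c = b and m = m and K = K, OF B b_inj KB]
    xlab_props(1)[where R = E and c = c and m = m and K = K, OF E(1) c_inj KE]
  obtain h where h: "is_iso B E h" "\<And>x y. h x = y \<longleftrightarrow> xlab B b m x = xlab E c m y \<and>
      pos {z. xlab B b m z = xlab B b m x} x = pos {z. xlab E c m z = xlab E c m y} y" by blast
  let ?g = "atomic_diagram B"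
  have "PR ?g (\<lambda>e. ?g (prod_encode (e 0, e 1)))" by (intro PR_oracle PR_prod_encode PR_var)
  then have PB: "PRP ?g (\<lambda>e. B (e 0) (e 1))" by (simp add: atomic_diagram_def)
  have PE: "PRP ?g (\<lambda>e. E (e 0) (e 1))" using PR_rebase E(2) by (simp add: punctual_iff_PR)
  have Pb: "PR ?g (\<lambda>e. b (e 0))" by (rule PR_table[of m]) (simp add: b_def)
  have Pc: "PR ?g (\<lambda>e. c (e 0))" by (rule PR_table[of m]) (simp add: c_def)
  have "PRP ?g (\<lambda>e. h (e 0) = e 1)"
    unfolding h(2)
    by (intro PRP_conj PRP_eq PR_pos PR_xlab[OF PB Pb] PR_xlab[OF PE Pc] PR_var;
        simp only: mem_Collect_eq; intro PRP_eq PR_xlab[OF PB Pb] PR_xlab[OF PE Pc] PR_var)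
  then have "Delta0_fun_in ?g 1 h" by (rule Delta1_fun_if_PR)
  then show "\<exists>f. is_iso B E f \<and> Delta0_fun_in (atomic_diagram B) 1 f" using h(1) by blast
qed

section \<open>Relative Delta-2-categoricity\<close>

text \<open>As in the Rasiowa-Sikorski lemma, finite injective lists are extended so as to meet
  countably many dense sets. Including \<open>n\<close> at step \<open>n\<close> makes the limit
  surjective, and the growing length makes it total.\<close>

lemma generic_bijection:
  fixes D :: "'i :: countable \<Rightarrow> nat list set"
  assumes dense: "\<And>i p. distinct p \<Longrightarrow> \<exists>q\<in>D i. distinct q \<and> prefix p q"
  shows "\<exists>\<pi>. bij \<pi> \<and> (\<forall>i. \<exists>L. map \<pi> [0..<L] \<in> D i)"
proof -
  define step where "step n p p' \<longleftrightarrow> distinct p' \<and> n \<in> set p' \<and> n < length p' \<and>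
    (\<exists>q\<in>D (from_nat n). prefix p q \<and> prefix q p')" for n p p'
  have ex: "\<exists>p'. step n p p'" if "distinct p" for n p
  proof -
    from dense[OF that] obtain q where q: "q \<in> D (from_nat n)" "distinct q" "prefix p q" by blast
    \<comment> \<open>Above \<open>n\<close> and all entries of \<open>q\<close>, so the numbers
      from \<open>M\<close> on are fresh padding.\<close>
    define M where "M = Suc (n + sum_list q)"
    have M: "z < M" if "z \<in> set q" for z using member_le_sum_list[OF that] by (simp add: M_def)
    let ?q = "q @ (if n \<in> set q then [] else [n]) @ [M..<M + Suc n]"
    have "n < M" by (simp add: M_def)
    then have "distinct ?q" using q(2) M by (auto simp del: upt_Suc dest: M)
    then have "step n p ?q" unfolding step_def using q by (auto intro!: bexI[OF _ q(1)])
    then show ?thesis by blast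
  qed
  define S where "S = rec_nat ([] :: nat list) (\<lambda>n p. SOME p'. step n p p')"
  have S: "distinct (S n) \<and> step n (S n) (S (Suc n))" for n
  proof (induction n)
    case 0
    then show ?case using someI_ex[OF ex, of "[]" 0] by (simp add: S_def)
  next
    case (Suc n)
    then have "distinct (S (Suc n))" by (simp add: step_def)
    moreover from this have "step (Suc n) (S (Suc n)) (SOME p'. step (Suc n) (S (Suc n)) p')"
      by (rule someI_ex[OF ex])
    ultimately show ?case by (simp add: S_def)
  qed
  have pre: "prefix (S n) (S m)" if "n \<le> m" for n m
    using that
  proof (induction m rule: dec_induct)
    case (step m)
    then show ?case using S[of m] unfolding step_def by (meson prefix_order.trans)
  qed simp
  define \<pi> where "\<pi> i = S (Suc i) ! i" for i
  have \<pi>: "\<pi> i = S n ! i" if "i < length (S n)" for i n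
  proof -
    have "i < length (S (Suc i))" using S[of i] by (simp add: step_def)
    then show ?thesis unfolding \<pi>_def using pre[of n "Suc i"] pre[of "Suc i" n] that
      by (metis nat_le_linear nth_append prefixE)
  qed
  have mapS: "map \<pi> [0..<length (S n)] = S n" for n
    by (rule nth_equalityI) (simp_all add: \<pi>)
  have "inj \<pi>"
  proof (rule injI)
    fix i j assume eq: "\<pi> i = \<pi> j"
    have "length (S (Suc i)) \<le> length (S (Suc (i + j)))" "length (S (Suc j)) \<le> length (S (Suc (i + j)))"
      by (intro prefix_length_le pre; simp)+
    then have "i < length (S (Suc (i + j)))" "j < length (S (Suc (i + j)))"
      using S[of i] S[of j] by (auto simp: step_def)
    then show "i = j" using eq S[of "Suc (i + j)"] \<pi> by (metis nth_eq_iff_index_eq)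
  qed
  moreover have "surj \<pi>"
    unfolding surj_def
  proof
    fix n
    have "n \<in> set (S (Suc n))" using S[of n] by (simp add: step_def)
    then show "\<exists>i. n = \<pi> i" by (metis \<pi> in_set_conv_nth)
  qed
  moreover have "\<exists>L. map \<pi> [0..<L] \<in> D i" for i
  proof -
    obtain q where q: "q \<in> D i" "prefix q (S (Suc (to_nat i)))"
      using S[of "to_nat i"] by (auto simp: step_def)
    then have "q = take (length q) (S (Suc (to_nat i)))" by (metis append_eq_conv_conj prefixE)
    also have "\<dots> = map \<pi> (take (length q) [0..<length (S (Suc (to_nat i)))])"
      by (subst mapS[symmetric]) (simp only: take_map)
    also have "take (length q) [0..<length (S (Suc (to_nat i)))] = [0..<length q]"
      using prefix_length_le[OF q(2)] by (simp add: take_upt)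
    finally show ?thesis using q(1) by metis
  qed
  ultimately show ?thesis by (auto simp: bij_def)
qed

text \<open>A list \<open>p\<close> of distinct numbers is the condition that the copy is \<open>E (p ! i) (p ! j)\<close>.\<close>

definition agrees :: "(nat \<Rightarrow> nat \<Rightarrow> bool) \<Rightarrow> nat list \<Rightarrow> (nat \<Rightarrow> nat \<Rightarrow> bool) \<Rightarrow> bool" where
  "agrees E p B \<longleftrightarrow> (\<forall>i<length p. \<forall>j<length p. B i j \<longleftrightarrow> E (p ! i) (p ! j))"

text \<open>Finite conditions cannot tell an infinite class from a large enough finite one. Whatever
  an extension \<open>r'\<close> adds to the finite class can be carried back into the infinite
  class of \<open>a\<close>, so \<open>r'\<close> describes the same copies as some extension of
  \<open>r\<close>.\<close>

lemma retarget:
  assumes E: "equivp E"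
    and Hinf: "\<And>F. finite F \<Longrightarrow> \<exists>a. infinite {y. E a y} \<and> (\<forall>x\<in>F. \<not> E x a)"
    and Hfin: "\<And>F n. finite F \<Longrightarrow> \<exists>a. finite {y. E a y} \<and> n \<le> card {y. E a y} \<and> (\<forall>x\<in>F. \<not> E x a)"
    and r: "distinct r" "a \<in> set r" "infinite {y. E a y}"
  shows "\<exists>\<sigma>. distinct (map \<sigma> r) \<and> finite {y. E (\<sigma> a) y} \<and> (\<forall>z. \<not> E a z \<longrightarrow> \<sigma> z = z) \<and>
    (\<forall>r'. distinct r' \<longrightarrow> prefix (map \<sigma> r) r' \<longrightarrow>
      (\<exists>r''. distinct r'' \<and> prefix r r'' \<and> (\<forall>B. agrees E r'' B \<longleftrightarrow> agrees E r' B)))"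
proof -
  have refl: "E x x" and sym: "E x y \<longleftrightarrow> E y x" and trans: "E x y \<Longrightarrow> E y z \<Longrightarrow> E x z" for x y z
    using E by (blast intro: equivp_reflp equivp_symp equivp_transp)+
  define A where "A = set r \<inter> {y. E a y}"
  obtain b where b: "finite {y. E b y}" "card A \<le> card {y. E b y}" "\<And>x. x \<in> set r \<Longrightarrow> \<not> E x b"
    using Hfin[of "set r" "card A"] by auto
  \<comment> \<open>\<open>C\<close> pads \<open>A\<close> to the exact size of the class of
    \<open>b\<close>. An extension may exhaust that class, and all of it must fit back into the
    class of \<open>a\<close>.\<close>
  have "infinite ({y. E a y} - set r)" using r(3) by simp
  from infinite_arbitrarily_large[OF this] obtain C where
    C: "finite C" "card C = card {y. E b y} - card A" "C \<subseteq> {y. E a y} - set r" by blast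
  have AC: "A \<union> C \<subseteq> {y. E a y}" using C(3) by (auto simp: A_def)
  have "card (A \<union> C) = card {y. E b y}"
    using C b(2) by (subst card_Un_disjoint) (auto simp: A_def)
  then obtain h where h: "bij_betw h (A \<union> C) {y. E b y}"
    using finite_same_card_bij[of "A \<union> C" "{y. E b y}"] b(1) C(1) by (auto simp: A_def)
  define \<sigma> where "\<sigma> z = (if E a z then h z else z)" for z
  have \<sigma>b: "E b (\<sigma> z)" if "z \<in> set r" "E a z" for z
    using h that by (auto simp: \<sigma>_def A_def bij_betw_def)
  have "distinct (map \<sigma> r)"
    unfolding distinct_map
  proof (intro conjI r(1) inj_onI)
    fix x y assume xy: "x \<in> set r" "y \<in> set r" "\<sigma> x = \<sigma> y"
    have nb: "\<not> E b z" if "z \<in> set r" for z using b(3)[OF that] sym by blast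
    show "x = y"
    proof (cases "E a x"; cases "E a y")
      assume "E a x" "E a y"
      then show ?thesis using xy h by (auto simp: \<sigma>_def A_def bij_betw_def inj_on_def)
    next
      assume "E a x" "\<not> E a y"
      then show ?thesis using xy \<sigma>b[of x] nb[of y] by (simp add: \<sigma>_def)
    next
      assume "\<not> E a x" "E a y"
      then show ?thesis using xy \<sigma>b[of y] nb[of x] by (simp add: \<sigma>_def)
    next
      assume "\<not> E a x" "\<not> E a y"
      then show ?thesis using xy by (simp add: \<sigma>_def)
    qed
  qed
  moreover have "finite {y. E (\<sigma> a) y}"
  proof -
    have "E b (\<sigma> a)" using \<sigma>b[OF r(2)] refl by blast
    then have "{y. E (\<sigma> a) y} \<subseteq> {y. E b y}" using trans by blast
    then show ?thesis using b(1) finite_subset by blast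
  qed
  moreover have "\<forall>z. \<not> E a z \<longrightarrow> \<sigma> z = z" by (simp add: \<sigma>_def)
  moreover have "\<exists>r''. distinct r'' \<and> prefix r r'' \<and> (\<forall>B. agrees E r'' B \<longleftrightarrow> agrees E r' B)"
    if r': "distinct r'" "prefix (map \<sigma> r) r'" for r'
  proof -
    \<comment> \<open>An extension may meet the class of \<open>a\<close> again. These elements must
      not merge with those coming back from the class of \<open>b\<close>, so they move to another
      infinite class that \<open>r'\<close> avoids.\<close>
    obtain a2 where a2: "infinite {y. E a2 y}" "\<And>x. x \<in> insert a (set r') \<Longrightarrow> \<not> E x a2"
      using Hinf[of "insert a (set r')"] by auto
    obtain k where k: "bij_betw k {y. E a y} {y. E a2 y}" using bij_betw_infinite_nat[OF r(3) a2(1)] by blast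
    define h' where "h' = inv_into (A \<union> C) h"
    have h': "h' z \<in> A \<union> C" "inj_on h' {y. E b y}" if "E b z" for z
      using bij_betw_inv_into[OF h] that unfolding h'_def bij_betw_def by auto
    define \<tau> where "\<tau> z = (if E b z then h' z else if E a z then k z else z)" for z
    have ab: "\<not> E a b" using b(3)[OF r(2)] .
    have \<tau>1: "E a (\<tau> z)" if "E b z" for z using h'(1)[OF that] AC that by (auto simp: \<tau>_def)
    have nab: "\<not> E b z" if "E a z" for z using that ab sym trans by blast
    have \<tau>2: "E a2 (\<tau> z)" if "E a z" for z
      using that nab[OF that] k by (auto simp: \<tau>_def bij_betw_def)
    have \<tau>3: "\<tau> z = z" if "\<not> E a z" "\<not> E b z" for z using that by (simp add: \<tau>_def)
    have naa2: "\<not> E a a2" using a2(2) by simp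
    have na2: "\<not> E z a2" if "z \<in> set r'" for z using a2(2) that by simp
    have iff: "E (\<tau> x) (\<tau> y) \<longleftrightarrow> E x y" if "x \<in> set r'" "y \<in> set r'" for x y
    proof -
      have cls: "(E a z \<and> \<not> E b z \<and> E a2 (\<tau> z)) \<or> (E b z \<and> \<not> E a z \<and> E a (\<tau> z))
          \<or> (\<not> E a z \<and> \<not> E b z \<and> \<tau> z = z)" for z
        using \<tau>1 \<tau>2 \<tau>3 nab by blast
      have "\<not> E x a2" "\<not> E y a2" using na2 that by auto
      then show ?thesis using cls[of x] cls[of y] naa2 ab sym trans by metis
    qed
    have inj: "inj_on \<tau> (set r')"
    proof (rule inj_onI)
      fix x y assume xy: "x \<in> set r'" "y \<in> set r'" "\<tau> x = \<tau> y"
      then have exy: "E x y" using iff[of x y] refl by simp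
      show "x = y"
      proof (cases "E b x")
        case True
        then have "E b y" using exy trans by blast
        then show ?thesis using True xy(3) h'(2) by (auto simp: \<tau>_def dest: inj_onD)
      next
        case nb: False
        then have nby: "\<not> E b y" using exy sym trans by blast
        show ?thesis
        proof (cases "E a x")
          case True
          then have "E a y" using exy trans by blast
          then show ?thesis using True nb nby xy(3) k by (auto simp: \<tau>_def bij_betw_def dest: inj_onD)
        next
          case False
          then have "\<not> E a y" using exy sym trans by blast
          then show ?thesis using False nb nby xy(3) by (simp add: \<tau>_def)
        qed
      qed
    qed
    obtain w where w: "r' = map \<sigma> r @ w" using r'(2) by (rule prefixE)
    have "\<tau> (\<sigma> z) = z" if "z \<in> set r" for z
    proof (cases "E a z")
      case True
      then have "z \<in> A \<union> C" using that by (simp add: A_def)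
      then have "h' (h z) = z" using h unfolding h'_def by (simp add: bij_betw_def)
      then show ?thesis using \<sigma>b[OF that True] True by (simp add: \<tau>_def \<sigma>_def)
    next
      case False
      then show ?thesis using b(3)[OF that] sym by (auto simp: \<tau>_def \<sigma>_def)
    qed
    then have "map \<tau> (map \<sigma> r) = r" by (simp add: map_idI)
    then have "prefix r (map \<tau> r')" unfolding w map_append by (metis prefixI)
    moreover have "distinct (map \<tau> r')" using inj r'(1) by (simp add: distinct_map)
    moreover have "agrees E (map \<tau> r') B \<longleftrightarrow> agrees E r' B" for B
      unfolding agrees_def using iff by (simp add: nth_map)
    ultimately show ?thesis by blast
  qed
  ultimately show ?thesis by blast
qed

text \<open>Forcing with finite conditions. If a condition forces an element of an infinite class to
  be mapped into an infinite class, \<open>retarget\<close> moves the element to a finite class and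
  the same value remains forced. So conditions that defeat a given functional are dense.\<close>

lemma not_relatively_Delta2_categorical:
  assumes E: "equivp E"
    and Hinf: "\<And>F. finite F \<Longrightarrow> \<exists>a. infinite {y. E a y} \<and> (\<forall>x\<in>F. \<not> E x a)"
    and Hfin: "\<And>F n. finite F \<Longrightarrow> \<exists>a. finite {y. E a y} \<and> n \<le> card {y. E a y} \<and> (\<forall>x\<in>F. \<not> E x a)"
  shows "\<not> relatively_Delta0_categorical 2 E"
proof
  assume cat: "relatively_Delta0_categorical 2 E"
  obtain \<Psi> :: "nat \<Rightarrow> (nat \<Rightarrow> nat) \<Rightarrow> nat \<Rightarrow> nat \<Rightarrow> nat \<Rightarrow> nat \<Rightarrow> bool" where
    use: "\<And>k g u w x y. \<exists>N. \<forall>g'. (\<forall>i<N. g' i = g i) \<longrightarrow> \<Psi> k g' u w x y = \<Psi> k g u w x y"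
    and all: "\<And>g f. Delta0_fun_in g 2 f \<Longrightarrow> \<exists>k. \<forall>x y. f x = y \<longleftrightarrow> (\<exists>u. \<forall>w. \<not> \<Psi> k g u w x y)"
    using Delta2_functionals by metis
  \<comment> \<open>In forcing terms, \<open>refutes\<close> says that \<open>p\<close> forces
    \<open>u\<close> not to be a witness for the value \<open>y\<close> at \<open>b\<close>, and
    \<open>never\<close> that no extension does so, that is, that \<open>p\<close> forces
    \<open>u\<close> to be a witness.\<close>
  define refutes where "refutes p k b y u \<longleftrightarrow>
    (\<exists>w. \<forall>B. agrees E p B \<longrightarrow> \<Psi> k (atomic_diagram B) u w b y)" for p k b y u
  define never where "never p k b y u \<longleftrightarrow>
    (\<forall>r. distinct r \<longrightarrow> prefix p r \<longrightarrow> \<not> refutes r k b y u)" for p k b y u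
  \<comment> \<open>Either a value with a class of the wrong kind is forced at some
    \<open>b\<close>, or no extension forces any value at \<open>b\<close>. In both cases functional
    \<open>k\<close> defines no isomorphism on a generic copy.\<close>
  define D1 where "D1 k = {q. \<exists>b<length q.
      (\<exists>y u. finite {z. E (q ! b) z} \<noteq> finite {z. E y z} \<and> never q k b y u) \<or>
      (\<forall>y u r. distinct r \<longrightarrow> prefix q r \<longrightarrow> \<not> never r k b y u)}" for k
  define D2 where "D2 k b y u = {q. refutes q k b y u \<or> never q k b y u}" for k b y u
  define D :: "nat + nat \<times> nat \<times> nat \<times> nat \<Rightarrow> nat list set" where
    "D i = (case i of Inl k \<Rightarrow> D1 k | Inr (k, b, y, u) \<Rightarrow> D2 k b y u)" for i
  have dense1: "\<exists>q\<in>D1 k. distinct q \<and> prefix p q" if p: "distinct p" for k p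
  proof -
    obtain a where a: "infinite {y. E a y}" "\<And>x. x \<in> set p \<Longrightarrow> \<not> E x a" using Hinf[of "set p"] by auto
    have aa: "E a a" using E by (rule equivp_reflp)
    define b where "b = length p"
    have d: "distinct (p @ [a])" using p a(2) aa by auto
    show ?thesis
    proof (cases "\<forall>y u r. distinct r \<longrightarrow> prefix (p @ [a]) r \<longrightarrow> \<not> never r k b y u")
      case True
      then have "p @ [a] \<in> D1 k" unfolding D1_def b_def by auto
      then show ?thesis using d by (intro bexI[of _ "p @ [a]"]) auto
    next
      case False
      then obtain y u r where r: "distinct r" "prefix (p @ [a]) r" "never r k b y u" by blast
      obtain w where w: "r = p @ a # w" using r(2) by (auto elim: prefixE)
      have b: "b < length r" "r ! b = a" by (simp_all add: w b_def)
      show ?thesis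
      proof (cases "finite {z. E y z}")
        case True
        then have "r \<in> D1 k" unfolding D1_def using b a(1) r(3) by auto
        then show ?thesis using r(1) w by (intro bexI[of _ r]) auto
      next
        case y: False
        have "a \<in> set r" by (simp add: w)
        from retarget[OF E Hinf Hfin r(1) this a(1)] obtain \<sigma> where
          \<sigma>: "distinct (map \<sigma> r)" "finite {y. E (\<sigma> a) y}" "\<And>z. \<not> E a z \<Longrightarrow> \<sigma> z = z"
            "\<And>r'. distinct r' \<Longrightarrow> prefix (map \<sigma> r) r' \<Longrightarrow>
              \<exists>r''. distinct r'' \<and> prefix r r'' \<and> (\<forall>B. agrees E r'' B \<longleftrightarrow> agrees E r' B)"
          by blast
        \<comment> \<open>\<open>refutes\<close> depends only on the copies that agree with the
          condition, so a refuting extension of the new condition would yield one of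
          \<open>r\<close>.\<close>
        have "never (map \<sigma> r) k b y u"
          unfolding never_def
        proof (intro allI impI)
          fix r' assume "distinct r'" "prefix (map \<sigma> r) r'"
          from \<sigma>(4)[OF this] obtain r'' where r'': "distinct r''" "prefix r r''"
            "\<And>B. agrees E r'' B \<longleftrightarrow> agrees E r' B" by blast
          have "\<not> refutes r'' k b y u" using r(3) r''(1,2) unfolding never_def by blast
          then show "\<not> refutes r' k b y u" unfolding refutes_def r''(3) .
        qed
        moreover have "b < length (map \<sigma> r)" "map \<sigma> r ! b = \<sigma> a" using b by auto
        moreover have "finite {z. E (\<sigma> a) z} \<noteq> finite {z. E y z}" using \<sigma>(2) y by blast
        ultimately have "map \<sigma> r \<in> D1 k" unfolding D1_def by (intro CollectI exI[of _ b]) metis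
        moreover have "map \<sigma> p = p"
          using a(2) \<sigma>(3) equivp_symp[OF E] by (intro map_idI) blast
        then have "prefix p (map \<sigma> r)" unfolding w map_append by (metis prefixI)
        ultimately show ?thesis using \<sigma>(1) by blast
      qed
    qed
  qed
  have "\<exists>q\<in>D i. distinct q \<and> prefix p q" if p: "distinct p" for i p
  proof (cases i)
    case (Inl k)
    then show ?thesis using dense1[OF p] by (simp add: D_def)
  next
    case (Inr j)
    obtain k b y u where j: "j = (k, b, y, u)" by (cases j)
    show ?thesis
    proof (cases "never p k b y u")
      case True
      then show ?thesis using p Inr j by (auto simp: D_def D2_def)
    next
      case False
      then show ?thesis unfolding never_def using Inr j by (auto simp: D_def D2_def)
    qed
  qed
  from generic_bijection[of D, OF this] obtain \<pi> where
    \<pi>: "bij \<pi>" "\<And>i. \<exists>L. map \<pi> [0..<L] \<in> D i" by blast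
  define B where "B i j \<longleftrightarrow> E (\<pi> i) (\<pi> j)" for i j
  let ?g = "atomic_diagram B"
  have iso: "is_iso B E \<pi>" unfolding is_iso_def B_def using \<pi>(1) by blast
  then have "isomorphic B E" unfolding isomorphic_def by blast
  then obtain f where f: "is_iso B E f" "Delta0_fun_in ?g 2 f"
    using cat unfolding relatively_Delta0_categorical_def by blast
  obtain k where k: "\<And>x y. f x = y \<longleftrightarrow> (\<exists>u. \<forall>w. \<not> \<Psi> k ?g u w x y)" using all[OF f(2)] by blast
  have agB: "agrees E (map \<pi> [0..<L]) B" for L by (simp add: agrees_def B_def)
  have dist: "distinct (map \<pi> [0..<L])" for L
    using inj_on_subset[OF bij_is_inj[OF \<pi>(1)]] by (simp add: distinct_map)
  have pre: "prefix (map \<pi> [0..<L]) (map \<pi> [0..<M])" if "L \<le> M" for L M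
    using that by (intro map_mono_prefix) (metis le_Suc_ex prefixI upt_add_eq_append zero_le)
  have ref: "\<exists>N. \<forall>L\<ge>N. refutes (map \<pi> [0..<L]) k b y u" if psi: "\<Psi> k ?g u w b y" for u w b y
  proof -
    obtain N where N: "\<And>g'. \<forall>i<N. g' i = ?g i \<Longrightarrow> \<Psi> k g' u w b y = \<Psi> k ?g u w b y"
      using use[of ?g k u w b y] by blast
    have "refutes (map \<pi> [0..<L]) k b y u" if "L \<ge> N" for L
      unfolding refutes_def
    proof (intro exI[of _ w] allI impI)
      fix B' assume B': "agrees E (map \<pi> [0..<L]) B'"
      \<comment> \<open>Query \<open>i\<close> concerns the numbers \<open>dfst i\<close> and
        \<open>dsnd i\<close>, which are at most \<open>i\<close>, so a condition of length at least
        \<open>N\<close> answers it.\<close>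
      have "\<forall>i<N. atomic_diagram B' i = ?g i"
      proof (intro allI impI)
        fix i assume "i < N"
        then have "dfst i < L" "dsnd i < L" using \<open>L \<ge> N\<close> dfst_le[of i] dsnd_le[of i] by auto
        then have "B' (dfst i) (dsnd i) \<longleftrightarrow> B (dfst i) (dsnd i)"
          using B' unfolding agrees_def B_def by simp
        then show "atomic_diagram B' i = ?g i"
          by (simp add: atomic_diagram_def case_prod_beta dfst_def dsnd_def)
      qed
      then show "\<Psi> k (atomic_diagram B') u w b y" using N psi by blast
    qed
    then show ?thesis by blast
  qed
  have never_imp: "f b = y" if nev: "never (map \<pi> [0..<L]) k b y u" for L b y u
  proof -
    have "\<not> \<Psi> k ?g u w b y" for w
    proof
      assume "\<Psi> k ?g u w b y"
      from ref[OF this] obtain N where "\<And>M. M \<ge> N \<Longrightarrow> refutes (map \<pi> [0..<M]) k b y u" by blast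
      then have "refutes (map \<pi> [0..<L + N]) k b y u" by simp
      then show False using nev dist[of "L + N"] pre[of L "L + N"] unfolding never_def by auto
    qed
    then show ?thesis using k[of b y] by blast
  qed
  obtain L where "map \<pi> [0..<L] \<in> D1 k" using \<pi>(2)[of "Inl k"] by (auto simp: D_def)
  then obtain b where bL: "b < length (map \<pi> [0..<L])" and b:
    "(\<exists>y u. finite {z. E (map \<pi> [0..<L] ! b) z} \<noteq> finite {z. E y z} \<and> never (map \<pi> [0..<L]) k b y u) \<or>
      (\<forall>y u r. distinct r \<longrightarrow> prefix (map \<pi> [0..<L]) r \<longrightarrow> \<not> never r k b y u)"
    unfolding D1_def by blast
  have nth: "map \<pi> [0..<L] ! b = \<pi> b" using bL by simp
  from b[unfolded nth] show False
  proof
    assume "\<exists>y u. finite {z. E (\<pi> b) z} \<noteq> finite {z. E y z} \<and> never (map \<pi> [0..<L]) k b y u"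
    then obtain y u where y: "finite {z. E (\<pi> b) z} \<noteq> finite {z. E y z}"
      "never (map \<pi> [0..<L]) k b y u" by blast
    have "f b = y" by (rule never_imp[OF y(2)])
    then have "esz {z. E y z} = esz {z. E (\<pi> b) z}"
      using is_iso_class_size[OF f(1), of b] is_iso_class_size[OF iso, of b] by simp
    then show False using y(1) by (auto simp: esz_def split: if_splits)
  next
    assume nn: "\<forall>y u r. distinct r \<longrightarrow> prefix (map \<pi> [0..<L]) r \<longrightarrow> \<not> never r k b y u"
    \<comment> \<open>The true value \<open>f b\<close> has a witness. A condition in
      \<open>D2\<close> decides it and cannot refute it, so some longer condition forces
      \<open>f b\<close>, against the second alternative.\<close>
    obtain u where u: "\<And>w. \<not> \<Psi> k ?g u w b (f b)" using k[of b "f b"] by blast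
    obtain M where "map \<pi> [0..<M] \<in> D2 k b (f b) u" using \<pi>(2)[of "Inr (k, b, f b, u)"] by (auto simp: D_def)
    then consider "refutes (map \<pi> [0..<M]) k b (f b) u" | "never (map \<pi> [0..<M]) k b (f b) u"
      unfolding D2_def by blast
    then show False
    proof cases
      case 1
      then show False using agB u unfolding refutes_def by blast
    next
      case 2
      have "never (map \<pi> [0..<L + M]) k b (f b) u"
        using 2 pre[of M "L + M"] unfolding never_def by (meson le_add2 prefix_order.trans)
      then show False using nn dist[of "L + M"] pre[of L "L + M"] by auto
    qed
  qed
qed

section \<open>The categoricity spectrum\<close>

lemma finite_multiple_classes:
  assumes E: "equivp E" and inf: "infinite {x \<in> reps E. P {y. E x y}}" and F: "finite F"
  shows "\<exists>a. P {y. E a y} \<and> (\<forall>x\<in>F. \<not> E x a)"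
proof -
  have "finite (cmin E ` F)" using F by simp
  then obtain a where a: "a \<in> reps E" "P {y. E a y}" "a \<notin> cmin E ` F"
    using inf by (metis (mono_tags, lifting) finite_subset mem_Collect_eq subsetI)
  have "\<not> E x a" if "x \<in> F" for x
    using a(1,3) that cmin_props(4)[OF E, of x a] by (auto simp: reps_def)
  then show ?thesis using a(2) by blast
qed

lemma sizes_if_relatively_Delta2_categorical:
  assumes E: "equivp E" and cat: "relatively_Delta0_categorical 2 E"
    and inf: "infinite {x \<in> reps E. infinite {y. E x y}}"
  shows "\<exists>v. \<forall>x. finite {y. E x y} \<longrightarrow> card {y. E x y} \<le> v"
proof (rule ccontr)
  assume unb: "\<not> ?thesis"
  have "\<exists>a. finite {y. E a y} \<and> n \<le> card {y. E a y} \<and> (\<forall>x\<in>F. \<not> E x a)" if F: "finite F" for F n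
  proof -
    \<comment> \<open>A class larger than the sum of the sizes of the classes of \<open>F\<close> is
      none of these; infinite classes contribute 0 to the sum, which is also their
      \<open>card\<close>.\<close>
    obtain a where a: "finite {y. E a y}" "n + (\<Sum>x\<in>F. card {y. E x y}) < card {y. E a y}"
      using unb by (meson not_le)
    have "\<not> E x a" if x: "x \<in> F" for x
    proof
      assume "E x a"
      then have "E x = E a" using E by (simp add: equivp_def)
      then have "card {y. E a y} \<le> (\<Sum>x\<in>F. card {y. E x y})"
        using member_le_sum[of x F "\<lambda>x. card {y. E x y}"] x F by simp
      then show False using a(2) by simp
    qed
    then show ?thesis using a by (intro exI[of _ a]) auto
  qed
  moreover have "\<exists>a. infinite {y. E a y} \<and> (\<forall>x\<in>F. \<not> E x a)" if "finite F" for F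
    by (rule finite_multiple_classes[OF E inf that])
  ultimately show False using not_relatively_Delta2_categorical[OF E] cat by blast
qed

theorem theorem2p2:
  fixes E :: "nat \<Rightarrow> nat \<Rightarrow> bool"
  assumes "punctual_equivalence_structure E"
    and "relatively_Delta0_categorical 2 E"
    and "\<not> relatively_Delta0_categorical 1 E"
  shows "PrCat E = Cone_Delta0 2"
proof
  show "Cone_Delta0 2 \<subseteq> PrCat E" by (rule Cone_subset_PrCat[OF assms(2)])
  have E: "equivp E" "punctual E" using assms(1) unfolding punctual_equivalence_structure_def by auto
  \<comment> \<open>Otherwise all but finitely many classes have size \<open>K\<close>, and the
    structure is relatively Delta-1-categorical.\<close>
  have many: "infinite {x \<in> reps E. esz {y. E x y} \<noteq> K}" for K
    using relatively_Delta1_categorical[OF E, of K] assms(3) by blast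
  have reps: "infinite (reps E)"
    using many[of 0] by (rule contrapos_nn) (auto intro: finite_subset)
  define k where "k x = pos (reps E) (cmin E x)" for x
  have size: "esz {y. E x y} = eSuc (ssize (elab E) (k x))" for x
    unfolding k_def by (rule class_size_elab[OF E(1) reps])
  \<comment> \<open>Ranks number the classes bijectively, so that counts of classes can be carried
    from representatives in \<open>E\<close> to labels of \<open>srel (elab E)\<close>.\<close>
  have classes: "infinite {x \<in> reps E. P (ssize (elab E) (k x))} \<longleftrightarrow> infinite {k. P (ssize (elab E) k)}" for P
  proof -
    have "bij_betw k {x \<in> reps E. P (ssize (elab E) (k x))} {k. P (ssize (elab E) k)}"
      unfolding bij_betw_def
    proof (intro conjI inj_onI equalityI subsetI)
      fix x y assume "x \<in> {x \<in> reps E. P (ssize (elab E) (k x))}" "y \<in> {x \<in> reps E. P (ssize (elab E) (k x))}" "k x = k y"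
      then show "x = y" using rank_props(1)[OF E(1) reps, of x y] cmin_props(4)[OF E(1), of x y]
        unfolding k_def by (auto simp: reps_def)
    next
      fix j assume "j \<in> {k. P (ssize (elab E) k)}"
      then show "j \<in> k ` {x \<in> reps E. P (ssize (elab E) (k x))}"
        using rank_props(2)[OF E(1) reps, of j] unfolding k_def by auto
    qed auto
    then show ?thesis using bij_betw_finite by blast
  qed
  show "PrCat E \<subseteq> Cone_Delta0 2"
  proof (rule PrCat_subset_Cone_sizes[of "elab E"])
    show "PR (\<lambda>_. 0) (\<lambda>e. elab E (e 0))" using E(2) by (intro PR_elab) (simp add: punctual_iff_PR)
    show "isomorphic (srel (elab E)) E" by (rule isomorphic_sym[OF isomorphic_srel_elab[OF E(1) reps]])
    show "infinite {k. ssize (elab E) k \<noteq> K}" for K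
      using many[of "eSuc K"] classes[of "\<lambda>n. n \<noteq> K"] unfolding size by simp
    assume "infinite {k. ssize (elab E) k = \<infinity>}"
    moreover have "infinite {y. E x y} \<longleftrightarrow> ssize (elab E) (k x) = \<infinity>" for x
      using size[of x] by (auto simp: esz_def eSuc_def split: if_splits enat.splits)
    ultimately have "infinite {x \<in> reps E. infinite {y. E x y}}"
      using classes[of "\<lambda>n. n = \<infinity>"] by simp
    from sizes_if_relatively_Delta2_categorical[OF E(1) assms(2) this]
    obtain v where v: "\<And>x. finite {y. E x y} \<Longrightarrow> card {y. E x y} \<le> v" by blast
    have "ssize (elab E) j \<le> enat v" if j: "ssize (elab E) j \<noteq> \<infinity>" for j
    proof -
      obtain x where x: "k x = j" using rank_props(2)[OF E(1) reps, of j] unfolding k_def by blast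
      have s: "esz {y. E x y} = eSuc (ssize (elab E) j)" using size[of x] x by simp
      then have "finite {y. E x y}" using j by (auto simp: esz_def eSuc_def split: if_splits enat.splits)
      then have "eSuc (ssize (elab E) j) \<le> enat v" using s v[of x] by (simp add: esz_def flip: s)
      then show ?thesis using ile_eSuc order.trans by blast
    qed
    then show "\<exists>v. \<forall>k. ssize (elab E) k \<noteq> \<infinity> \<longrightarrow> ssize (elab E) k \<le> enat v" by blast
  qed
qed

end
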